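(* Let $t=(\mathcal{G},\sigma,\Omega)$ be a symplectic symmetric triple which is not solvable, not semisimple, and without semisimple factor. Let $\mathcal{G}=\mathcal{K}\oplus\mathcal{P}$ be its canonical decomposition, $\mathcal{R}$ the radical of $\mathcal{G}$ and $\mathcal{P}_{\mathcal{R}}=\mathcal{P}\cap\mathcal{R}$. Then $\dim t=4$ if and only if $\dim\mathcal{P}_{\mathcal{R}}=2$.
   Context: A symplectic symmetric triple is a triple $t=(\mathcal{G},\sigma,\Omega)$ where: (i) $\mathcal{G}$ is a finite-dimensional real Lie algebra; (ii) $\sigma$ is an involutive automorphism of $\mathcal{G}$ such that, writing $\mathcal{G}=\mathcal{K}\oplus\mathcal{P}$ with $\sigma=\mathrm{id}_{\mathcal{K}}\oplus(-\mathrm{id}_{\mathcal{P}})$ (canonical decomposition), one has $[\mathcal{P},\mathcal{P}]=\mathcal{K}$ and $\mathcal{K}$ acts faithfully on $\mathcal{P}$; (iii) $\Omega$ is a $\mathcal{K}$-invariant symplectic form on $\mathcal{P}$. The dimension of $t$ is $\dim t=\dim\mathcal{P}$. $t$ is solvable (resp. semisimple) if $\mathcal{G}$ is. Direct sums of triples are defined in the obvious way (with orthogonal direct sum of forms). A semisimple factor of $t$ is a non-zero triple $t_{\mathcal{L}}$ with semisimple Lie algebra such that $t=t_{\mathcal{L}}\oplus t_1$ for some triple $t_1$. *)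

theory Defs
  imports "HOL-Analysis.Analysis"
begin

text \<open>
  All structures are carried by a subspace \<open>V\<close> of an arbitrary real vector space type; functions
  (bracket, involution, form) are constrained only on the relevant subspaces and their values
  elsewhere are irrelevant.  A sub-object is thus given by its carrier alone, with the same
  functions.
\<close>

definition linear_on :: "'a::real_vector set \<Rightarrow> ('a \<Rightarrow> 'b::real_vector) \<Rightarrow> bool" where
  "linear_on V f \<longleftrightarrow>
     (\<forall>x\<in>V. \<forall>y\<in>V. f (x + y) = f x + f y) \<and> (\<forall>c. \<forall>x\<in>V. f (c *\<^sub>R x) = c *\<^sub>R f x)"

definition bilinear_on :: "'a::real_vector set \<Rightarrow> ('a \<Rightarrow> 'a \<Rightarrow> 'b::real_vector) \<Rightarrow> bool" where
  "bilinear_on V f \<longleftrightarrow>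
     (\<forall>y\<in>V. linear_on V (\<lambda>x. f x y)) \<and> (\<forall>x\<in>V. linear_on V (\<lambda>y. f x y))"

subsection \<open>Finite-dimensional real Lie algebras\<close>

locale fd_lie_algebra =
  fixes V :: "'a::real_vector set" and br :: "'a \<Rightarrow> 'a \<Rightarrow> 'a"
  assumes subspace_carrier: "subspace V"
    and finite_dimensional: "\<exists>B. finite B \<and> span B = V"
    and bracket_closed: "\<lbrakk>x \<in> V; y \<in> V\<rbrakk> \<Longrightarrow> br x y \<in> V"
    and bracket_bilinear: "bilinear_on V br"
    and bracket_alternating: "x \<in> V \<Longrightarrow> br x x = 0"
    and jacobi: "\<lbrakk>x \<in> V; y \<in> V; z \<in> V\<rbrakk> \<Longrightarrow>
                   br x (br y z) + br y (br z x) + br z (br x y) = 0"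

definition lie_bracket_span :: "('a::real_vector \<Rightarrow> 'a \<Rightarrow> 'a) \<Rightarrow> 'a set \<Rightarrow> 'a set \<Rightarrow> 'a set" where
  "lie_bracket_span br A B = span {br x y | x y. x \<in> A \<and> y \<in> B}"

primrec lie_derived_series :: "('a::real_vector \<Rightarrow> 'a \<Rightarrow> 'a) \<Rightarrow> 'a set \<Rightarrow> nat \<Rightarrow> 'a set" where
  "lie_derived_series br V 0 = V"
| "lie_derived_series br V (Suc n) =
     lie_bracket_span br (lie_derived_series br V n) (lie_derived_series br V n)"

definition lie_solvable :: "'a::real_vector set \<Rightarrow> ('a \<Rightarrow> 'a \<Rightarrow> 'a) \<Rightarrow> bool" where
  "lie_solvable V br \<longleftrightarrow> (\<exists>n. lie_derived_series br V n = {0})"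

definition lie_ideal :: "'a::real_vector set \<Rightarrow> ('a \<Rightarrow> 'a \<Rightarrow> 'a) \<Rightarrow> 'a set \<Rightarrow> bool" where
  "lie_ideal V br I \<longleftrightarrow> subspace I \<and> I \<subseteq> V \<and> (\<forall>x\<in>V. \<forall>y\<in>I. br x y \<in> I)"

text \<open>The sum of all solvable ideals; in finite dimension this is the largest solvable ideal.\<close>

definition lie_radical :: "'a::real_vector set \<Rightarrow> ('a \<Rightarrow> 'a \<Rightarrow> 'a) \<Rightarrow> 'a set" where
  "lie_radical V br = span (\<Union>{I. lie_ideal V br I \<and> lie_solvable I br})"

definition lie_semisimple :: "'a::real_vector set \<Rightarrow> ('a \<Rightarrow> 'a \<Rightarrow> 'a) \<Rightarrow> bool" where
  "lie_semisimple V br \<longleftrightarrow> lie_radical V br = {0}"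

definition lie_automorphism ::
  "'a::real_vector set \<Rightarrow> ('a \<Rightarrow> 'a \<Rightarrow> 'a) \<Rightarrow> ('a \<Rightarrow> 'a) \<Rightarrow> bool" where
  "lie_automorphism V br f \<longleftrightarrow>
     linear_on V f \<and> bij_betw f V V \<and> (\<forall>x\<in>V. \<forall>y\<in>V. f (br x y) = br (f x) (f y))"

subsection \<open>Symplectic symmetric triples\<close>

text \<open>The summands \<open>\<K>\<close> and \<open>\<P>\<close> of the canonical decomposition.\<close>

definition fixed_part :: "'a::real_vector set \<Rightarrow> ('a \<Rightarrow> 'a) \<Rightarrow> 'a set" where
  "fixed_part V \<sigma> = {x \<in> V. \<sigma> x = x}"

definition anti_part :: "'a::real_vector set \<Rightarrow> ('a \<Rightarrow> 'a) \<Rightarrow> 'a set" where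
  "anti_part V \<sigma> = {x \<in> V. \<sigma> x = - x}"

definition symplectic_form_on :: "'a::real_vector set \<Rightarrow> ('a \<Rightarrow> 'a \<Rightarrow> real) \<Rightarrow> bool" where
  "symplectic_form_on P \<Omega> \<longleftrightarrow>
     bilinear_on P \<Omega> \<and> (\<forall>x\<in>P. \<Omega> x x = 0) \<and> (\<forall>x\<in>P. (\<forall>y\<in>P. \<Omega> x y = 0) \<longrightarrow> x = 0)"

locale symplectic_symmetric_triple = fd_lie_algebra V br
  for V :: "'a::real_vector set" and br :: "'a \<Rightarrow> 'a \<Rightarrow> 'a" +
  fixes \<sigma> :: "'a \<Rightarrow> 'a" and \<Omega> :: "'a \<Rightarrow> 'a \<Rightarrow> real"
  assumes automorphism: "lie_automorphism V br \<sigma>"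
    and involutive: "x \<in> V \<Longrightarrow> \<sigma> (\<sigma> x) = x"
    and bracket_anti_part: "lie_bracket_span br (anti_part V \<sigma>) (anti_part V \<sigma>) = fixed_part V \<sigma>"
    and faithful: "\<lbrakk>k \<in> fixed_part V \<sigma>; \<And>p. p \<in> anti_part V \<sigma> \<Longrightarrow> br k p = 0\<rbrakk> \<Longrightarrow> k = 0"
    and symplectic: "symplectic_form_on (anti_part V \<sigma>) \<Omega>"
    and invariant: "\<lbrakk>k \<in> fixed_part V \<sigma>; x \<in> anti_part V \<sigma>; y \<in> anti_part V \<sigma>\<rbrakk> \<Longrightarrow>
                      \<Omega> (br k x) y + \<Omega> x (br k y) = 0"

definition triple_dim :: "'a::real_vector set \<Rightarrow> ('a \<Rightarrow> 'a) \<Rightarrow> nat" where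
  "triple_dim V \<sigma> = dim (anti_part V \<sigma>)"

text \<open>
  Internal direct sum \<open>t = t\<^sub>1 \<oplus> t\<^sub>2\<close> of the triples with carriers \<open>V\<^sub>1\<close>, \<open>V\<^sub>2\<close> inside the triple
  with carrier \<open>V\<close>: the addition map is a linear bijection from \<open>V\<^sub>1 \<times> V\<^sub>2\<close> to \<open>V\<close>, the two
  summands commute, and their \<open>\<P>\<close>-parts are \<open>\<Omega>\<close>-orthogonal.  That \<open>\<sigma>\<close> preserves both summands
  is part of their being triples.
\<close>

definition triple_direct_sum ::
  "'a::real_vector set \<Rightarrow> ('a \<Rightarrow> 'a \<Rightarrow> 'a) \<Rightarrow> ('a \<Rightarrow> 'a) \<Rightarrow> ('a \<Rightarrow> 'a \<Rightarrow> real)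
     \<Rightarrow> 'a set \<Rightarrow> 'a set \<Rightarrow> bool" where
  "triple_direct_sum V br \<sigma> \<Omega> V\<^sub>1 V\<^sub>2 \<longleftrightarrow>
     symplectic_symmetric_triple V\<^sub>1 br \<sigma> \<Omega> \<and> symplectic_symmetric_triple V\<^sub>2 br \<sigma> \<Omega> \<and>
     V = {x + y | x y. x \<in> V\<^sub>1 \<and> y \<in> V\<^sub>2} \<and> V\<^sub>1 \<inter> V\<^sub>2 = {0} \<and>
     (\<forall>x\<in>V\<^sub>1. \<forall>y\<in>V\<^sub>2. br x y = 0) \<and>
     (\<forall>x\<in>anti_part V\<^sub>1 \<sigma>. \<forall>y\<in>anti_part V\<^sub>2 \<sigma>. \<Omega> x y = 0)"

definition semisimple_factor ::
  "'a::real_vector set \<Rightarrow> ('a \<Rightarrow> 'a \<Rightarrow> 'a) \<Rightarrow> ('a \<Rightarrow> 'a) \<Rightarrow> ('a \<Rightarrow> 'a \<Rightarrow> real) \<Rightarrow> 'a set \<Rightarrow> bool" where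
  "semisimple_factor V br \<sigma> \<Omega> L \<longleftrightarrow>
     L \<noteq> {0} \<and> lie_semisimple L br \<and> (\<exists>V\<^sub>1. triple_direct_sum V br \<sigma> \<Omega> L V\<^sub>1)"

end

theory Submission
  imports
    Defs
    "Jordan_Normal_Form.Jordan_Normal_Form_Existence"
    "HOL-Library.Function_Algebras"
begin

text \<open>
  Let \<open>K\<close> and \<open>P\<close> be the summands of the canonical decomposition. Besides
  \<open>\<Omega>\<close> the argument uses a second form \<open>\<beta>\<close>: the Killing form of the
  semisimple quotient of the Lie algebra by its radical \<open>R\<close>, pulled back. Both forms are invariant
  under \<open>K\<close>; \<open>\<Omega>\<close> is nondegenerate on \<open>P\<close>, and the kernel of
  \<open>\<beta>\<close> is exactly \<open>R\<close> (Cartan's criterion, proved here from a trace argument for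
  complex matrices and Engel's theorem, see \<open>exists_radical_form\<close>). Comparing the two forms replaces
  every use of a Levi decomposition. Write \<open>PR\<close> for \<open>P \<inter> R\<close> and
  \<open>U\<close> for its \<open>\<Omega>\<close>-orthogonal in \<open>P\<close>.

  If \<open>PR = 0\<close>, then \<open>K \<inter> R\<close> kills \<open>P\<close> and the algebra is semisimple.  If \<open>PR\<close> has codimension at most
  one in \<open>P\<close>, then all brackets of \<open>P\<close> lie in \<open>R\<close> and the algebra is solvable.  The radical part is
  never a line either (\<open>PR_not_line\<close>).  So \<open>dim P = 4\<close> forces \<open>dim PR = 2\<close>.

  Conversely let \<open>dim PR = 2\<close>.  The way to use the absence of semisimple factors is
  \<open>no_semisimple_factor_complement\<close>: if \<open>W\<close> contains \<open>PR\<close>, satisfies \<open>P = W + U\<close> and \<open>W \<inter> U \<subseteq> PR\<close>, and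
  commutes with \<open>U\<close> modulo \<open>R\<close>, then \<open>P = W\<close>; otherwise \<open>[[U,U],U]\<close> would generate a semisimple factor.
  If \<open>\<Omega>\<close> is nondegenerate on \<open>PR\<close>, the choice \<open>W = PR\<close> gives \<open>P \<subseteq> R\<close> and hence solvability.  If not,
  then \<open>PR\<close> is isotropic, since it is a plane.  Now let \<open>W\<close> consist of the vectors that \<open>\<beta>\<close> identifies
  with functionals \<open>\<Omega> r\<close> for \<open>r \<in> PR\<close>.  Modulo \<open>PR\<close> it is a copy of \<open>PR\<close>, and its \<open>\<beta>\<close>-orthogonal is
  \<open>U\<close>.  As soon as \<open>W \<inter> U \<subseteq> PR\<close> is known, it follows that \<open>P = W\<close> has dimension \<open>2 + 2\<close>.

  The remaining inclusion is the heart of the proof.  A \<open>K\<close>-stable, \<open>\<beta>\<close>-isotropic subspace \<open>Y\<close> with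
  \<open>[[Y,P],Y]\<close> in \<open>R\<close> lies in \<open>R\<close> itself, because \<open>[Y,P]\<close> lowers the flag formed by \<open>Y\<close>, its
  \<open>\<beta>\<close>-orthogonal and \<open>P\<close>, and is therefore invisible to the Killing form
  (\<open>\<beta>_isotropic_flag_in_radical\<close>).  This applies to \<open>W \<inter> U\<close> when \<open>\<Omega>\<close> vanishes on it.  When it does not,
  then \<open>W \<subseteq> U\<close>, and modulo \<open>PR\<close> the space \<open>W\<close> is a symplectic plane which carries a \<open>K\<close>-invariant
  symmetric quartic form.  Operators in \<open>K\<close> built from the quartic itself force it to be zero or the
  fourth power of a linear form, and its nonzero kernel contradicts the flag argument
  (\<open>quartic_contradiction\<close>).
\<close>

hide_const (open) VectorSpace.subspace

section \<open>Generalized eigencomponents in invariant subspaces\<close>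

context vector_space
begin

text \<open>
  The polynomials \<open>(t - a)^m\<close> and \<open>(t - b)^n\<close> are coprime, so \<open>v\<close> is a combination of the two given
  vectors.  Induction on \<open>m + n\<close> makes this explicit without polynomial arithmetic: both
  \<open>T v - a v\<close> and \<open>T v - b v\<close> lie in \<open>M\<close>, and so does their difference.
\<close>
lemma power_shift_in_subspace:
  assumes T: "Vector_Spaces.linear scale scale T" and M: "subspace M" and TM: "\<And>x. x \<in> M \<Longrightarrow> T x \<in> M"
    and "a \<noteq> b"
    and "((\<lambda>x. T x - scale a x) ^^ m) v \<in> M" "((\<lambda>x. T x - scale b x) ^^ n) v \<in> M"
  shows "v \<in> M"
  using assms(5,6)
proof (induction "m + n" arbitrary: m n v rule: less_induct)
  case less
  interpret T: Vector_Spaces.linear scale scale T by (rule T)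
  define S where "S c = (\<lambda>x. T x - scale c x)" for c
  have SM: "S c x \<in> M" if "x \<in> M" for c x
    unfolding S_def using that by (intro subspace_diff[OF M] subspace_scale[OF M] TM)
  have comm: "S c (S d x) = S d (S c x)" for c d x
    by (simp add: S_def T.diff T.scale scale_right_diff_distrib algebra_simps)
  have comm': "(S c ^^ k) (S d x) = S d ((S c ^^ k) x)" for c d k x
    by (induction k) (auto simp: comm)
  show ?case
  proof (cases "m = 0 \<or> n = 0")
    case True
    then show ?thesis using less.prems by auto
  next
    case False
    then obtain m' n' where mn: "m = Suc m'" "n = Suc n'" by (metis not0_implies_Suc)
    have prem: "(S a ^^ Suc m') v \<in> M" "(S b ^^ Suc n') v \<in> M"
      using less.prems mn by (simp_all add: S_def)
    have 1: "S a v \<in> M"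
    proof (rule less.hyps[of m' n])
      show "m' + n < m + n" using mn by simp
      show "((\<lambda>x. T x - scale a x) ^^ m') (S a v) \<in> M" using prem(1) by (simp add: S_def[symmetric] comm')
      show "((\<lambda>x. T x - scale b x) ^^ n) (S a v) \<in> M" using SM[OF prem(2)] mn by (simp only: S_def[symmetric] comm')
    qed
    have 2: "S b v \<in> M"
    proof (rule less.hyps[of m n'])
      show "m + n' < m + n" using mn by simp
      show "((\<lambda>x. T x - scale a x) ^^ m) (S b v) \<in> M" using SM[OF prem(1)] mn by (simp only: S_def[symmetric] comm')
      show "((\<lambda>x. T x - scale b x) ^^ n') (S b v) \<in> M" using prem(2) by (simp add: S_def[symmetric] comm')
    qed
    have "S a v - S b v = scale (b - a) v"
      by (simp add: S_def algebra_simps)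
    then have "scale (b - a) v \<in> M" using subspace_diff[OF M 1 2] by simp
    then have "scale (inverse (b - a)) (scale (b - a) v) \<in> M" by (rule subspace_scale[OF M])
    then show ?thesis using \<open>a \<noteq> b\<close> by simp
  qed
qed

text \<open>
  Membership in \<open>M\<close>, rather than vanishing, is what the nilpotency hypothesis asks for; this is the form that
  survives the induction over \<open>F\<close>.
\<close>
lemma generalized_eigencomponents_in_subspace:
  assumes T: "Vector_Spaces.linear scale scale T" and M: "subspace M" and TM: "\<And>x. x \<in> M \<Longrightarrow> T x \<in> M"
    and "finite F" "\<And>a. a \<in> F \<Longrightarrow> ((\<lambda>x. T x - scale a x) ^^ n) (v a) \<in> M"
    and "(\<Sum>a\<in>F. v a) \<in> M" "a \<in> F"
  shows "v a \<in> M"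
  using assms(4-7)
proof (induction F arbitrary: v a rule: finite_induct)
  case empty
  then show ?case by simp
next
  case (insert c F)
  interpret T: Vector_Spaces.linear scale scale T by (rule T)
  define S where "S d = (\<lambda>x. T x - scale d x)" for d
  have SM: "S d x \<in> M" if "x \<in> M" for d x
    unfolding S_def using that by (intro subspace_diff[OF M] subspace_scale[OF M] TM)
  have SnM: "(S d ^^ k) x \<in> M" if "x \<in> M" for d k x
    using that by (induction k) (auto simp: SM)
  have comm: "S d (S e x) = S e (S d x)" for d e x
    by (simp add: S_def T.diff T.scale scale_right_diff_distrib algebra_simps)
  have comm': "(S d ^^ k) (S e x) = S e ((S d ^^ k) x)" for d e k x
    by (induction k) (auto simp: comm)
  have comm'': "(S d ^^ k) ((S e ^^ l) x) = (S e ^^ l) ((S d ^^ k) x)" for d e k l x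
    by (induction l) (auto simp: comm')
  have Sadd: "S d (x + y) = S d x + S d y" for d x y
    by (simp add: S_def T.add scale_right_distrib)
  have Sn: "(S d ^^ k) (x + y) = (S d ^^ k) x + (S d ^^ k) y" for d k x y
    by (induction k) (auto simp: Sadd)
  have Szero: "(S d ^^ k) 0 = 0" for d k using Sn[where x=0 and y=0] by simp
  have Ssum: "(S d ^^ k) (\<Sum>a\<in>F. v a) = (\<Sum>a\<in>F. (S d ^^ k) (v a))" for d k
    using insert.hyps(1) by (induction F rule: finite_induct) (auto simp: Sn Szero)
  have nil: "(S a ^^ n) (v a) \<in> M" if "a \<in> insert c F" for a
    using insert.prems(1)[OF that] by (simp add: S_def)
  have "(S c ^^ n) (v c + (\<Sum>a\<in>F. v a)) \<in> M"
    using insert.prems(2) insert.hyps by (intro SnM) simp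
  then have "(S c ^^ n) (v c + (\<Sum>a\<in>F. v a)) - (S c ^^ n) (v c) \<in> M"
    by (intro subspace_diff[OF M] nil) auto
  then have sum: "(\<Sum>a\<in>F. (S c ^^ n) (v a)) \<in> M" by (simp add: Sn Ssum)
  have inF: "v a \<in> M" if a: "a \<in> F" for a
  proof -
    have "(S c ^^ n) (v a) \<in> M"
    proof (rule insert.IH[OF _ sum a])
      fix b assume "b \<in> F"
      then have "(S c ^^ n) ((S b ^^ n) (v b)) \<in> M" by (intro SnM nil) auto
      then show "((\<lambda>x. T x - scale b x) ^^ n) ((S c ^^ n) (v b)) \<in> M"
        by (simp only: S_def[symmetric] comm'')
    qed
    moreover have "c \<noteq> a" using insert.hyps a by auto
    ultimately show ?thesis
      using power_shift_in_subspace[OF T M TM, of c a n "v a" n] nil[of a] a by (auto simp: S_def)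
  qed
  have "v c + (\<Sum>a\<in>F. v a) - (\<Sum>a\<in>F. v a) \<in> M"
    using insert.prems(2) insert.hyps by (intro subspace_diff[OF M] subspace_sum[OF M] inF) auto
  then show ?case using inF insert.prems(3) by auto
qed

end

section \<open>Jordan form, traces and nilpotency\<close>

definition mat_trace :: "'a::comm_monoid_add mat \<Rightarrow> 'a" where
  "mat_trace A = (\<Sum>i<dim_row A. A $$ (i,i))"

lemma mat_mult_index:
  assumes "A \<in> carrier_mat d d" "B \<in> carrier_mat d d" "i < d" "j < d"
  shows "(A * B) $$ (i,j) = (\<Sum>k<d. A $$ (i,k) * B $$ (k,j))"
  using assms by (auto simp: scalar_prod_def lessThan_atLeast0 intro!: sum.cong)

lemma mat_trace_comm:
  fixes A B :: "'a::comm_semiring_0 mat"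
  assumes "A \<in> carrier_mat d d" "B \<in> carrier_mat d d"
  shows "mat_trace (A * B) = mat_trace (B * A)"
proof -
  have "mat_trace (A * B) = (\<Sum>i<d. \<Sum>k<d. A $$ (i,k) * B $$ (k,i))"
    using assms by (auto simp: mat_trace_def mat_mult_index[OF assms] intro!: sum.cong simp del: index_mult_mat(1))
  also have "\<dots> = (\<Sum>k<d. \<Sum>i<d. B $$ (k,i) * A $$ (i,k))"
    by (subst sum.swap) (simp add: mult.commute)
  also have "\<dots> = mat_trace (B * A)"
    using assms by (auto simp: mat_trace_def mat_mult_index[OF assms(2,1)] intro!: sum.cong simp del: index_mult_mat(1))
  finally show ?thesis .
qed

lemma jordan_matrix_offdiagonal:
  "i < sum_list (map fst n_as) \<Longrightarrow> j < sum_list (map fst n_as) \<Longrightarrow>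
    jordan_matrix n_as $$ (i,j) \<noteq> 0 \<Longrightarrow> jordan_matrix n_as $$ (i,i) = jordan_matrix n_as $$ (j,j)"
proof (induction n_as arbitrary: i j)
  case Nil
  then show ?case by simp
next
  case (Cons na n_as)
  obtain n a where na: "na = (n, a)" by force
  show ?case using Cons.prems Cons.IH[of "i - n" "j - n"] unfolding na jordan_matrix_Cons
    by (auto split: if_splits)
qed

text \<open>
  The last property says that the diagonal part of \<open>J\<close> commutes with \<open>J\<close>: it is the semisimple part in
  the Jordan--Chevalley decomposition.
\<close>
lemma complex_jordan_form:
  fixes A :: "complex mat"
  assumes A: "A \<in> carrier_mat d d"
  obtains P Q J where "P \<in> carrier_mat d d" "Q \<in> carrier_mat d d" "J \<in> carrier_mat d d"
    "P * Q = 1\<^sub>m d" "Q * P = 1\<^sub>m d" "A = P * J * Q"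
    "\<And>i j. i < d \<Longrightarrow> j < i \<Longrightarrow> J $$ (i,j) = 0"
    "\<And>i j. i < d \<Longrightarrow> j < d \<Longrightarrow> J $$ (i,j) \<noteq> 0 \<Longrightarrow> J $$ (i,i) = J $$ (j,j)"
proof -
  obtain as where "char_poly A = (\<Prod>a\<leftarrow>as. [:- a, 1:])" using char_poly_factorized[OF A] by auto
  then obtain n_as where "jordan_nf A n_as" using jordan_nf_exists[OF A] by auto
  then have "similar_mat A (jordan_matrix n_as)" by (simp add: jordan_nf_def)
  then obtain P Q where wit: "similar_mat_wit A (jordan_matrix n_as) P Q" by (auto simp: similar_mat_def)
  note w = similar_mat_witD2[OF A wit]
  have d: "sum_list (map fst n_as) = d" using w(5) by (metis carrier_matD(1) jordan_matrix_dim(1))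
  have ut: "jordan_matrix n_as $$ (i,j) = 0" if "i < d" "j < i" for i j
    using jordan_matrix_upper_triangular[of i n_as j] that d by simp
  show ?thesis
    by (rule that[OF w(6,7,5,1,2,3) ut jordan_matrix_offdiagonal[of _ n_as, unfolded d]])
qed


context
  fixes P Q :: "'a::comm_ring_1 mat" and d :: nat
  assumes P: "P \<in> carrier_mat d d" and Q: "Q \<in> carrier_mat d d"
    and PQ: "P * Q = 1\<^sub>m d" and QP: "Q * P = 1\<^sub>m d"
begin

lemma conjugation_mult:
  assumes X: "X \<in> carrier_mat d d" and Y: "Y \<in> carrier_mat d d"
  shows "P * (X * Y) * Q = (P * X * Q) * (P * Y * Q)"
proof -
  note assoc = assoc_mult_mat[of _ d d _ d _ d]
  have "(P * X * Q) * (P * Y * Q) = P * (X * ((Q * P) * (Y * Q)))"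
    using X Y P Q by (simp add: assoc)
  also have "\<dots> = P * (X * Y) * Q"
    unfolding QP using X Y P Q by (simp add: assoc)
  finally show ?thesis by simp
qed

lemma conjugation_minus:
  assumes X: "X \<in> carrier_mat d d" and Y: "Y \<in> carrier_mat d d"
  shows "P * (X - Y) * Q = P * X * Q - P * Y * Q"
  using X Y P Q by (simp add: mult_minus_distrib_mat[of _ d d _ d] minus_mult_distrib_mat[of _ d d _ _ d])

lemma conjugation_add:
  assumes X: "X \<in> carrier_mat d d" and Y: "Y \<in> carrier_mat d d"
  shows "P * (X + Y) * Q = P * X * Q + P * Y * Q"
  using X Y P Q by (simp add: mult_add_distrib_mat[of _ d d _ d] add_mult_distrib_mat[of _ d d _ _ d])

lemma conjugation_smult:
  assumes X: "X \<in> carrier_mat d d"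
  shows "P * (c \<cdot>\<^sub>m X) * Q = c \<cdot>\<^sub>m (P * X * Q)"
  using X P Q by (simp add: mult_smult_distrib[of _ d d _ d] mult_smult_assoc_mat[of _ d d _ d])

lemma conjugation_inverse:
  assumes X: "X \<in> carrier_mat d d"
  shows "P * (Q * X * P) * Q = X"
proof -
  note assoc = assoc_mult_mat[of _ d d _ d _ d]
  have "P * (Q * X * P) * Q = (P * Q) * X * (P * Q)" using X P Q by (simp add: assoc)
  then show ?thesis unfolding PQ using X by simp
qed

lemma conjugation_trace:
  assumes X: "X \<in> carrier_mat d d"
  shows "mat_trace (P * X * Q) = mat_trace X"
proof -
  have "mat_trace (P * X * Q) = mat_trace (Q * (P * X))"
    using P Q X by (intro mat_trace_comm[of _ d]) auto
  also have "Q * (P * X) = (Q * P) * X" using P Q X by simp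
  finally show ?thesis unfolding QP using X by simp
qed

lemma conjugation_pow:
  assumes X: "X \<in> carrier_mat d d"
  shows "(P * X * Q) ^\<^sub>m k = P * (X ^\<^sub>m k) * Q"
proof (induction k)
  case 0
  then show ?case using P Q X PQ by simp
next
  case (Suc k)
  then show ?case using X by (simp add: conjugation_mult)
qed

end

lemma strictly_upper_triangular_nilpotent:
  fixes J :: "'a::comm_ring_1 mat"
  assumes J: "J \<in> carrier_mat d d" and ut: "\<And>i j. i < d \<Longrightarrow> j \<le> i \<Longrightarrow> J $$ (i,j) = 0"
  shows "J ^\<^sub>m d = 0\<^sub>m d d"
proof -
  have "(J ^\<^sub>m k) $$ (i,j) = 0" if "i < d" "j < d" "j < i + k" for i j k
    using that
  proof (induction k arbitrary: i j)
    case 0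
    then show ?case using J by simp
  next
    case (Suc k)
    have "(J ^\<^sub>m Suc k) $$ (i,j) = (\<Sum>l<d. (J ^\<^sub>m k) $$ (i,l) * J $$ (l,j))"
      using mat_mult_index[of "J ^\<^sub>m k" d J i j] J Suc.prems by simp
    also have "\<dots> = 0"
    proof (rule sum.neutral, rule ballI)
      fix l assume "l \<in> {..<d}"
      then show "(J ^\<^sub>m k) $$ (i,l) * J $$ (l,j) = 0"
        using Suc.IH[of i l] ut[of l j] Suc.prems by (cases "l < i + k") auto
    qed
    finally show ?case .
  qed
  then show ?thesis using J by (intro eq_matI) auto
qed

lemma nilpotent_trace_zero:
  fixes A :: "complex mat"
  assumes A: "A \<in> carrier_mat d d" and nil: "A ^\<^sub>m m = 0\<^sub>m d d"
  shows "mat_trace A = 0"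
proof -
  obtain P Q J where PQ: "P \<in> carrier_mat d d" "Q \<in> carrier_mat d d" "P * Q = 1\<^sub>m d" "Q * P = 1\<^sub>m d"
    and J: "J \<in> carrier_mat d d" and APJQ: "A = P * J * Q" and ut: "\<And>i j. i < d \<Longrightarrow> j < i \<Longrightarrow> J $$ (i,j) = 0"
    by (rule complex_jordan_form[OF A]) blast
  have low: "(J ^\<^sub>m k) $$ (i,j) = (if i = j then J $$ (i,i) ^ k else 0)" if "i < d" "j \<le> i" for i j k
    using that
  proof (induction k arbitrary: i j)
    case 0
    then show ?case using J by simp
  next
    case (Suc k)
    have "(J ^\<^sub>m Suc k) $$ (i,j) = (\<Sum>l<d. (J ^\<^sub>m k) $$ (i,l) * J $$ (l,j))"
      using mat_mult_index[of "J ^\<^sub>m k" d J i j] J Suc.prems by simp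
    also have "\<dots> = (\<Sum>l<d. if l = i then J $$ (i,i) ^ k * J $$ (i,j) else 0)"
    proof (rule sum.cong[OF refl])
      fix l assume "l \<in> {..<d}"
      then show "(J ^\<^sub>m k) $$ (i,l) * J $$ (l,j) = (if l = i then J $$ (i,i) ^ k * J $$ (i,j) else 0)"
        using Suc.IH[of i l] ut[of l j] Suc.prems by (cases l i rule: linorder_cases) auto
    qed
    also have "\<dots> = J $$ (i,i) ^ k * J $$ (i,j)" using Suc.prems by (simp add: sum.delta)
    also have "\<dots> = (if i = j then J $$ (i,i) ^ Suc k else 0)" using ut[of i j] Suc.prems by auto
    finally show ?case .
  qed
  have "J = Q * A * P"
    using conjugation_inverse[OF PQ(2,1,4,3) J] APJQ by simp
  then have "J ^\<^sub>m m = Q * (A ^\<^sub>m m) * P" using conjugation_pow[OF PQ(2,1,4,3) A] by simp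
  then have "J ^\<^sub>m m = 0\<^sub>m d d" unfolding nil using PQ by simp
  then have "J $$ (i,i) ^ m = 0" if "i < d" for i using low[OF that, of i m] that by simp
  then have "J $$ (i,i) = 0" if "i < d" for i using that by (metis power_eq_0_iff)
  then have "mat_trace J = 0" using J by (simp add: mat_trace_def)
  then show ?thesis unfolding APJQ by (simp add: conjugation_trace[OF PQ J])
qed

text \<open>
  The linear-algebra core of Cartan's criterion.  Let \<open>Y\<close> have the eigenspaces of the semisimple part of \<open>A\<close>
  but the complex conjugate eigenvalues.  Every invariant subspace of \<open>ad A\<close> contains the components of
  its elements of given weight \<open>w\<^sub>i - w\<^sub>j\<close>, and \<open>ad Y\<close> acts on these by the conjugate weight;
  so \<open>Y\<close> normalizes \<open>M\<close>, and the trace of \<open>A Y\<close>, which is the sum of the squared moduli of the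
  eigenvalues of \<open>A\<close>, vanishes.
\<close>
lemma nilpotent_if_trace_orthogonal_to_normalizer:
  fixes A :: "complex mat"
  assumes A: "A \<in> carrier_mat d d" and M: "M \<subseteq> carrier_mat d d"
    and zero: "0\<^sub>m d d \<in> M" and add: "\<And>B C. B \<in> M \<Longrightarrow> C \<in> M \<Longrightarrow> B + C \<in> M"
    and smult: "\<And>B c. B \<in> M \<Longrightarrow> c \<cdot>\<^sub>m B \<in> M"
    and ad: "\<And>B. B \<in> M \<Longrightarrow> A * B - B * A \<in> M"
    and tr: "\<And>Y. Y \<in> carrier_mat d d \<Longrightarrow> (\<And>B. B \<in> M \<Longrightarrow> Y * B - B * Y \<in> M) \<Longrightarrow> mat_trace (A * Y) = 0"
  shows "A ^\<^sub>m d = 0\<^sub>m d d"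
proof -
  obtain P Q J where PQ: "P \<in> carrier_mat d d" "Q \<in> carrier_mat d d" "P * Q = 1\<^sub>m d" "Q * P = 1\<^sub>m d"
    and J: "J \<in> carrier_mat d d" and APJQ: "A = P * J * Q" and ut: "\<And>i j. i < d \<Longrightarrow> j < i \<Longrightarrow> J $$ (i,j) = 0"
    and Jeq: "\<And>i j. i < d \<Longrightarrow> j < d \<Longrightarrow> J $$ (i,j) \<noteq> 0 \<Longrightarrow> J $$ (i,i) = J $$ (j,j)"
    by (rule complex_jordan_form[OF A]) blast
  define w where "w i = J $$ (i,i)" for i
  define D where "D = mat d d (\<lambda>(i,j). if i = j then cnj (w i) else 0)"
  define Y where "Y = P * D * Q"
  have D: "D \<in> carrier_mat d d" by (simp add: D_def)
  have Y: "Y \<in> carrier_mat d d" using PQ D by (simp add: Y_def)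
  define mk :: "(nat \<times> nat \<Rightarrow> complex) \<Rightarrow> complex mat" where "mk f = mat d d f" for f
  have mkc[simp]: "mk f \<in> carrier_mat d d" for f by (simp add: mk_def)
  have mkI: "mk f = X" if "X \<in> carrier_mat d d" "\<And>i j. i < d \<Longrightarrow> j < d \<Longrightarrow> f (i,j) = X $$ (i,j)" for f X
    unfolding mk_def using that by (intro eq_matI) auto
  define Mf where "Mf = {f. P * mk f * Q \<in> M}"
  define T :: "(nat \<times> nat \<Rightarrow> complex) \<Rightarrow> nat \<times> nat \<Rightarrow> complex" where
    "T f = (\<lambda>(i,j). (\<Sum>k<d. J $$ (i,k) * f (k,j)) - (\<Sum>k<d. f (i,k) * J $$ (k,j)))" for f
  define sc :: "complex \<Rightarrow> (nat \<times> nat \<Rightarrow> complex) \<Rightarrow> nat \<times> nat \<Rightarrow> complex" where "sc c f = (\<lambda>p. c * f p)" for c f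
  interpret vs: vector_space sc
    by unfold_locales (auto simp: sc_def fun_eq_iff algebra_simps)
  have Tlin: "Vector_Spaces.linear sc sc T"
    by unfold_locales
      (auto simp: T_def sc_def fun_eq_iff algebra_simps sum.distrib sum_distrib_left)
  have mkT: "mk (T f) = J * mk f - mk f * J" for f
    by (rule mkI) (use J in \<open>auto simp: T_def mat_mult_index[of _ d] minus_mat_def mk_def simp del: index_mult_mat(1)\<close>)
  have Msub: "vs.subspace Mf"
  proof (rule vs.subspaceI)
    have "mk 0 = 0\<^sub>m d d" by (rule mkI) auto
    then show "0 \<in> Mf" using zero PQ by (simp add: Mf_def)
  next
    fix f g assume fg: "f \<in> Mf" "g \<in> Mf"
    have "mk (f + g) = mk f + mk g" by (rule mkI) (auto simp: mk_def)
    then show "f + g \<in> Mf" using add fg by (simp add: Mf_def conjugation_add[OF PQ])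
  next
    fix c f assume f: "f \<in> Mf"
    have "mk (sc c f) = c \<cdot>\<^sub>m mk f" by (rule mkI) (auto simp: mk_def sc_def)
    then show "sc c f \<in> Mf" using smult f by (simp add: Mf_def conjugation_smult[OF PQ])
  qed
  have TM: "T f \<in> Mf" if "f \<in> Mf" for f
    using ad[of "P * mk f * Q"] that J
    by (simp add: Mf_def mkT mult_carrier_mat[of _ d d _ d] conjugation_minus[OF PQ] conjugation_mult[OF PQ] APJQ)
  (* ad J - l acts on the weight space of l as ad N for the strictly upper triangular part N of J,
     which moves entries away from the lower left corner by at least one diagonal; 2d steps leave
     the matrix. *)
  have nilp: "((\<lambda>f. T f - sc l f) ^^ (2 * d)) f \<in> Mf"
    if supp: "\<And>i j. i < d \<Longrightarrow> j < d \<Longrightarrow> f (i,j) \<noteq> 0 \<Longrightarrow> w i - w j = l" for l f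
  proof -
    define g where "g s = ((\<lambda>f. T f - sc l f) ^^ s) f" for s
    have "g s (i,j) = 0 \<or> (w i - w j = l \<and> i + s \<le> j + d)" if "i < d" "j < d" for i j s
      using that
    proof (induction s arbitrary: i j)
      case 0
      then show ?case using supp[of i j] by (auto simp: g_def)
    next
      case (Suc s)
      define N where "N i j = (if i = j then 0 else J $$ (i,j))" for i j
      have N0: "N a b \<noteq> 0 \<Longrightarrow> w a = w b \<and> a < b" if "a < d" "b < d" for a b
        using ut[of a b] Jeq[of a b] that by (auto simp: N_def w_def split: if_splits) (metis linorder_neqE_nat)
      have JN: "J $$ (a,b) = N a b + (if a = b then w a else 0)" for a b
        by (auto simp: N_def w_def)
      have "g (Suc s) (i,j) = (\<Sum>k<d. J $$ (i,k) * g s (k,j)) - (\<Sum>k<d. g s (i,k) * J $$ (k,j)) - l * g s (i,j)"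
        by (simp add: g_def T_def sc_def)
      also have "(\<Sum>k<d. J $$ (i,k) * g s (k,j)) = (\<Sum>k<d. N i k * g s (k,j)) + w i * g s (i,j)"
        using Suc.prems by (simp add: JN distrib_right sum.distrib if_distrib[of "\<lambda>x. x * _"] sum.delta cong: if_cong)
      also have "(\<Sum>k<d. g s (i,k) * J $$ (k,j)) = (\<Sum>k<d. g s (i,k) * N k j) + w j * g s (i,j)"
        using Suc.prems by (simp add: JN distrib_left sum.distrib if_distrib[of "\<lambda>x. _ * x"] sum.delta' mult.commute cong: if_cong)
      finally have eq: "g (Suc s) (i,j) = (\<Sum>k<d. N i k * g s (k,j)) - (\<Sum>k<d. g s (i,k) * N k j)
          + (w i - w j - l) * g s (i,j)"
        by (simp add: algebra_simps)
      have z: "(w i - w j - l) * g s (i,j) = 0" using Suc.IH[OF Suc.prems] by auto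
      show ?case
      proof (rule ccontr)
        assume neg: "\<not> ?thesis"
        have "N i k * g s (k,j) = 0" if k: "k < d" for k
          using N0[OF Suc.prems(1) k] Suc.IH[OF k Suc.prems(2)] neg by force
        moreover have "g s (i,k) * N k j = 0" if k: "k < d" for k
          using N0[OF k Suc.prems(2)] Suc.IH[OF Suc.prems(1) k] neg by force
        ultimately have "g (Suc s) (i,j) = 0" unfolding eq z by (simp add: sum.neutral del: mult_eq_0_iff)
        then show False using neg by simp
      qed
    qed
    from this[of _ _ "2 * d"] have "mk (g (2 * d)) = 0\<^sub>m d d" by (intro mkI) force+
    then show ?thesis using PQ zero by (simp add: Mf_def g_def)
  qed
  have norm: "Y * B - B * Y \<in> M" if B: "B \<in> M" for B
  proof -
    have Bc: "B \<in> carrier_mat d d" using B M by auto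
    define f where "f = (\<lambda>p. (Q * B * P) $$ p)"
    have mkf: "mk f = Q * B * P" by (rule mkI) (use PQ Bc in \<open>auto simp: f_def\<close>)
    have Pf: "P * mk f * Q = B" unfolding mkf by (rule conjugation_inverse[OF PQ Bc])
    define F where "F = (\<lambda>(i,j). w i - w j) ` ({..<d} \<times> {..<d})"
    define v where "v l = (\<lambda>(i,j). if i < d \<and> j < d \<and> w i - w j = l then f (i,j) else 0)" for l
    have F: "finite F" by (simp add: F_def)
    have sumapp: "(\<Sum>l\<in>F. u l) p = (\<Sum>l\<in>F. u l p)" for u :: "complex \<Rightarrow> nat \<times> nat \<Rightarrow> complex" and p
      using F by (induction F rule: finite_induct) auto
    have inF: "w i - w j \<in> F" if "i < d" "j < d" for i j using that by (auto simp: F_def)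
    have coll: "(\<Sum>l\<in>F. sc (c l) (v l)) (i,j) = c (w i - w j) * f (i,j)" if "i < d" "j < d" for c i j
    proof -
      have "(\<Sum>l\<in>F. sc (c l) (v l)) (i,j) = (\<Sum>l\<in>F. if w i - w j = l then c l * f (i,j) else 0)"
        unfolding sumapp by (rule sum.cong) (use that in \<open>auto simp: v_def sc_def\<close>)
      then show ?thesis using F inF[OF that] by (simp add: sum.delta')
    qed
    have "mk (\<Sum>l\<in>F. v l) = mk f"
      by (rule mkI) (use coll[of _ _ "\<lambda>_. 1"] in \<open>auto simp: mk_def sc_def\<close>)
    then have sum: "(\<Sum>l\<in>F. v l) \<in> Mf" using Pf B by (simp add: Mf_def)
    have "v l \<in> Mf" if "l \<in> F" for l
      by (rule vs.generalized_eigencomponents_in_subspace[OF Tlin Msub TM F _ sum that, of "2 * d"])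
        (auto intro!: nilp simp: v_def split: if_splits)
    then have "(\<Sum>l\<in>F. sc (cnj l) (v l)) \<in> Mf" by (intro vs.subspace_sum[OF Msub] vs.subspace_scale[OF Msub])
    moreover have "mk (\<Sum>l\<in>F. sc (cnj l) (v l)) = D * mk f - mk f * D"
    proof (rule mkI)
      show "D * mk f - mk f * D \<in> carrier_mat d d" by (intro minus_carrier_mat mult_carrier_mat[of _ d d] D mkc)
      fix i j assume ij: "i < d" "j < d"
      have "(D * mk f - mk f * D) $$ (i,j) = (D * mk f) $$ (i,j) - (mk f * D) $$ (i,j)"
        using ij D by (simp add: mk_def)
      also have "(D * mk f) $$ (i,j) = cnj (w i) * f (i,j)"
        unfolding mat_mult_index[OF D mkc ij] using ij
        by (simp add: D_def mk_def if_distrib[of "\<lambda>x. x * _"] sum.delta cong: if_cong)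
      also have "(mk f * D) $$ (i,j) = cnj (w j) * f (i,j)"
        unfolding mat_mult_index[OF mkc D ij] using ij
        by (simp add: D_def mk_def if_distrib[of "\<lambda>x. _ * x"] sum.delta' mult.commute cong: if_cong)
      finally show "(\<Sum>l\<in>F. sc (cnj l) (v l)) (i,j) = (D * mk f - mk f * D) $$ (i,j)"
        unfolding coll[OF ij] by (simp add: algebra_simps)
    qed
    ultimately have "P * (D * mk f - mk f * D) * Q \<in> M" by (simp add: Mf_def)
    then show ?thesis
      using D by (simp add: mult_carrier_mat[of _ d d _ d] conjugation_minus[OF PQ] conjugation_mult[OF PQ] Pf Y_def)
  qed
  have JD: "(J * D) $$ (i,i) = w i * cnj (w i)" if "i < d" for i
    unfolding mat_mult_index[OF J D that that] using that
    by (simp add: D_def w_def if_distrib[of "\<lambda>x. _ * x"] sum.delta cong: if_cong)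
  have "mat_trace (A * Y) = mat_trace (J * D)"
    using J D by (simp add: mult_carrier_mat[of _ d d _ d] APJQ Y_def conjugation_mult[OF PQ, symmetric] conjugation_trace[OF PQ])
  also have "\<dots> = (\<Sum>i<d. w i * cnj (w i))"
    unfolding mat_trace_def using J JD by simp
  also have "\<dots> = of_real (\<Sum>i<d. (cmod (w i))\<^sup>2)"
    by (simp add: complex_norm_square[symmetric])
  finally have "(\<Sum>i<d. (cmod (w i))\<^sup>2) = 0" using tr[OF Y norm] by (metis of_real_eq_0_iff)
  then have "w i = 0" if "i < d" for i using that by (simp add: sum_nonneg_eq_0_iff)
  then have "J ^\<^sub>m d = 0\<^sub>m d d"
    by (intro strictly_upper_triangular_nilpotent[OF J]) (metis le_neq_implies_less ut w_def)
  then show ?thesis unfolding APJQ conjugation_pow[OF PQ J] using PQ by simp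
qed

section \<open>Subspaces of a finite-dimensional space\<close>

lemma fd_independent:
  fixes V :: "'a::real_vector set"
  assumes "\<exists>B. finite B \<and> span B = V" "independent S" "S \<subseteq> V"
  shows "finite S"
  using assms independent_span_bound by metis

lemma fd_subspace_dim_le:
  fixes V :: "'a::real_vector set"
  assumes V: "\<exists>B. finite B \<and> span B = V" and "S \<subseteq> T" "T \<subseteq> V"
  shows "dim S \<le> dim T"
proof -
  obtain B where B: "B \<subseteq> S" "independent B" "S \<subseteq> span B" "card B = dim S"
    using real_vector.basis_exists by blast
  obtain C where C: "B \<subseteq> C" "C \<subseteq> T" "independent C" "T \<subseteq> span C"
    using real_vector.maximal_independent_subset_extend[of B T] B assms(2) by blast
  have "finite C" using fd_independent[OF V C(3)] C(2) assms(3) by blast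
  moreover have "card C = dim T" using C by (intro real_vector.basis_card_eq_dim) auto
  ultimately show ?thesis using B C card_mono by metis
qed

lemma fd_subspace_dim_equal:
  fixes V :: "'a::real_vector set"
  assumes V: "\<exists>B. finite B \<and> span B = V" and "subspace S" "S \<subseteq> T" "T \<subseteq> V" "dim T \<le> dim S"
  shows "S = T"
proof -
  obtain B where B: "B \<subseteq> S" "independent B" "S \<subseteq> span B" "card B = dim S"
    using real_vector.basis_exists by blast
  obtain C where C: "B \<subseteq> C" "C \<subseteq> T" "independent C" "T \<subseteq> span C"
    using real_vector.maximal_independent_subset_extend[of B T] B assms(3) by blast
  have "finite C" using fd_independent[OF V C(3)] C(2) assms(4) by blast
  moreover have "card C = dim T" using C by (intro real_vector.basis_card_eq_dim) auto
  ultimately have "B = C" using B C assms(5) by (metis card_seteq)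
  then show ?thesis using B C assms by (metis real_vector.span_minimal subset_antisym subset_trans)
qed

lemma fd_subspace_spanned:
  fixes V :: "'a::real_vector set"
  assumes V: "\<exists>B. finite B \<and> span B = V" and "subspace S" "S \<subseteq> V"
  shows "\<exists>B. finite B \<and> span B = S"
proof -
  obtain B where B: "B \<subseteq> S" "independent B" "S \<subseteq> span B" "card B = dim S"
    using real_vector.basis_exists by blast
  then have "finite B" using fd_independent[OF V] assms by blast
  moreover have "span B = S" using B assms by (metis real_vector.span_minimal subset_antisym)
  ultimately show ?thesis by blast
qed

text \<open>
  A basis \<open>b\<close> of a complement of \<open>R\<close> in \<open>V\<close> together with coordinates \<open>c\<close> modulo \<open>R\<close>, which makes it
  possible to compute in \<open>V / R\<close> without forming a quotient type.
\<close>
lemma relative_basis: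
  fixes V :: "'a::real_vector set"
  assumes V: "\<exists>B. finite B \<and> span B = V" and R: "subspace R" "R \<subseteq> V"
  obtains d :: nat and b :: "nat \<Rightarrow> 'a" and c :: "nat \<Rightarrow> 'a \<Rightarrow> real"
  where "\<And>i. i < d \<Longrightarrow> b i \<in> V" "\<And>i. linear (c i)" "\<And>i r. i < d \<Longrightarrow> r \<in> R \<Longrightarrow> c i r = 0"
    "\<And>i j. i < d \<Longrightarrow> j < d \<Longrightarrow> c i (b j) = (if i = j then 1 else 0)"
    "\<And>x. x \<in> V \<Longrightarrow> x - (\<Sum>i<d. c i x *\<^sub>R b i) \<in> R"
proof -
  obtain A where A: "A \<subseteq> R" "independent A" "R \<subseteq> span A"
    using real_vector.maximal_independent_subset by blast
  obtain C where C: "A \<subseteq> C" "C \<subseteq> V" "independent C" "V \<subseteq> span C"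
    using real_vector.maximal_independent_subset_extend[of A V] A R(2) by blast
  obtain E where E: "C \<subseteq> E" "independent E" "UNIV \<subseteq> span E"
    using real_vector.maximal_independent_subset_extend[OF subset_UNIV C(3)] by metis
  have spE: "x \<in> span E" for x using E by blast
  have finC: "finite C" using fd_independent[OF V C(3,2)] .
  then obtain b where b: "bij_betw b {..<card (C - A)} (C - A)"
    using ex_bij_betw_nat_finite[of "C - A"] lessThan_atLeast0 by auto
  define d where "d = card (C - A)"
  have b: "bij_betw b {..<d} (C - A)" using b by (simp add: d_def)
  have bCA: "b i \<in> C - A" if "i < d" for i using b that by (auto simp: bij_betw_def)
  define c where "c i x = real_vector.representation E x (b i)" for i x
  have lin: "linear (c i)" for i
    by (rule linearI) (simp_all add: c_def real_vector.representation_add[OF E(2) spE spE]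
        real_vector.representation_scale[OF E(2) spE])
  have cE: "c i e = (if e = b i then 1 else 0)" if "e \<in> E" for i e
    using real_vector.representation_basis[OF E(2) that] by (simp add: c_def)
  have cR: "c i r = 0" if "i < d" "r \<in> R" for i r
  proof -
    have "subspace {x. c i x = 0}"
      using lin[of i] by (auto simp: real_vector.subspace_def linear_0 linear_add linear_scale)
    moreover have "A \<subseteq> {x. c i x = 0}" using cE[of _ i] bCA[OF that(1)] C(1) E(1) by auto
    ultimately show ?thesis using A(3) that(2) real_vector.span_minimal by blast
  qed
  have cb: "c i (b j) = (if i = j then 1 else 0)" if "i < d" "j < d" for i j
  proof -
    have "b j \<in> E" using bCA[OF that(2)] E(1) by auto
    moreover have "b j = b i \<longleftrightarrow> i = j" using b that by (auto simp: bij_betw_def inj_on_def)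
    ultimately show ?thesis using cE by simp
  qed
  have dec: "x - (\<Sum>i<d. c i x *\<^sub>R b i) \<in> R" if x: "x \<in> V" for x
  proof -
    define S where "S = {x. x - (\<Sum>i<d. c i x *\<^sub>R b i) \<in> R}"
    have "subspace S"
      unfolding real_vector.subspace_def
    proof (intro conjI ballI allI)
      show "0 \<in> S" using R by (simp add: S_def linear_0[OF lin] subspace_0)
      fix x y assume "x \<in> S" "y \<in> S"
      then have "(x - (\<Sum>i<d. c i x *\<^sub>R b i)) + (y - (\<Sum>i<d. c i y *\<^sub>R b i)) \<in> R"
        using R by (auto simp: S_def subspace_add)
      then show "x + y \<in> S" by (simp add: S_def linear_add[OF lin] scaleR_left_distrib sum.distrib algebra_simps)
    next
      fix k x assume "x \<in> S"
      then have "k *\<^sub>R (x - (\<Sum>i<d. c i x *\<^sub>R b i)) \<in> R"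
        using R by (auto simp: S_def subspace_scale)
      then show "k *\<^sub>R x \<in> S" by (simp add: S_def linear_scale[OF lin] scaleR_right_diff_distrib scaleR_sum_right)
    qed
    moreover have "C \<subseteq> S"
    proof
      fix e assume e: "e \<in> C"
      show "e \<in> S"
      proof (cases "e \<in> A")
        case True
        then have "e \<in> R" using A by auto
        then show ?thesis using cR by (simp add: S_def)
      next
        case False
        then obtain j where j: "j < d" "e = b j" using e b by (auto simp: bij_betw_def image_def)
        have "(\<Sum>i<d. c i e *\<^sub>R b i) = (\<Sum>i<d. if i = j then b i else 0)"
          using j cb by (intro sum.cong) auto
        then have "(\<Sum>i<d. c i e *\<^sub>R b i) = e" using j by (simp add: sum.delta)
        then show ?thesis using R by (simp add: S_def subspace_0)
      qed
    qed
    ultimately have "span C \<subseteq> S" by (rule real_vector.span_minimal[rotated])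
    then show ?thesis using C(4) x by (auto simp: S_def)
  qed
  show ?thesis by (rule that[of d b c]) (use bCA C(2) lin cR cb dec in auto)
qed

section \<open>Solvable ideals and the radical\<close>

context fd_lie_algebra
begin

lemma carrier_0[simp]: "0 \<in> V" by (rule subspace_0[OF subspace_carrier])
lemma carrier_add[simp]: "x \<in> V \<Longrightarrow> y \<in> V \<Longrightarrow> x + y \<in> V" by (rule subspace_add[OF subspace_carrier])
lemma carrier_diff[simp]: "x \<in> V \<Longrightarrow> y \<in> V \<Longrightarrow> x - y \<in> V" by (rule subspace_diff[OF subspace_carrier])
lemma carrier_scale[simp]: "x \<in> V \<Longrightarrow> c *\<^sub>R x \<in> V" by (rule subspace_scale[OF subspace_carrier])
lemma carrier_neg[simp]: "x \<in> V \<Longrightarrow> - x \<in> V" by (rule subspace_neg[OF subspace_carrier])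
lemma carrier_br[simp]: "x \<in> V \<Longrightarrow> y \<in> V \<Longrightarrow> br x y \<in> V" by (rule bracket_closed)

lemma br_add_left: "x \<in> V \<Longrightarrow> y \<in> V \<Longrightarrow> z \<in> V \<Longrightarrow> br (x + y) z = br x z + br y z"
  using bracket_bilinear by (simp add: bilinear_on_def linear_on_def)
lemma br_add_right: "x \<in> V \<Longrightarrow> y \<in> V \<Longrightarrow> z \<in> V \<Longrightarrow> br x (y + z) = br x y + br x z"
  using bracket_bilinear by (simp add: bilinear_on_def linear_on_def)
lemma br_scale_left: "x \<in> V \<Longrightarrow> y \<in> V \<Longrightarrow> br (c *\<^sub>R x) y = c *\<^sub>R br x y"
  using bracket_bilinear by (simp add: bilinear_on_def linear_on_def)
lemma br_scale_right: "x \<in> V \<Longrightarrow> y \<in> V \<Longrightarrow> br x (c *\<^sub>R y) = c *\<^sub>R br x y"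
  using bracket_bilinear by (simp add: bilinear_on_def linear_on_def)
lemma br_0_left[simp]: "x \<in> V \<Longrightarrow> br 0 x = 0" using br_scale_left[of 0 x 0] by simp
lemma br_0_right[simp]: "x \<in> V \<Longrightarrow> br x 0 = 0" using br_scale_right[of x 0 0] by simp
lemma br_minus_left: "x \<in> V \<Longrightarrow> y \<in> V \<Longrightarrow> br (- x) y = - br x y" using br_scale_left[of x y "-1"] by simp
lemma br_minus_right: "x \<in> V \<Longrightarrow> y \<in> V \<Longrightarrow> br x (- y) = - br x y" using br_scale_right[of x y "-1"] by simp
lemma br_diff_left: "x \<in> V \<Longrightarrow> y \<in> V \<Longrightarrow> z \<in> V \<Longrightarrow> br (x - y) z = br x z - br y z"
  using br_add_left[of x "- y" z] br_minus_left[of y z] by simp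
lemma br_diff_right: "x \<in> V \<Longrightarrow> y \<in> V \<Longrightarrow> z \<in> V \<Longrightarrow> br x (y - z) = br x y - br x z"
  using br_add_right[of x y "- z"] br_minus_right[of x z] by simp

lemma br_skew:
  assumes "x \<in> V" "y \<in> V" shows "br x y = - br y x"
proof -
  have "br (x + y) (x + y) = br x x + br x y + (br y x + br y y)"
    using assms by (simp only: br_add_left br_add_right carrier_add add_ac)
  then show ?thesis using assms by (simp add: bracket_alternating eq_neg_iff_add_eq_0)
qed

lemma br_derivation:
  assumes "x \<in> V" "y \<in> V" "z \<in> V"
  shows "br x (br y z) = br (br x y) z + br y (br x z)"
proof -
  have "br x (br y z) + br y (br z x) + br z (br x y) = 0" using jacobi assms by blast
  moreover have "br y (br z x) = - br y (br x z)"
    using br_skew[of z x] br_minus_right[of y "br x z"] assms by simp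
  moreover have "br z (br x y) = - br (br x y) z" using br_skew[of z "br x y"] assms by simp
  ultimately show ?thesis by (simp add: algebra_simps)
qed

lemma br_bracket_left:
  assumes "x \<in> V" "y \<in> V" "z \<in> V"
  shows "br (br x y) z = br x (br y z) - br y (br x z)"
  using br_derivation[OF assms] by simp

lemma linear_on_br: "x \<in> V \<Longrightarrow> linear_on V (br x)"
  using bracket_bilinear by (simp add: bilinear_on_def)

lemma lie_bracket_span_subset:
  "subspace S \<Longrightarrow> (\<And>x y. x \<in> A \<Longrightarrow> y \<in> B \<Longrightarrow> br x y \<in> S) \<Longrightarrow> lie_bracket_span br A B \<subseteq> S"
  unfolding lie_bracket_span_def by (rule span_minimal) auto

lemma lie_bracket_span_memI: "x \<in> A \<Longrightarrow> y \<in> B \<Longrightarrow> br x y \<in> lie_bracket_span br A B"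
  unfolding lie_bracket_span_def by (rule span_base) auto

lemma subspace_lie_bracket_span: "subspace (lie_bracket_span br A B)"
  by (simp add: lie_bracket_span_def)

definition subalgebra :: "'a set \<Rightarrow> bool" where
  "subalgebra H \<longleftrightarrow> subspace H \<and> H \<subseteq> V \<and> (\<forall>x\<in>H. \<forall>y\<in>H. br x y \<in> H)"

lemma ideal_subalgebra: "lie_ideal V br I \<Longrightarrow> subalgebra I"
  by (auto simp: subalgebra_def lie_ideal_def)

lemma ideal_right: "lie_ideal V br I \<Longrightarrow> x \<in> I \<Longrightarrow> y \<in> V \<Longrightarrow> br x y \<in> I"
  using br_skew[of x y] subspace_neg[of I "br y x"] by (auto simp: lie_ideal_def subset_iff)

lemma derived_series_mono:
  "A \<subseteq> B \<Longrightarrow> lie_derived_series br A n \<subseteq> lie_derived_series br B n"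
proof (induction n)
  case (Suc n)
  then show ?case unfolding lie_derived_series.simps lie_bracket_span_def
    by (intro span_mono) blast
qed simp

lemma derived_series_add:
  "lie_derived_series br A (n + m) = lie_derived_series br (lie_derived_series br A n) m"
  by (induction m) auto

lemma subspace_derived_series: "subspace A \<Longrightarrow> subspace (lie_derived_series br A n)"
  by (cases n) (auto simp: subspace_lie_bracket_span)

lemma derived_series_subalgebra:
  assumes "subalgebra H"
  shows "subalgebra (lie_derived_series br H n) \<and> lie_derived_series br H n \<subseteq> H"
proof (induction n)
  case 0
  then show ?case using assms by simp
next
  case (Suc n)
  define D where "D = lie_derived_series br H n"
  have D: "subalgebra D" "D \<subseteq> H" using Suc by (auto simp: D_def)
  have sub: "lie_bracket_span br D D \<subseteq> D"
    using D by (intro lie_bracket_span_subset) (auto simp: subalgebra_def)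
  then show ?case using D unfolding lie_derived_series.simps D_def[symmetric] subalgebra_def
    by (auto simp: subspace_lie_bracket_span intro!: lie_bracket_span_memI)
qed

lemma solvable_iff:
  assumes "subspace A" shows "lie_solvable A br \<longleftrightarrow> (\<exists>n. lie_derived_series br A n \<subseteq> {0})"
proof -
  have "lie_derived_series br A n \<subseteq> {0} \<longleftrightarrow> lie_derived_series br A n = {0}" for n
    using subspace_0[OF subspace_derived_series[OF assms, of n]] by auto
  then show ?thesis by (simp add: lie_solvable_def)
qed

lemma solvable_if_derived_in_solvable:
  assumes "subspace H" "lie_derived_series br H n \<subseteq> J" "lie_solvable J br"
  shows "lie_solvable H br"
proof -
  obtain m where "lie_derived_series br J m = {0}" using assms(3) by (auto simp: lie_solvable_def)
  then have "lie_derived_series br H (n + m) \<subseteq> {0}"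
    using derived_series_mono[OF assms(2), of m] by (simp add: derived_series_add)
  then show ?thesis using solvable_iff[OF assms(1)] by blast
qed

text \<open>
  Modulo \<open>J\<close> the derived series of \<open>I + J\<close> is that of \<open>I\<close>.
\<close>
lemma solvable_ideal_sum:
  assumes I: "lie_ideal V br I" "lie_solvable I br" and J: "lie_ideal V br J" "lie_solvable J br"
  shows "lie_ideal V br {x + y |x y. x \<in> I \<and> y \<in> J}" "lie_solvable {x + y |x y. x \<in> I \<and> y \<in> J} br"
proof -
  let ?S = "{x + y |x y. x \<in> I \<and> y \<in> J}"
  have sI: "subspace I" "I \<subseteq> V" and sJ: "subspace J" "J \<subseteq> V" using I(1) J(1) by (simp_all add: lie_ideal_def)
  have sS: "subspace ?S" by (rule subspace_sums[OF sI(1) sJ(1)])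
  show "lie_ideal V br ?S" unfolding lie_ideal_def
  proof (intro conjI ballI sS)
    show "?S \<subseteq> V" using sI(2) sJ(2) by (auto intro!: carrier_add)
    fix x y assume x: "x \<in> V" and "y \<in> ?S"
    then obtain a b where ab: "y = a + b" "a \<in> I" "b \<in> J" by auto
    have "a \<in> V" "b \<in> V" using ab sI sJ by auto
    then have "br x y = br x a + br x b" using x ab by (simp add: br_add_right)
    moreover have "br x a \<in> I" "br x b \<in> J" using x ab I J by (auto simp: lie_ideal_def)
    ultimately show "br x y \<in> ?S" by blast
  qed
  have D: "lie_derived_series br ?S n \<subseteq> {x + y |x y. x \<in> lie_derived_series br I n \<and> y \<in> J}" for n
  proof (induction n)
    case (Suc n)
    let ?D = "lie_derived_series br I n"
    have DV: "?D \<subseteq> V" using derived_series_subalgebra[OF ideal_subalgebra[OF I(1)], of n] by (auto simp: subalgebra_def)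
    show ?case unfolding lie_derived_series.simps
    proof (rule lie_bracket_span_subset)
      show "subspace {x + y |x y. x \<in> lie_bracket_span br ?D ?D \<and> y \<in> J}"
        by (rule subspace_sums[OF subspace_lie_bracket_span sJ(1)])
      fix x y assume "x \<in> lie_derived_series br ?S n" "y \<in> lie_derived_series br ?S n"
      then obtain a b a' b' where ab: "x = a + b" "y = a' + b'" "a \<in> ?D" "b \<in> J" "a' \<in> ?D" "b' \<in> J"
        using Suc by blast
      have V: "a \<in> V" "b \<in> V" "a' \<in> V" "b' \<in> V" using ab DV sJ by auto
      have "br x y = br a a' + (br a b' + br b (a' + b'))" using ab V by (simp add: br_add_left br_add_right)
      moreover have "br a a' \<in> lie_bracket_span br ?D ?D" using ab by (intro lie_bracket_span_memI)
      moreover have "br a b' + br b (a' + b') \<in> J"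
        using ab V J(1) by (intro subspace_add[OF sJ(1)] ideal_right[OF J(1) ab(4)]) (auto simp: lie_ideal_def)
      ultimately show "br x y \<in> {x + y |x y. x \<in> lie_bracket_span br ?D ?D \<and> y \<in> J}" by blast
    qed
  qed auto
  obtain n where "lie_derived_series br I n = {0}" using I by (auto simp: lie_solvable_def)
  then have "lie_derived_series br ?S n \<subseteq> J" using D[of n] by auto
  then show "lie_solvable ?S br" using solvable_if_derived_in_solvable[OF sS _ J(2)] by blast
qed

text \<open>
  The radical is defined as a span; a solvable ideal of maximal dimension absorbs all the others,
  hence coincides with it.
\<close>
lemma radical_greatest:
  "lie_ideal V br (lie_radical V br)" "lie_solvable (lie_radical V br) br"
  "\<And>I. lie_ideal V br I \<Longrightarrow> lie_solvable I br \<Longrightarrow> I \<subseteq> lie_radical V br"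
proof -
  let ?P = "\<lambda>I. lie_ideal V br I \<and> lie_solvable I br"
  have "?P {0}"
    by (auto simp: lie_ideal_def lie_solvable_def subspace_0 intro!: exI[of _ 0])
  moreover have "\<forall>I. ?P I \<longrightarrow> dim I < Suc (dim V)"
    using fd_subspace_dim_le[OF finite_dimensional, of _ V] by (auto simp: lie_ideal_def less_Suc_eq_le)
  ultimately obtain I where I: "?P I" "\<And>J. ?P J \<Longrightarrow> dim J \<le> dim I"
    using ex_has_greatest_nat[of ?P "{0}" dim "Suc (dim V)"] by blast
  have max: "J \<subseteq> I" if J: "?P J" for J
  proof -
    let ?S = "{x + y |x y. x \<in> I \<and> y \<in> J}"
    have S: "?P ?S" using solvable_ideal_sum I(1) J by blast
    have s: "subspace I" "subspace J" using I(1) J by (simp_all add: lie_ideal_def)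
    have *: "I \<subseteq> ?S" "J \<subseteq> ?S"
    proof -
      have "x = x + 0 \<and> x \<in> I \<and> 0 \<in> J" if "x \<in> I" for x using subspace_0[OF s(2)] that by simp
      then show "I \<subseteq> ?S" by blast
      have "x = 0 + x \<and> 0 \<in> I \<and> x \<in> J" if "x \<in> J" for x using subspace_0[OF s(1)] that by simp
      then show "J \<subseteq> ?S" by blast
    qed
    have "I = ?S"
      by (rule fd_subspace_dim_equal[OF finite_dimensional s(1) *(1)]) (use S I(2)[OF S] in \<open>auto simp: lie_ideal_def\<close>)
    then show ?thesis using *(2) by blast
  qed
  have "\<Union>{I. ?P I} = I" using max I(1) by blast
  then have "lie_radical V br = I"
    unfolding lie_radical_def using I(1) by (simp add: lie_ideal_def span_eq_iff)
  then show "lie_ideal V br (lie_radical V br)" "lie_solvable (lie_radical V br) br"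
    "\<And>I. lie_ideal V br I \<Longrightarrow> lie_solvable I br \<Longrightarrow> I \<subseteq> lie_radical V br"
    using I(1) max by auto
qed

abbreviation "R \<equiv> lie_radical V br"

lemma subspace_radical: "subspace R" and radical_subset: "R \<subseteq> V"
  using radical_greatest(1) by (auto simp: lie_ideal_def)

lemma radical_in_carrier[simp]: "x \<in> R \<Longrightarrow> x \<in> V" using radical_subset by auto

lemma br_radical_right: "x \<in> V \<Longrightarrow> y \<in> R \<Longrightarrow> br x y \<in> R"
  using radical_greatest(1) by (auto simp: lie_ideal_def)

lemma br_radical_left: "x \<in> R \<Longrightarrow> y \<in> V \<Longrightarrow> br x y \<in> R"
  using ideal_right[OF radical_greatest(1)] .

end

section \<open>Engel's theorem modulo the radical\<close>

context fd_lie_algebra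
begin

text \<open>
  The induction step common to Engel's theorem and its corollary.  \<open>H'\<close> is a maximal proper subalgebra
  above \<open>R\<close>; Engel's theorem for \<open>H'\<close>, acting on \<open>H / H'\<close>, supplies \<open>b\<close>, and maximality shows that
  \<open>H'\<close> and \<open>b\<close> span \<open>H\<close>.  The theorem enters as a hypothesis since it is available only inductively
  when it is first needed.
\<close>
lemma proper_subalgebra_absorbing:
  assumes H: "subalgebra H" "R \<subseteq> H" "H \<noteq> R"
    and engel: "\<And>H' A B. subalgebra H' \<Longrightarrow> R \<subseteq> H' \<Longrightarrow> H' \<subset> H \<Longrightarrow> subspace A \<Longrightarrow> subspace B \<Longrightarrow>
      R \<subseteq> A \<Longrightarrow> A \<subset> B \<Longrightarrow> B \<subseteq> V \<Longrightarrow> (\<And>h x. h \<in> H' \<Longrightarrow> x \<in> A \<Longrightarrow> br h x \<in> A) \<Longrightarrow>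
      (\<And>h x. h \<in> H' \<Longrightarrow> x \<in> B \<Longrightarrow> br h x \<in> B) \<Longrightarrow> \<exists>v\<in>B - A. \<forall>h\<in>H'. br h v \<in> A"
  obtains H' b where "subalgebra H'" "R \<subseteq> H'" "H' \<subset> H" "b \<in> H" "b \<notin> H'"
    "H = {h + t *\<^sub>R b |h t. h \<in> H'}" "\<forall>h\<in>H'. br h b \<in> H'"
proof -
  let ?P = "\<lambda>S. subalgebra S \<and> R \<subseteq> S \<and> S \<subset> H"
  have HV: "H \<subseteq> V" using H(1) by (simp add: subalgebra_def)
  have "subalgebra R" by (rule ideal_subalgebra[OF radical_greatest(1)])
  then have "?P R" using H by auto
  moreover have "\<forall>S. ?P S \<longrightarrow> dim S < Suc (dim V)"
    using fd_subspace_dim_le[OF finite_dimensional, of _ V] by (auto simp: subalgebra_def less_Suc_eq_le)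
  ultimately obtain H' where H': "?P H'" and max: "\<And>S. ?P S \<Longrightarrow> dim S \<le> dim H'"
    using ex_has_greatest_nat[of ?P R dim "Suc (dim V)"] by blast
  have sH': "subspace H'" "H' \<subseteq> V" and clH': "\<And>x y. x \<in> H' \<Longrightarrow> y \<in> H' \<Longrightarrow> br x y \<in> H'"
    using H' by (simp_all add: subalgebra_def)
  have sH: "subspace H" and clH: "\<And>x y. x \<in> H \<Longrightarrow> y \<in> H \<Longrightarrow> br x y \<in> H"
    using H(1) by (simp_all add: subalgebra_def)
  have "\<exists>v\<in>H - H'. \<forall>h\<in>H'. br h v \<in> H'"
    by (rule engel[of H']) (use H' sH' sH HV clH' clH in auto)
  then obtain b where b: "b \<in> H" "b \<notin> H'" and bH': "\<And>h. h \<in> H' \<Longrightarrow> br h b \<in> H'" by blast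
  let ?S = "{h + t *\<^sub>R b |h t. h \<in> H'}"
  have S_eq: "?S = {x + y |x y. x \<in> H' \<and> y \<in> span {b}}" by (auto simp: span_singleton)
  have sS: "subspace ?S" unfolding S_eq by (rule subspace_sums[OF sH'(1) subspace_span])
  have inV: "h \<in> H' \<Longrightarrow> h \<in> V" "b \<in> V" for h using sH' b HV by auto
  have SH: "?S \<subseteq> H" using H' b sH by (auto intro!: subspace_add[OF sH] subspace_scale[OF sH])
  have clS: "br x y \<in> ?S" if "x \<in> ?S" "y \<in> ?S" for x y
  proof -
    obtain h t where x: "x = h + t *\<^sub>R b" "h \<in> H'" using \<open>x \<in> ?S\<close> by blast
    obtain k u where y: "y = k + u *\<^sub>R b" "k \<in> H'" using \<open>y \<in> ?S\<close> by blast
    note xy = x(1) y(1) x(2) y(2)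
    have "br b k = - br k b" using br_skew inV xy by blast
    then have "br x y = (br h k + u *\<^sub>R br h b - t *\<^sub>R br k b) + 0 *\<^sub>R b"
      using xy inV by (simp add: br_add_left br_add_right br_scale_left br_scale_right bracket_alternating)
    moreover have "br h k + u *\<^sub>R br h b - t *\<^sub>R br k b \<in> H'"
      using xy clH' bH' by (intro subspace_diff[OF sH'(1)] subspace_add[OF sH'(1)] subspace_scale[OF sH'(1)])
    ultimately show ?thesis by blast
  qed
  have H'S: "H' \<subseteq> ?S"
  proof
    fix x assume "x \<in> H'"
    then have "x = x + 0 *\<^sub>R b \<and> x \<in> H'" by simp
    then show "x \<in> ?S" by blast
  qed
  have "b = 0 + 1 *\<^sub>R b \<and> 0 \<in> H'" using subspace_0[OF sH'(1)] by simp
  then have bS: "b \<in> ?S" by blast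
  have SV: "?S \<subseteq> V" using SH HV by blast
  have "?S = H"
  proof (rule ccontr)
    assume "?S \<noteq> H"
    then have "?S \<subset> H" using SH by blast
    moreover have "subalgebra ?S" unfolding subalgebra_def using sS SV clS by blast
    moreover have "R \<subseteq> ?S" using H' H'S by blast
    ultimately have "?P ?S" by blast
    then have "dim ?S \<le> dim H'" by (rule max)
    then have "H' = ?S" using fd_subspace_dim_equal[OF finite_dimensional sH'(1) H'S SV] by simp
    then show False using bS b(2) by blast
  qed
  then show ?thesis using that[of H' b] H' b bH' by blast
qed

text \<open>
  Engel's theorem for the adjoint action on \<open>V / R\<close>, formulated for subquotients \<open>B / A\<close> so
  that no abstract representations are needed.
\<close>
theorem engel_mod_radical:
  assumes "subalgebra H" "R \<subseteq> H" "\<And>x. x \<in> H \<Longrightarrow> \<exists>m. \<forall>z\<in>V. (br x ^^ m) z \<in> R"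
    and "subspace A" "subspace B" "R \<subseteq> A" "A \<subset> B" "B \<subseteq> V"
    and "\<And>h x. h \<in> H \<Longrightarrow> x \<in> A \<Longrightarrow> br h x \<in> A" "\<And>h x. h \<in> H \<Longrightarrow> x \<in> B \<Longrightarrow> br h x \<in> B"
  shows "\<exists>v\<in>B - A. \<forall>h\<in>H. br h v \<in> A"
  using assms
proof (induction "dim H" arbitrary: H A B rule: less_induct)
  case less
  have HV: "H \<subseteq> V" using less.prems(1) by (simp add: subalgebra_def)
  show ?case
  proof (cases "H = R")
    case True
    obtain v where v: "v \<in> B - A" using less.prems(7) by blast
    then have "v \<in> V" using less.prems(8) by blast
    then have "\<forall>h\<in>H. br h v \<in> A" using True less.prems(6) br_radical_left by blast
    then show ?thesis using v by blast
  next
    case False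
    have IH: "\<exists>v\<in>B' - A'. \<forall>h\<in>H'. br h v \<in> A'"
      if "subalgebra H'" "R \<subseteq> H'" "H' \<subset> H" "subspace A'" "subspace B'"
        "R \<subseteq> A'" "A' \<subset> B'" "B' \<subseteq> V" "\<And>h x. h \<in> H' \<Longrightarrow> x \<in> A' \<Longrightarrow> br h x \<in> A'"
        "\<And>h x. h \<in> H' \<Longrightarrow> x \<in> B' \<Longrightarrow> br h x \<in> B'" for H' A' B'
    proof (rule less.hyps[OF _ that(1,2) _ that(4-8)])
      have "subspace H'" using that(1) by (simp add: subalgebra_def)
      then show "dim H' < dim H"
        using fd_subspace_dim_equal[OF finite_dimensional, of H' H] that(3) HV by force
      fix x assume "x \<in> H'"
      then show "\<exists>m. \<forall>z\<in>V. (br x ^^ m) z \<in> R" using less.prems(3) that(3) by blast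
    qed (use that(9,10) in auto)
    obtain H' b where H': "subalgebra H'" "R \<subseteq> H'" "H' \<subset> H" and b: "b \<in> H" "b \<notin> H'"
      and Heq: "H = {h + t *\<^sub>R b |h t. h \<in> H'}" and bH'': "\<forall>h\<in>H'. br h b \<in> H'"
      by (rule proper_subalgebra_absorbing[OF less.prems(1,2) False IH])
    have bH': "\<And>h. h \<in> H' \<Longrightarrow> br h b \<in> H'" using bH'' by blast
    have H'H: "h \<in> H' \<Longrightarrow> h \<in> H" for h using H'(3) by blast
    define C where "C = {v \<in> B. \<forall>h\<in>H'. br h v \<in> A}"
    have "\<exists>v\<in>B - A. \<forall>h\<in>H'. br h v \<in> A"
      by (rule IH[OF H' less.prems(4-8)]) (use less.prems(9,10) H'H in auto)
    then obtain v where v: "v \<in> C" "v \<notin> A" by (auto simp: C_def)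
    have inV: "x \<in> B \<Longrightarrow> x \<in> V" "h \<in> H \<Longrightarrow> h \<in> V" for x h using less.prems(8) HV by auto
    have bC: "br b x \<in> C" if x: "x \<in> C" for x
    proof -
      have xB: "x \<in> B" "x \<in> V" and hx: "\<And>h. h \<in> H' \<Longrightarrow> br h x \<in> A" using x inV by (auto simp: C_def)
      have "br h (br b x) \<in> A" if h: "h \<in> H'" for h
      proof -
        have "br h (br b x) = br (br h b) x + br b (br h x)"
          using br_derivation inV H'H[OF h] b(1) xB by blast
        then show ?thesis using hx[OF bH'[OF h]] less.prems(9)[OF b(1) hx[OF h]] subspace_add[OF less.prems(4)] by simp
      qed
      then show ?thesis using less.prems(10)[OF b(1) xB(1)] by (simp add: C_def)
    qed
    have pow: "(br b ^^ k) v \<in> C" for k by (induction k) (auto simp: v bC)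
    obtain m where "\<forall>z\<in>V. (br b ^^ m) z \<in> R" using less.prems(3)[OF b(1)] by blast
    then have "(br b ^^ m) v \<in> A" using v(1) inV less.prems(6) by (auto simp: C_def)
    then obtain k where k: "(br b ^^ k) v \<in> A" "\<And>l. l < k \<Longrightarrow> (br b ^^ l) v \<notin> A"
      using exists_least_iff[of "\<lambda>k. (br b ^^ k) v \<in> A"] by blast
    have "k \<noteq> 0" using k(1) v(2) by (auto intro: gr0I)
    then obtain l where l: "k = Suc l" by (cases k) auto
    define u where "u = (br b ^^ l) v"
    have u: "u \<in> C" "u \<notin> A" "br b u \<in> A" using pow[of l] k(2)[of l] k(1) l by (auto simp: u_def)
    have uB: "u \<in> B" and hu: "\<And>h. h \<in> H' \<Longrightarrow> br h u \<in> A" using u(1) by (auto simp: C_def)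
    have "br h u \<in> A" if hH: "h \<in> H" for h
    proof -
      obtain h' t where h: "h = h' + t *\<^sub>R b" "h' \<in> H'" using hH Heq by blast
      have "br h u = br h' u + t *\<^sub>R br b u"
        using h inV H'H b(1) uB by (simp add: br_add_left br_scale_left)
      then show ?thesis
        using hu[OF h(2)] u(3) subspace_add[OF less.prems(4)] subspace_scale[OF less.prems(4)] by simp
    qed
    then show ?thesis using u(2) uB by blast
  qed
qed

text \<open>
  Otherwise the image of \<open>M\<close> in \<open>V / R\<close> would be a nonzero algebra acting nilpotently, and by Engel's
  theorem its derived algebra would be proper.
\<close>
lemma perfect_nilpotent_in_radical:
  assumes M: "subalgebra M" "M = lie_bracket_span br M M"
    and nil: "\<And>x. x \<in> M \<Longrightarrow> \<exists>m. \<forall>z\<in>V. (br x ^^ m) z \<in> R"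
  shows "M \<subseteq> R"
proof (rule ccontr)
  assume notR: "\<not> M \<subseteq> R"
  let ?H = "{x + y |x y. x \<in> M \<and> y \<in> R}"
  have sM: "subspace M" "M \<subseteq> V" and clM: "\<And>x y. x \<in> M \<Longrightarrow> y \<in> M \<Longrightarrow> br x y \<in> M"
    using M(1) by (simp_all add: subalgebra_def)
  have sH: "subspace ?H" by (rule subspace_sums[OF sM(1) subspace_radical])
  have MH: "M \<subseteq> ?H" and RH: "R \<subseteq> ?H"
  proof -
    have "x = x + 0 \<and> x \<in> M \<and> 0 \<in> R" if "x \<in> M" for x using subspace_0[OF subspace_radical] that by simp
    then show "M \<subseteq> ?H" by blast
    have "x = 0 + x \<and> 0 \<in> M \<and> x \<in> R" if "x \<in> R" for x using subspace_0[OF sM(1)] that by simp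
    then show "R \<subseteq> ?H" by blast
  qed
  have HV: "?H \<subseteq> V" using sM(2) by (auto intro!: carrier_add)
  have brH: "br (x + r) (y + s) - br x y \<in> R" if "x \<in> V" "y \<in> V" "r \<in> R" "s \<in> R" for x y r s
  proof -
    have "br (x + r) (y + s) - br x y = br x s + br r (y + s)"
      using that by (simp add: br_add_left br_add_right)
    then show ?thesis using that subspace_add[OF subspace_radical] br_radical_left br_radical_right by simp
  qed
  have clH: "br h k \<in> ?H" if hk: "h \<in> ?H" "k \<in> ?H" for h k
  proof -
    obtain x r where h: "h = x + r" "x \<in> M" "r \<in> R" using hk(1) by blast
    obtain y s where k: "k = y + s" "y \<in> M" "s \<in> R" using hk(2) by blast
    note e = h(1) k(1) h(2) k(2) h(3) k(3)
    have "x \<in> V" "y \<in> V" using e sM(2) by auto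
    then have "br h k = br x y + (br h k - br x y) \<and> br x y \<in> M \<and> br h k - br x y \<in> R"
      using brH[of x y r s] e clM by simp
    then show ?thesis by blast
  qed
  have H: "subalgebra ?H" using sH HV clH by (simp add: subalgebra_def)
  have nilH: "\<exists>m. \<forall>z\<in>V. (br h ^^ m) z \<in> R" if hH: "h \<in> ?H" for h
  proof -
    obtain x r where e: "h = x + r" "x \<in> M" "r \<in> R" using hH by blast
    have xV: "x \<in> V" using e sM(2) by auto
    obtain m where m: "\<forall>z\<in>V. (br x ^^ m) z \<in> R" using nil e(2) by blast
    have "(br h ^^ k) z - (br x ^^ k) z \<in> R \<and> (br h ^^ k) z \<in> V \<and> (br x ^^ k) z \<in> V" if "z \<in> V" for k z
    proof (induction k)
      case 0
      then show ?case using that subspace_0[OF subspace_radical] by simp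
    next
      case (Suc k)
      have "br h ((br h ^^ k) z) - br x ((br x ^^ k) z)
        = br x ((br h ^^ k) z - (br x ^^ k) z) + br r ((br h ^^ k) z)"
        using Suc e xV by (simp add: br_add_left br_diff_right)
      moreover have "\<dots> \<in> R"
        using Suc e xV by (intro subspace_add[OF subspace_radical] br_radical_left br_radical_right) auto
      ultimately show ?case using Suc e xV by simp
    qed
    then have "(br h ^^ m) z \<in> R" if "z \<in> V" for z
      using m subspace_add[OF subspace_radical, of "(br h ^^ m) z - (br x ^^ m) z" "(br x ^^ m) z"] that by auto
    then show ?thesis by blast
  qed
  have neq: "?H \<noteq> R" using MH notR by blast
  have eng: "\<exists>v\<in>B - A. \<forall>h\<in>H'. br h v \<in> A" if "subalgebra H'" "R \<subseteq> H'" "H' \<subset> ?H" "subspace A" "subspace B"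
        "R \<subseteq> A" "A \<subset> B" "B \<subseteq> V" "\<And>h x. h \<in> H' \<Longrightarrow> x \<in> A \<Longrightarrow> br h x \<in> A"
        "\<And>h x. h \<in> H' \<Longrightarrow> x \<in> B \<Longrightarrow> br h x \<in> B" for H' A B
  proof (rule engel_mod_radical[OF that(1,2) _ that(4-8)])
    fix x assume "x \<in> H'"
    then show "\<exists>m. \<forall>z\<in>V. (br x ^^ m) z \<in> R" using nilH that(3) by blast
  qed (use that(9,10) in auto)
  (* [H, H] lies in H' for an ideal H' of codimension one, but H = [M, M] + R. *)
  obtain H' b where H': "subalgebra H'" "R \<subseteq> H'" "H' \<subset> ?H" and b: "b \<in> ?H" "b \<notin> H'"
      and Heq: "?H = {h + t *\<^sub>R b |h t. h \<in> H'}" and bH'': "\<forall>h\<in>H'. br h b \<in> H'"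
    by (rule proper_subalgebra_absorbing[OF H RH neq eng])
  have bH': "\<And>h. h \<in> H' \<Longrightarrow> br h b \<in> H'" using bH'' by blast
  have sH': "subspace H'" "H' \<subseteq> V" and clH': "\<And>x y. x \<in> H' \<Longrightarrow> y \<in> H' \<Longrightarrow> br x y \<in> H'"
    using H' by (simp_all add: subalgebra_def)
  have inV: "h \<in> H' \<Longrightarrow> h \<in> V" "b \<in> V" for h using sH'(2) b HV by auto
  have brH': "br x y \<in> H'" if "x \<in> ?H" "y \<in> ?H" for x y
  proof -
    obtain h t where x: "x = h + t *\<^sub>R b" "h \<in> H'" using \<open>x \<in> ?H\<close> Heq by blast
    obtain k u where y: "y = k + u *\<^sub>R b" "k \<in> H'" using \<open>y \<in> ?H\<close> Heq by blast
    have "br b k = - br k b" using br_skew inV y by blast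
    then have "br x y = br h k + u *\<^sub>R br h b - t *\<^sub>R br k b"
      using x y inV by (simp add: br_add_left br_add_right br_scale_left br_scale_right bracket_alternating)
    also have "\<dots> \<in> H'"
      using x y clH' bH' by (intro subspace_diff[OF sH'(1)] subspace_add[OF sH'(1)] subspace_scale[OF sH'(1)])
    finally show ?thesis .
  qed
  have "br x y \<in> H'" if "x \<in> M" "y \<in> M" for x y
    using brH'[OF subsetD[OF MH] subsetD[OF MH]] that .
  then have "lie_bracket_span br M M \<subseteq> H'" by (rule lie_bracket_span_subset[OF sH'(1)])
  then have "M \<subseteq> H'" using M(2) by simp
  then have "?H \<subseteq> H'" using H'(2) by (auto intro!: subspace_add[OF sH'(1)])
  then show False using H'(3) by blast
qed

end

section \<open>The Killing form of the quotient by the radical\<close>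

lemma mat_trace_add: "A \<in> carrier_mat d d \<Longrightarrow> B \<in> carrier_mat d d \<Longrightarrow> mat_trace (A + B) = mat_trace A + mat_trace B"
  by (simp add: mat_trace_def sum.distrib)

lemma mat_trace_minus:
  fixes A B :: "'a::ab_group_add mat"
  shows "A \<in> carrier_mat d d \<Longrightarrow> B \<in> carrier_mat d d \<Longrightarrow> mat_trace (A - B) = mat_trace A - mat_trace B"
  by (simp add: mat_trace_def sum_subtractf)

lemma mat_trace_smult:
  fixes A :: "'a::semiring_0 mat"
  shows "A \<in> carrier_mat d d \<Longrightarrow> mat_trace (k \<cdot>\<^sub>m A) = k * mat_trace A"
  by (simp add: mat_trace_def sum_distrib_left)

lemma linear_on_0: "linear_on V f \<Longrightarrow> subspace V \<Longrightarrow> f 0 = 0"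
  using subspace_0[of V] by (metis linear_on_def scaleR_zero_left)

lemma linear_on_sum:
  assumes "subspace V" "linear_on V f" "finite A" "\<And>i. i \<in> A \<Longrightarrow> x i \<in> V"
  shows "f (\<Sum>i\<in>A. x i) = (\<Sum>i\<in>A. f (x i))"
  using assms(3,4)
proof (induction A rule: finite_induct)
  case empty
  then show ?case using linear_on_0[OF assms(2,1)] by simp
next
  case (insert i A)
  then show ?case using assms(2) subspace_sum[OF assms(1), of A x] by (simp add: linear_on_def)
qed

lemma linear_on_image_subspace:
  assumes "linear_on V f" "subspace V" "subspace S" "S \<subseteq> V"
  shows "subspace (f ` S)"
  unfolding real_vector.subspace_def
proof (intro conjI ballI allI)
  show "0 \<in> f ` S" using linear_on_0[OF assms(1,2)] subspace_0[OF assms(3)] by (metis image_eqI)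
  fix x y assume "x \<in> f ` S" "y \<in> f ` S"
  then obtain a a' where a: "x = f a" "y = f a'" "a \<in> S" "a' \<in> S" by blast
  then have "x + y = f (a + a')" using assms(1,4) by (auto simp: linear_on_def subset_iff)
  then show "x + y \<in> f ` S" using subspace_add[OF assms(3)] a by blast
next
  fix k x assume "x \<in> f ` S"
  then obtain a where a: "x = f a" "a \<in> S" by blast
  then have "k *\<^sub>R x = f (k *\<^sub>R a)" using assms(1,4) by (auto simp: linear_on_def subset_iff)
  then show "k *\<^sub>R x \<in> f ` S" using subspace_scale[OF assms(3)] a by blast
qed

context fd_lie_algebra
begin

text \<open>
  The image of the radical is again a solvable ideal.
\<close>
lemma involutive_automorphism_radical:
  assumes f: "lie_automorphism V br f" "\<And>x. x \<in> V \<Longrightarrow> f (f x) = x" and r: "r \<in> R"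
  shows "f r \<in> R"
proof -
  have lin: "linear_on V f" and fV: "\<And>x. x \<in> V \<Longrightarrow> f x \<in> V"
    and hom: "\<And>x y. x \<in> V \<Longrightarrow> y \<in> V \<Longrightarrow> f (br x y) = br (f x) (f y)"
    using f(1) by (auto simp: lie_automorphism_def bij_betw_def)
  have img: "subspace S \<Longrightarrow> S \<subseteq> V \<Longrightarrow> subspace (f ` S)" for S
    by (rule linear_on_image_subspace[OF lin subspace_carrier])
  have sub: "subspace (f ` R)" by (rule img[OF subspace_radical radical_subset])
  have ideal: "lie_ideal V br (f ` R)" unfolding lie_ideal_def
  proof (intro conjI ballI sub)
    show "f ` R \<subseteq> V" using fV by auto
    fix x y assume x: "x \<in> V" and "y \<in> f ` R"
    then obtain s where s: "y = f s" "s \<in> R" by blast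
    then have "br x y = f (br (f x) s)" using x hom[of "f x" s] fV f(2) by simp
    then show "br x y \<in> f ` R" using br_radical_right[OF fV[OF x] s(2)] by blast
  qed
  have D: "lie_derived_series br (f ` R) n \<subseteq> f ` lie_derived_series br R n" for n
  proof (induction n)
    case (Suc n)
    let ?D = "lie_derived_series br R n"
    have DV: "?D \<subseteq> V" "lie_bracket_span br ?D ?D \<subseteq> V"
      using derived_series_subalgebra[OF ideal_subalgebra[OF radical_greatest(1)], of n]
        derived_series_subalgebra[OF ideal_subalgebra[OF radical_greatest(1)], of "Suc n"] by (auto simp: subalgebra_def)
    show ?case unfolding lie_derived_series.simps
    proof (rule lie_bracket_span_subset)
      show "subspace (f ` lie_bracket_span br ?D ?D)"
        by (rule img[OF subspace_lie_bracket_span DV(2)])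
      fix x y assume "x \<in> lie_derived_series br (f ` R) n" "y \<in> lie_derived_series br (f ` R) n"
      then obtain a a' where a: "x = f a" "y = f a'" "a \<in> ?D" "a' \<in> ?D" using Suc by blast
      then have "br x y = f (br a a')" using hom DV(1) by (metis subsetD)
      then show "br x y \<in> f ` lie_bracket_span br ?D ?D" using lie_bracket_span_memI[OF a(3,4)] by blast
    qed
  qed simp
  obtain n where "lie_derived_series br R n = {0}" using radical_greatest(2) by (auto simp: lie_solvable_def)
  then have "lie_derived_series br (f ` R) n \<subseteq> {0}" using D[of n] linear_on_0[OF lin subspace_carrier] by simp
  then have "lie_solvable (f ` R) br" using solvable_iff[OF sub] by blast
  then show ?thesis using radical_greatest(3)[OF ideal] r by blast
qed

context
  (* a relative basis of V modulo its radical *)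
  fixes d :: nat and b :: "nat \<Rightarrow> 'a" and c :: "nat \<Rightarrow> 'a \<Rightarrow> real"
  assumes bV: "\<And>i. i < d \<Longrightarrow> b i \<in> V" and c_lin: "\<And>i. linear (c i)"
    and cR: "\<And>i r. i < d \<Longrightarrow> r \<in> R \<Longrightarrow> c i r = 0"
    and cb: "\<And>i j. i < d \<Longrightarrow> j < d \<Longrightarrow> c i (b j) = (if i = j then 1 else 0)"
    and dec: "\<And>x. x \<in> V \<Longrightarrow> x - (\<Sum>i<d. c i x *\<^sub>R b i) \<in> R"
begin

definition descends :: "('a \<Rightarrow> 'a) \<Rightarrow> bool" where
  "descends g \<longleftrightarrow> linear_on V g \<and> (\<forall>x\<in>V. g x \<in> V) \<and> (\<forall>r\<in>R. g r \<in> R)"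

text \<open>
  The matrix, over the complex numbers because Jordan forms are needed, of the endomorphism that \<open>g\<close>
  induces on \<open>V / R\<close>.
\<close>
definition quotient_mat :: "('a \<Rightarrow> 'a) \<Rightarrow> complex mat" where
  "quotient_mat g = mat d d (\<lambda>(i,j). complex_of_real (c i (g (b j))))"

lemma quotient_mat_carrier[simp]: "quotient_mat g \<in> carrier_mat d d"
  by (simp add: quotient_mat_def)

lemma quotient_mat_dim[simp]: "dim_row (quotient_mat g) = d" "dim_col (quotient_mat g) = d"
  by (simp_all add: quotient_mat_def)

lemma quotient_mat_index[simp]:
  "i < d \<Longrightarrow> j < d \<Longrightarrow> quotient_mat g $$ (i,j) = complex_of_real (c i (g (b j)))"
  by (simp add: quotient_mat_def)

lemma quotient_mat_cong: "(\<And>x. x \<in> V \<Longrightarrow> g x = h x) \<Longrightarrow> quotient_mat g = quotient_mat h"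
  by (rule eq_matI) (simp_all add: bV)

lemma quotient_mat_comp:
  assumes g: "descends g" and h: "\<And>x. x \<in> V \<Longrightarrow> h x \<in> V"
  shows "quotient_mat (\<lambda>x. g (h x)) = quotient_mat g * quotient_mat h"
proof (rule eq_matI)
  fix i j assume "i < dim_row (quotient_mat g * quotient_mat h)" "j < dim_col (quotient_mat g * quotient_mat h)"
  then have ij: "i < d" "j < d" by simp_all
  define y where "y = h (b j)"
  define s where "s = (\<Sum>k<d. c k y *\<^sub>R b k)"
  have gl: "linear_on V g" and gR: "\<And>r. r \<in> R \<Longrightarrow> g r \<in> R" using g by (auto simp: descends_def)
  have yV: "y \<in> V" using h bV ij by (simp add: y_def)
  have sV: "s \<in> V" unfolding s_def by (rule subspace_sum[OF subspace_carrier]) (simp add: bV)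
  have "g s = (\<Sum>k<d. g (c k y *\<^sub>R b k))"
    unfolding s_def by (rule linear_on_sum[OF subspace_carrier gl]) (auto simp: bV)
  then have gs: "g s = (\<Sum>k<d. c k y *\<^sub>R g (b k))" using gl bV by (simp add: linear_on_def)
  have yR: "y - s \<in> R" using dec[OF yV] by (simp add: s_def)
  have "g y = g (s + (y - s))" by simp
  also have "\<dots> = g s + g (y - s)" using gl sV yV unfolding linear_on_def by (metis carrier_diff)
  finally have "c i (g y) = c i (g s)" using cR[OF ij(1) gR[OF yR]] linear_add[OF c_lin] by simp
  also have "\<dots> = (\<Sum>k<d. c i (g (b k)) * c k y)"
    by (simp add: gs linear_sum[OF c_lin] linear_scale[OF c_lin] mult.commute)
  finally show "quotient_mat (\<lambda>x. g (h x)) $$ (i,j) = (quotient_mat g * quotient_mat h) $$ (i,j)"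
    using mat_mult_index[OF quotient_mat_carrier quotient_mat_carrier ij, of g h] ij by (simp add: y_def)
qed simp_all

lemma descends_br: "x \<in> V \<Longrightarrow> descends (br x)"
  by (simp add: descends_def linear_on_br br_radical_right)

lemma descends_comp: "descends g \<Longrightarrow> descends h \<Longrightarrow> descends (\<lambda>x. g (h x))"
  by (simp add: descends_def linear_on_def)

lemma descends_pow: "descends g \<Longrightarrow> descends (g ^^ m)"
  by (induction m) (auto simp: descends_def linear_on_def)

lemma quotient_mat_pow: "descends g \<Longrightarrow> quotient_mat (g ^^ m) = quotient_mat g ^\<^sub>m m"
proof (induction m)
  case 0
  show ?case by (rule eq_matI) (simp_all add: cb)
next
  case (Suc m)
  have "quotient_mat (g ^^ Suc m) = quotient_mat (\<lambda>x. (g ^^ m) (g x))"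
    by (rule quotient_mat_cong) (simp add: funpow_swap1)
  also have "\<dots> = quotient_mat (g ^^ m) * quotient_mat g"
    using Suc.prems by (intro quotient_mat_comp descends_pow) (auto simp: descends_def)
  finally show ?case using Suc by (simp del: funpow.simps)
qed

lemma quotient_mat_zero_iff:
  assumes g: "descends g"
  shows "quotient_mat g = 0\<^sub>m d d \<longleftrightarrow> (\<forall>z\<in>V. g z \<in> R)"
proof
  assume 0: "quotient_mat g = 0\<^sub>m d d"
  have gl: "linear_on V g" and gR: "\<And>r. r \<in> R \<Longrightarrow> g r \<in> R" and gV: "\<And>x. x \<in> V \<Longrightarrow> g x \<in> V"
    using g by (auto simp: descends_def)
  have gb: "g (b j) \<in> R" if j: "j < d" for j
  proof -
    have "c i (g (b j)) = 0" if "i < d" for i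
      using quotient_mat_index[OF that j, of g] that j unfolding 0 by simp
    then show ?thesis using dec[OF gV[OF bV[OF j]]] by simp
  qed
  show "\<forall>z\<in>V. g z \<in> R"
  proof
    fix z assume z: "z \<in> V"
    define s where "s = (\<Sum>k<d. c k z *\<^sub>R b k)"
    have sV: "s \<in> V" unfolding s_def by (rule subspace_sum[OF subspace_carrier]) (simp add: bV)
    have "g s = (\<Sum>k<d. g (c k z *\<^sub>R b k))"
      unfolding s_def by (rule linear_on_sum[OF subspace_carrier gl]) (auto simp: bV)
    then have "g s = (\<Sum>k<d. c k z *\<^sub>R g (b k))" using gl bV by (simp add: linear_on_def)
    then have "g s \<in> R" using gb by (auto intro!: subspace_sum[OF subspace_radical] subspace_scale[OF subspace_radical])
    moreover have "g (z - s) \<in> R" using dec[OF z] gR by (simp add: s_def)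
    moreover have "g (s + (z - s)) = g s + g (z - s)"
      using gl sV z unfolding linear_on_def by (metis carrier_diff)
    ultimately show "g z \<in> R" using subspace_add[OF subspace_radical] by simp
  qed
next
  assume "\<forall>z\<in>V. g z \<in> R"
  then show "quotient_mat g = 0\<^sub>m d d" by (intro eq_matI) (simp_all add: bV cR)
qed

abbreviation "ad_mat x \<equiv> quotient_mat (br x)"

lemma ad_mat_bracket:
  assumes "x \<in> V" "y \<in> V"
  shows "ad_mat (br x y) = ad_mat x * ad_mat y - ad_mat y * ad_mat x"
proof -
  have 1: "ad_mat x * ad_mat y = quotient_mat (\<lambda>z. br x (br y z))"
    using assms by (intro quotient_mat_comp[symmetric] descends_br) auto
  have 2: "ad_mat y * ad_mat x = quotient_mat (\<lambda>z. br y (br x z))"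
    using assms by (intro quotient_mat_comp[symmetric] descends_br) auto
  show ?thesis unfolding 1 2
    by (rule eq_matI) (simp_all add: br_bracket_left assms bV linear_diff[OF c_lin])
qed

definition killing :: "'a \<Rightarrow> 'a \<Rightarrow> real" where
  "killing x y = (\<Sum>i<d. \<Sum>k<d. c i (br x (b k)) * c k (br y (b i)))"

lemma of_real_killing: "complex_of_real (killing x y) = mat_trace (ad_mat x * ad_mat y)"
  by (simp add: killing_def mat_trace_def mat_mult_index[of _ d] del: index_mult_mat(1))

lemma killing_sym: "killing x y = killing y x"
proof -
  have "complex_of_real (killing x y) = complex_of_real (killing y x)"
    unfolding of_real_killing by (rule mat_trace_comm[of _ d]) simp_all
  then show ?thesis by simp
qed

lemma killing_bilinear: "bilinear_on V killing"
  by (auto simp: bilinear_on_def linear_on_def killing_def br_add_left br_scale_left bV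
      linear_add[OF c_lin] linear_scale[OF c_lin] algebra_simps sum.distrib sum_distrib_left)

lemma killing_invariant:
  assumes "x \<in> V" "y \<in> V" "z \<in> V"
  shows "killing (br x y) z = killing x (br y z)"
proof -
  let ?X = "ad_mat x" and ?Y = "ad_mat y" and ?Z = "ad_mat z"
  note car = mult_carrier_mat[of _ d d _ d]
  have "complex_of_real (killing (br x y) z) = mat_trace ((?X * ?Y - ?Y * ?X) * ?Z)"
    by (simp add: of_real_killing ad_mat_bracket assms)
  also have "\<dots> = mat_trace (?X * ?Y * ?Z) - mat_trace (?Y * (?X * ?Z))"
    by (simp add: minus_mult_distrib_mat[of _ d d _ _ d] mat_trace_minus[of _ d] car assoc_mult_mat[of _ d d _ d _ d])
  also have "mat_trace (?Y * (?X * ?Z)) = mat_trace (?X * ?Z * ?Y)"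
    by (rule mat_trace_comm[of _ d]) (simp_all add: car)
  also have "mat_trace (?X * ?Y * ?Z) - mat_trace (?X * ?Z * ?Y) = mat_trace (?X * (?Y * ?Z - ?Z * ?Y))"
    by (simp add: mult_minus_distrib_mat[of _ d d _ d] mat_trace_minus[of _ d] car assoc_mult_mat[of _ d d _ d _ d])
  also have "\<dots> = complex_of_real (killing x (br y z))"
    by (simp add: of_real_killing ad_mat_bracket assms)
  finally show ?thesis by simp
qed

lemma killing_automorphism:
  assumes f: "lie_automorphism V br f" "\<And>x. x \<in> V \<Longrightarrow> f (f x) = x" and xy: "x \<in> V" "y \<in> V"
  shows "killing (f x) (f y) = killing x y"
proof -
  have fd: "descends f"
    using f involutive_automorphism_radical[OF f] by (auto simp: descends_def lie_automorphism_def bij_betw_def)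
  have fV: "\<And>x. x \<in> V \<Longrightarrow> f x \<in> V" using fd by (simp add: descends_def)
  let ?F = "quotient_mat f"
  note car = mult_carrier_mat[of _ d d _ d]
  have "?F * ?F = quotient_mat (\<lambda>x. f (f x))" by (rule quotient_mat_comp[symmetric, OF fd fV])
  also have "\<dots> = 1\<^sub>m d" by (rule eq_matI) (simp_all add: f(2) bV cb)
  finally have FF: "?F * ?F = 1\<^sub>m d" .
  have ad: "ad_mat (f z) = ?F * ad_mat z * ?F" if z: "z \<in> V" for z
  proof -
    have "?F * ad_mat z = quotient_mat (\<lambda>w. f (br z w))"
      using z by (intro quotient_mat_comp[symmetric, OF fd]) simp
    also have "\<dots> = quotient_mat (\<lambda>w. br (f z) (f w))"
      using f(1) z by (intro quotient_mat_cong) (simp add: lie_automorphism_def)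
    also have "\<dots> = ad_mat (f z) * ?F"
      by (rule quotient_mat_comp[OF descends_br fV]) (use z fV in auto)
    finally have "?F * ad_mat z * ?F = ad_mat (f z) * (?F * ?F)" by (simp add: assoc_mult_mat[of _ d d _ d _ d])
    then show ?thesis unfolding FF by simp
  qed
  have "complex_of_real (killing (f x) (f y)) = mat_trace (?F * (ad_mat x * ad_mat y) * ?F)"
    unfolding of_real_killing ad[OF xy(1)] ad[OF xy(2)]
    by (simp add: conjugation_mult[OF _ _ FF FF])
  also have "\<dots> = complex_of_real (killing x y)"
    unfolding of_real_killing by (rule conjugation_trace[OF _ _ FF FF]) (simp_all add: car)
  finally show ?thesis by simp
qed

lemma killing_zero_if_nilpotent:
  assumes xy: "x \<in> V" "y \<in> V" and nil: "\<And>z. z \<in> V \<Longrightarrow> ((\<lambda>z. br x (br y z)) ^^ m) z \<in> R"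
  shows "killing x y = 0"
proof -
  let ?g = "\<lambda>z. br x (br y z)"
  have g: "descends ?g" by (rule descends_comp[OF descends_br descends_br]) (use xy in auto)
  have gm: "quotient_mat ?g = ad_mat x * ad_mat y" by (rule quotient_mat_comp[OF descends_br]) (use xy in auto)
  have "quotient_mat (?g ^^ m) = 0\<^sub>m d d" using quotient_mat_zero_iff[OF descends_pow[OF g]] nil by blast
  then have "(ad_mat x * ad_mat y) ^\<^sub>m m = 0\<^sub>m d d" using quotient_mat_pow[OF g, of m] gm by simp
  then have "mat_trace (ad_mat x * ad_mat y) = 0"
    by (intro nilpotent_trace_zero[of _ d m]) (simp_all add: mult_carrier_mat[of _ d d _ d])
  then show ?thesis using of_real_killing[of x y] by simp
qed

text \<open>
  Cartan's criterion.  An element \<open>x\<close> of \<open>M = [M,M]\<close> is a sum of brackets, so for \<open>Y\<close> normalizing the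
  complexified image of \<open>M\<close> the trace of \<open>ad x Y\<close> is a sum of terms \<open>tr (ad u [ad v, Y])\<close>, all zero by
  isotropy.
\<close>
lemma ad_nilpotent_if_killing_isotropic:
  assumes M: "subalgebra M" "M = lie_bracket_span br M M"
    and iso: "\<And>x y. x \<in> M \<Longrightarrow> y \<in> M \<Longrightarrow> killing x y = 0" and x: "x \<in> M"
  shows "\<forall>z\<in>V. (br x ^^ d) z \<in> R"
proof -
  have sM: "subspace M" and MV: "\<And>x. x \<in> M \<Longrightarrow> x \<in> V" and clM: "\<And>x y. x \<in> M \<Longrightarrow> y \<in> M \<Longrightarrow> br x y \<in> M"
    using M(1) by (auto simp: subalgebra_def)
  note car = mult_carrier_mat[of _ d d _ d]
  (* E u v is the element u + i v of the complexification *)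
  define E where "E u v = ad_mat u + \<i> \<cdot>\<^sub>m ad_mat v" for u v
  have Ec[simp]: "E u v \<in> carrier_mat d d" "dim_row (E u v) = d" "dim_col (E u v) = d" for u v
    by (simp_all add: E_def)
  have Ei[simp]: "E u v $$ (i,j) = Complex (c i (br u (b j))) (c i (br v (b j)))" if "i < d" "j < d" for u v i j
    using that by (simp add: E_def complex_eq_iff)
  let ?M = "{E u v |u v. u \<in> M \<and> v \<in> M}"
  have "ad_mat x ^\<^sub>m d = 0\<^sub>m d d"
  proof (rule nilpotent_if_trace_orthogonal_to_normalizer[of _ _ ?M])
    show "?M \<subseteq> carrier_mat d d" by auto
    have "0\<^sub>m d d = E 0 0" by (rule eq_matI) (simp_all add: bV linear_0[OF c_lin] complex_eq_iff)
    then show "0\<^sub>m d d \<in> ?M" using subspace_0[OF sM] by blast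
  next
    fix B C assume "B \<in> ?M" "C \<in> ?M"
    then obtain u v u' v' where e: "B = E u v" "C = E u' v'" and uv: "u \<in> M" "v \<in> M" "u' \<in> M" "v' \<in> M" by auto
    have "B + C = E (u + u') (v + v')" unfolding e
      by (rule eq_matI) (simp_all add: bV MV uv br_add_left linear_add[OF c_lin] complex_eq_iff)
    then show "B + C \<in> ?M" using uv subspace_add[OF sM] by blast
  next
    fix B k assume "B \<in> ?M"
    then obtain u v where e: "B = E u v" and uv: "u \<in> M" "v \<in> M" by auto
    have "k \<cdot>\<^sub>m B = E (Re k *\<^sub>R u - Im k *\<^sub>R v) (Re k *\<^sub>R v + Im k *\<^sub>R u)" unfolding e
      by (rule eq_matI) (simp_all add: bV MV uv br_add_left br_diff_left br_scale_left linear_add[OF c_lin]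
          linear_diff[OF c_lin] linear_scale[OF c_lin] complex_eq_iff)
    moreover have "Re k *\<^sub>R u - Im k *\<^sub>R v \<in> M" "Re k *\<^sub>R v + Im k *\<^sub>R u \<in> M"
      using uv by (auto intro!: subspace_diff[OF sM] subspace_add[OF sM] subspace_scale[OF sM])
    ultimately show "k \<cdot>\<^sub>m B \<in> ?M" by blast
  next
    fix B assume "B \<in> ?M"
    then obtain u v where e: "B = E u v" and uv: "u \<in> M" "v \<in> M" by auto
    let ?X = "ad_mat x" and ?U = "ad_mat u" and ?W = "ad_mat v"
    have "?X * B = ?X * ?U + \<i> \<cdot>\<^sub>m (?X * ?W)" "B * ?X = ?U * ?X + \<i> \<cdot>\<^sub>m (?W * ?X)"
      by (simp_all add: e E_def mult_add_distrib_mat[of _ d d _ d] add_mult_distrib_mat[of _ d d _ _ d]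
          mult_smult_distrib[of _ d d _ d] mult_smult_assoc_mat[of _ d d _ d])
    moreover have "P + \<i> \<cdot>\<^sub>m Q - (P' + \<i> \<cdot>\<^sub>m Q') = (P - P') + \<i> \<cdot>\<^sub>m (Q - Q')"
      if "P \<in> carrier_mat d d" "Q \<in> carrier_mat d d" "P' \<in> carrier_mat d d" "Q' \<in> carrier_mat d d" for P Q P' Q'
      by (rule eq_matI) (use that in \<open>simp_all add: algebra_simps\<close>)
    ultimately have "?X * B - B * ?X = E (br x u) (br x v)"
      by (simp add: car E_def ad_mat_bracket MV uv x)
    then show "?X * B - B * ?X \<in> ?M" using clM[OF x] uv by blast
  next
    fix Y assume Y: "Y \<in> carrier_mat d d" and norm: "\<And>B. B \<in> ?M \<Longrightarrow> Y * B - B * Y \<in> ?M"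
    let ?S = "{z \<in> V. mat_trace (ad_mat z * Y) = 0}"
    have add: "ad_mat (u + v) = ad_mat u + ad_mat v" if "u \<in> V" "v \<in> V" for u v
      by (rule eq_matI) (simp_all add: bV that br_add_left linear_add[OF c_lin])
    have scale: "ad_mat (k *\<^sub>R u) = complex_of_real k \<cdot>\<^sub>m ad_mat u" if "u \<in> V" for u k
      by (rule eq_matI) (simp_all add: bV that br_scale_left linear_scale[OF c_lin])
    have zero: "ad_mat 0 = 0 \<cdot>\<^sub>m ad_mat 0" by (rule eq_matI) (simp_all add: bV linear_0[OF c_lin])
    have "subspace ?S" unfolding real_vector.subspace_def
    proof (intro conjI ballI allI)
      have "mat_trace (ad_mat 0 * Y) = 0"
        by (subst zero) (simp add: mult_smult_assoc_mat[of _ d d _ d] Y mat_trace_smult[of _ d] car)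
      then show "0 \<in> ?S" by simp
    qed (auto simp: add scale Y car add_mult_distrib_mat[of _ d d _ _ d] mat_trace_add[of _ d]
        mult_smult_assoc_mat[of _ d d _ d] mat_trace_smult[of _ d])
    moreover have "br u v \<in> ?S" if uv: "u \<in> M" "v \<in> M" for u v
    proof -
      let ?U = "ad_mat u" and ?W = "ad_mat v"
      have "?W = E v 0" by (rule eq_matI) (simp_all add: bV linear_0[OF c_lin] complex_eq_iff)
      then have "Y * ?W - ?W * Y \<in> ?M" using norm[of ?W] uv subspace_0[OF sM] by blast
      then obtain p q where pq: "Y * ?W - ?W * Y = E p q" "p \<in> M" "q \<in> M" by auto
      have "mat_trace (ad_mat (br u v) * Y) = mat_trace (?U * ?W * Y) - mat_trace (?W * (?U * Y))"
        using uv by (simp add: ad_mat_bracket MV Y car minus_mult_distrib_mat[of _ d d _ _ d] mat_trace_minus[of _ d] assoc_mult_mat[of _ d d _ d _ d])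
      also have "mat_trace (?W * (?U * Y)) = mat_trace (?U * Y * ?W)"
        by (rule mat_trace_comm[of _ d]) (simp_all add: car Y)
      also have "mat_trace (?U * ?W * Y) - mat_trace (?U * Y * ?W) = - mat_trace (?U * (Y * ?W - ?W * Y))"
        by (simp add: Y car mult_minus_distrib_mat[of _ d d _ d] mat_trace_minus[of _ d] assoc_mult_mat[of _ d d _ d _ d])
      also have "?U * (Y * ?W - ?W * Y) = ?U * ad_mat p + \<i> \<cdot>\<^sub>m (?U * ad_mat q)"
        by (simp add: pq E_def mult_add_distrib_mat[of _ d d _ d] mult_smult_distrib[of _ d d _ d])
      also have "mat_trace (?U * ad_mat p + \<i> \<cdot>\<^sub>m (?U * ad_mat q)) = 0"
        using iso[OF uv(1) pq(2)] iso[OF uv(1) pq(3)]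
        by (simp add: mat_trace_add[of _ d] mat_trace_smult[of _ d] car of_real_killing[symmetric])
      finally show ?thesis using uv MV by simp
    qed
    ultimately have "lie_bracket_span br M M \<subseteq> ?S" by (rule lie_bracket_span_subset)
    then show "mat_trace (ad_mat x * Y) = 0" using x M(2) by auto
  qed simp
  then have "quotient_mat (br x ^^ d) = 0\<^sub>m d d" by (simp add: quotient_mat_pow descends_br MV x)
  then show ?thesis using quotient_mat_zero_iff[OF descends_pow[OF descends_br[OF MV[OF x]]]] by blast
qed

text \<open>
  The kernel \<open>N\<close> of the Killing form is an ideal.  The last term of its derived series is perfect and
  isotropic, so it acts nilpotently modulo \<open>R\<close> and lies in \<open>R\<close> by Engel's theorem; hence \<open>N\<close> is
  solvable.
\<close>
lemma killing_nondegenerate_mod_radical: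
  assumes x: "x \<in> V" "\<And>y. y \<in> V \<Longrightarrow> killing x y = 0"
  shows "x \<in> R"
proof -
  have kadd: "killing (u + v) w = killing u w + killing v w" if "u \<in> V" "v \<in> V" "w \<in> V" for u v w
    using killing_bilinear that by (simp add: bilinear_on_def linear_on_def)
  have kscale: "killing (k *\<^sub>R u) w = k * killing u w" if "u \<in> V" "w \<in> V" for u w k
    using killing_bilinear that by (simp add: bilinear_on_def linear_on_def)
  define N where "N = {x \<in> V. \<forall>y\<in>V. killing x y = 0}"
  have sN: "subspace N" unfolding real_vector.subspace_def N_def
    using kscale[of 0 _ 0] by (auto simp: kadd kscale)
  have iN: "lie_ideal V br N" unfolding lie_ideal_def
  proof (intro conjI ballI sN)
    show "N \<subseteq> V" by (auto simp: N_def)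
    fix z w assume z: "z \<in> V" and w: "w \<in> N"
    then have wV: "w \<in> V" by (simp add: N_def)
    have "killing (br z w) y = 0" if y: "y \<in> V" for y
    proof -
      have "killing (br z w) y = killing y (br z w)" by (rule killing_sym)
      also have "\<dots> = killing (br y z) w" using killing_invariant y z wV by simp
      also have "\<dots> = killing w (br y z)" by (rule killing_sym)
      finally show ?thesis using w y z by (simp add: N_def)
    qed
    then show "br z w \<in> N" using z wV by (simp add: N_def)
  qed
  let ?D = "lie_derived_series br N"
  have D: "subalgebra (?D n)" "?D n \<subseteq> N" for n
    using derived_series_subalgebra[OF ideal_subalgebra[OF iN]] by auto
  then have Ds: "subspace (?D n)" "?D n \<subseteq> V" and Dcl: "\<And>x y. x \<in> ?D n \<Longrightarrow> y \<in> ?D n \<Longrightarrow> br x y \<in> ?D n" for n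
    by (auto simp: subalgebra_def)
  have Dsub: "?D (Suc n) \<subseteq> ?D n" for n
    unfolding lie_derived_series.simps by (rule lie_bracket_span_subset[OF Ds(1) Dcl])
  have "\<exists>n. ?D (Suc n) = ?D n"
  proof (rule ccontr)
    assume neg: "\<not> ?thesis"
    have lt: "dim (?D (Suc n)) < dim (?D n)" for n
    proof (rule ccontr)
      assume "\<not> ?thesis"
      then have "dim (?D n) \<le> dim (?D (Suc n))" by (simp only: not_less)
      then have "?D (Suc n) = ?D n" by (rule fd_subspace_dim_equal[OF finite_dimensional Ds(1) Dsub Ds(2)])
      then show False using neg by metis
    qed
    have "dim (?D n) + n \<le> dim (?D 0)" for n
    proof (induction n)
      case (Suc n)
      then show ?case using lt[of n] by simp
    qed simp
    from this[of "Suc (dim (?D 0))"] show False by simp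
  qed
  then obtain n where n: "?D (Suc n) = ?D n" by blast
  have perf: "?D n = lie_bracket_span br (?D n) (?D n)" using n by simp
  have iso: "killing u v = 0" if "u \<in> ?D n" "v \<in> ?D n" for u v
    using that D(2)[of n] by (auto simp: N_def)
  have "\<exists>m. \<forall>z\<in>V. (br u ^^ m) z \<in> R" if "u \<in> ?D n" for u
    using ad_nilpotent_if_killing_isotropic[OF D(1) perf iso that] by (rule exI)
  then have "?D n \<subseteq> R" by (rule perfect_nilpotent_in_radical[OF D(1) perf])
  then have "lie_solvable N br" using solvable_if_derived_in_solvable[OF sN _ radical_greatest(2)] by blast
  then have "N \<subseteq> R" by (rule radical_greatest(3)[OF iN])
  then show ?thesis using x by (auto simp: N_def)
qed

end

end

text \<open>
  The properties of the Killing form of \<open>V / R\<close> on which the study of triples rests.  The penultimate one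
  is all that is retained of its being a trace form.
\<close>
locale radical_form = fd_lie_algebra V br
  for V :: "'a::real_vector set" and br +
  fixes \<beta> :: "'a \<Rightarrow> 'a \<Rightarrow> real"
  assumes \<beta>_bilinear: "bilinear_on V \<beta>"
    and \<beta>_sym: "\<beta> x y = \<beta> y x"
    and \<beta>_invariant: "x \<in> V \<Longrightarrow> y \<in> V \<Longrightarrow> z \<in> V \<Longrightarrow> \<beta> (br x y) z = \<beta> x (br y z)"
    and \<beta>_automorphism: "lie_automorphism V br f \<Longrightarrow> (\<And>x. x \<in> V \<Longrightarrow> f (f x) = x) \<Longrightarrow>
      x \<in> V \<Longrightarrow> y \<in> V \<Longrightarrow> \<beta> (f x) (f y) = \<beta> x y"
    and \<beta>_nilpotent: "x \<in> V \<Longrightarrow> y \<in> V \<Longrightarrow>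
      (\<And>z. z \<in> V \<Longrightarrow> ((\<lambda>z. br x (br y z)) ^^ m) z \<in> lie_radical V br) \<Longrightarrow> \<beta> x y = 0"
    and \<beta>_nondegenerate: "x \<in> V \<Longrightarrow> (\<And>y. y \<in> V \<Longrightarrow> \<beta> x y = 0) \<Longrightarrow> x \<in> lie_radical V br"

theorem (in fd_lie_algebra) exists_radical_form: "\<exists>\<beta>. radical_form V br \<beta>"
proof -
  obtain d :: nat and b :: "nat \<Rightarrow> 'a" and c :: "nat \<Rightarrow> 'a \<Rightarrow> real"
    where bc: "\<And>i. i < d \<Longrightarrow> b i \<in> V" "\<And>i. linear (c i)" "\<And>i r. i < d \<Longrightarrow> r \<in> R \<Longrightarrow> c i r = 0"
    "\<And>i j. i < d \<Longrightarrow> j < d \<Longrightarrow> c i (b j) = (if i = j then 1 else 0)"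
    "\<And>x. x \<in> V \<Longrightarrow> x - (\<Sum>i<d. c i x *\<^sub>R b i) \<in> R"
    by (rule relative_basis[OF finite_dimensional subspace_radical radical_subset]) blast
  have "radical_form V br (killing d b c)"
    by unfold_locales
      (use killing_bilinear[OF bc] killing_sym[OF bc] killing_invariant[OF bc] killing_automorphism[OF bc]
        killing_zero_if_nilpotent[OF bc] killing_nondegenerate_mod_radical[OF bc] in \<open>blast+\<close>)
  then show ?thesis by blast
qed

section \<open>Representing functionals\<close>

text \<open>
  Induction on \<open>B\<close>: on the kernel of one more functional \<open>\<phi> b\<close> the remaining ones suffice, and a
  functional vanishing on that kernel is a multiple of \<open>\<phi> b\<close>.
\<close>
lemma functional_in_span_of_functionals:
  fixes S :: "'a::real_vector set"
  assumes "finite B" and "subspace S" "\<And>b. b \<in> B \<Longrightarrow> linear_on S (\<phi> b)" "linear_on S f"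
    and "\<And>s. s \<in> S \<Longrightarrow> (\<And>b. b \<in> B \<Longrightarrow> \<phi> b s = (0::real)) \<Longrightarrow> f s = 0"
  shows "\<exists>c. \<forall>s\<in>S. f s = (\<Sum>b\<in>B. c b * \<phi> b s)"
  using assms
proof (induction B arbitrary: S f rule: finite_induct)
  case empty
  then show ?case by simp
next
  case (insert b B)
  have \<phi>: "linear_on S (\<phi> x)" if "x \<in> insert b B" for x using insert.prems(2) that by blast
  have f: "linear_on S f" by fact
  have bl: "linear_on S (\<phi> b)" using \<phi> by blast
  define S' where "S' = {s \<in> S. \<phi> b s = 0}"
  have S': "subspace S'"
    unfolding real_vector.subspace_def S'_def
    using insert.prems(1) bl linear_on_0[OF bl insert.prems(1)]
    by (auto simp: linear_on_def subspace_0 subspace_add subspace_scale)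
  have S'S: "s \<in> S' \<Longrightarrow> s \<in> S" for s by (simp add: S'_def)
  have restr: "linear_on S g \<Longrightarrow> linear_on S' g" for g :: "'a \<Rightarrow> real"
    using S'S by (auto simp: linear_on_def)
  have "\<exists>c. \<forall>s\<in>S'. f s = (\<Sum>b\<in>B. c b * \<phi> b s)"
  proof (rule insert.IH[OF S'])
    show "linear_on S' (\<phi> x)" if "x \<in> B" for x using restr \<phi> that by blast
    show "linear_on S' f" using restr f by blast
    fix s assume "s \<in> S'" "\<And>b. b \<in> B \<Longrightarrow> \<phi> b s = 0"
    then show "f s = 0" using insert.prems(4)[of s] by (auto simp: S'_def)
  qed
  then obtain c where c: "\<And>s. s \<in> S' \<Longrightarrow> f s = (\<Sum>b\<in>B. c b * \<phi> b s)" by blast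
  define g where "g s = f s - (\<Sum>b\<in>B. c b * \<phi> b s)" for s
  have gl: "linear_on S g"
    using f \<phi> by (auto simp: g_def linear_on_def algebra_simps sum.distrib sum_distrib_left)
  have sum_upd: "(\<Sum>x\<in>insert b B. (c(b := k)) x * \<phi> x s) = k * \<phi> b s + (\<Sum>x\<in>B. c x * \<phi> x s)" for k s
  proof -
    have "(\<Sum>x\<in>B. (c(b := k)) x * \<phi> x s) = (\<Sum>x\<in>B. c x * \<phi> x s)"
      using insert.hyps(2) by (intro sum.cong) auto
    then show ?thesis using insert.hyps by simp
  qed
  show ?case
  proof (cases "\<exists>s\<in>S. \<phi> b s \<noteq> 0")
    case False
    then have "f s = (\<Sum>x\<in>insert b B. (c(b := 0)) x * \<phi> x s)" if "s \<in> S" for s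
      unfolding sum_upd using that c[of s] by (auto simp: S'_def)
    then show ?thesis by blast
  next
    case True
    then obtain s0 where s0: "s0 \<in> S" "\<phi> b s0 \<noteq> 0" by blast
    have "f s = (\<Sum>x\<in>insert b B. (c(b := g s0 / \<phi> b s0)) x * \<phi> x s)" if s: "s \<in> S" for s
    proof -
      define t where "t = - (\<phi> b s / \<phi> b s0)"
      have "\<phi> b (s + t *\<^sub>R s0) = \<phi> b s + t * \<phi> b s0"
        using s s0 insert.prems(1) bl by (simp add: linear_on_def subspace_scale)
      then have "\<phi> b (s + t *\<^sub>R s0) = 0" using s0 by (simp add: t_def)
      moreover have "s + t *\<^sub>R s0 \<in> S" using s s0 insert.prems(1) by (simp add: subspace_add subspace_scale)
      ultimately have "s + t *\<^sub>R s0 \<in> S'" by (simp add: S'_def)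
      then have "g (s + t *\<^sub>R s0) = 0" using c by (simp add: g_def)
      moreover have "g (s + t *\<^sub>R s0) = g s + t * g s0"
        using gl s s0 insert.prems(1) by (simp add: linear_on_def subspace_scale)
      ultimately have "g s = g s0 / \<phi> b s0 * \<phi> b s" by (simp add: t_def field_simps)
      then show ?thesis unfolding sum_upd by (simp add: g_def)
    qed
    then show ?thesis by blast
  qed
qed

text \<open>
  All orthogonality arguments below (double orthogonals, orthogonal decompositions, transfer between
  \<open>\<Omega>\<close> and \<open>\<beta>\<close>) are instances of this statement, which replaces dimension counts.
\<close>
lemma functional_represented_by_pairing:
  fixes P :: "'a::real_vector set" and S :: "'b::real_vector set" and \<gamma> :: "'a \<Rightarrow> 'b \<Rightarrow> real"
  assumes P: "\<exists>B. finite B \<and> span B = P" and S: "subspace S"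
    and l: "\<And>s. s \<in> S \<Longrightarrow> linear_on P (\<lambda>p. \<gamma> p s)" and r: "\<And>p. p \<in> P \<Longrightarrow> linear_on S (\<gamma> p)"
    and f: "linear_on S f" and ker: "\<And>s. s \<in> S \<Longrightarrow> (\<And>p. p \<in> P \<Longrightarrow> \<gamma> p s = 0) \<Longrightarrow> f s = 0"
  obtains p where "p \<in> P" "\<And>s. s \<in> S \<Longrightarrow> f s = \<gamma> p s"
proof -
  obtain B where B: "finite B" "span B = P" using P by blast
  have sP: "subspace P" using B(2) subspace_span by blast
  have BP: "b \<in> B \<Longrightarrow> b \<in> P" for b using B(2) span_base by blast
  have "\<exists>c. \<forall>s\<in>S. f s = (\<Sum>b\<in>B. c b * \<gamma> b s)"
  proof (rule functional_in_span_of_functionals[OF B(1) S _ f])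
    show "linear_on S (\<gamma> b)" if "b \<in> B" for b using r BP that by blast
    fix s assume s: "s \<in> S" and 0: "\<And>b. b \<in> B \<Longrightarrow> \<gamma> b s = 0"
    have "subspace {p \<in> P. \<gamma> p s = 0}"
      unfolding real_vector.subspace_def
      using l[OF s] linear_on_0[OF l[OF s] sP] sP
      by (auto simp: linear_on_def subspace_0 subspace_add subspace_scale)
    moreover have "B \<subseteq> {p \<in> P. \<gamma> p s = 0}" using 0 BP by blast
    ultimately have "span B \<subseteq> {p \<in> P. \<gamma> p s = 0}" by (rule span_minimal[rotated])
    then show "f s = 0" using ker[OF s] B(2) by blast
  qed
  then obtain c where c: "\<And>s. s \<in> S \<Longrightarrow> f s = (\<Sum>b\<in>B. c b * \<gamma> b s)" by blast
  have "\<gamma> (\<Sum>b\<in>B. c b *\<^sub>R b) s = (\<Sum>b\<in>B. c b * \<gamma> b s)" if s: "s \<in> S" for s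
  proof -
    have "\<gamma> (\<Sum>b\<in>B. c b *\<^sub>R b) s = (\<Sum>b\<in>B. \<gamma> (c b *\<^sub>R b) s)"
      using linear_on_sum[OF sP l[OF s] B(1), of "\<lambda>b. c b *\<^sub>R b"] BP subspace_scale[OF sP] by blast
    also have "\<dots> = (\<Sum>b\<in>B. c b * \<gamma> b s)"
      using l[OF s] BP by (intro sum.cong) (auto simp: linear_on_def)
    finally show ?thesis .
  qed
  moreover have "(\<Sum>b\<in>B. c b *\<^sub>R b) \<in> P" using BP by (intro subspace_sum[OF sP] subspace_scale[OF sP])
  ultimately show ?thesis using that c by metis
qed

lemma eq_neg_zero: "x = - x \<Longrightarrow> x = 0" for x :: "'a::real_vector"
proof -
  assume "x = - x"
  then have "x + x = 0" by (rule eq_neg_iff_add_eq_0[THEN iffD1])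
  then have "2 *\<^sub>R x = 0" by (simp only: scaleR_2)
  then show "x = 0" by simp
qed

section \<open>The canonical decomposition of a triple\<close>

context symplectic_symmetric_triple
begin

abbreviation "K \<equiv> fixed_part V \<sigma>"
abbreviation "P \<equiv> anti_part V \<sigma>"

lemma K_V: "k \<in> K \<Longrightarrow> k \<in> V" by (simp add: fixed_part_def)
lemma P_V: "p \<in> P \<Longrightarrow> p \<in> V" by (simp add: anti_part_def)

lemma \<sigma>_V[simp]: "x \<in> V \<Longrightarrow> \<sigma> x \<in> V"
  using automorphism by (auto simp: lie_automorphism_def bij_betw_def)
lemma \<sigma>_add: "x \<in> V \<Longrightarrow> y \<in> V \<Longrightarrow> \<sigma> (x + y) = \<sigma> x + \<sigma> y"
  using automorphism by (simp add: lie_automorphism_def linear_on_def)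
lemma \<sigma>_scale: "x \<in> V \<Longrightarrow> \<sigma> (c *\<^sub>R x) = c *\<^sub>R \<sigma> x"
  using automorphism by (simp add: lie_automorphism_def linear_on_def)
lemma \<sigma>_br: "x \<in> V \<Longrightarrow> y \<in> V \<Longrightarrow> \<sigma> (br x y) = br (\<sigma> x) (\<sigma> y)"
  using automorphism by (simp add: lie_automorphism_def)
lemma \<sigma>_diff: "x \<in> V \<Longrightarrow> y \<in> V \<Longrightarrow> \<sigma> (x - y) = \<sigma> x - \<sigma> y"
  using \<sigma>_add[of "x - y" y] by simp
lemma \<sigma>_0[simp]: "\<sigma> 0 = 0" using \<sigma>_scale[of 0 0] by simp

lemma subspace_K: "subspace K"
  by (auto simp: real_vector.subspace_def fixed_part_def \<sigma>_add \<sigma>_scale)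
lemma subspace_P: "subspace P"
  by (auto simp: real_vector.subspace_def anti_part_def \<sigma>_add \<sigma>_scale)

lemma canonical_decomposition:
  assumes "x \<in> V" obtains k p where "k \<in> K" "p \<in> P" "x = k + p"
proof -
  define h where "h = \<sigma> x"
  have h: "h \<in> V" "\<sigma> h = x" "\<sigma> x = h" using assms involutive by (simp_all add: h_def)
  have "\<sigma> ((1/2) *\<^sub>R (x + h)) = (1/2) *\<^sub>R (h + x)"
    using assms h by (simp only: \<sigma>_scale \<sigma>_add carrier_add)
  then have "(1/2) *\<^sub>R (x + h) \<in> K" using assms h by (simp add: fixed_part_def add.commute)
  moreover have "\<sigma> ((1/2) *\<^sub>R (x - h)) = (1/2) *\<^sub>R (h - x)"
    using assms h by (simp only: \<sigma>_scale \<sigma>_diff carrier_diff)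
  then have "(1/2) *\<^sub>R (x - h) \<in> P"
    using assms h by (simp add: anti_part_def scaleR_right_diff_distrib)
  moreover have "x = (1/2) *\<^sub>R (x + h) + (1/2) *\<^sub>R (x - h)"
    unfolding scaleR_right_distrib[symmetric] by (simp add: scaleR_2[symmetric])
  ultimately show ?thesis by (rule that)
qed

lemma K_P_zero:
  assumes "x \<in> K" "x \<in> P" shows "x = 0"
proof -
  have "x = - x" using assms unfolding fixed_part_def anti_part_def by auto
  then show ?thesis by (rule eq_neg_zero)
qed

lemma br_K_K[simp]: "x \<in> K \<Longrightarrow> y \<in> K \<Longrightarrow> br x y \<in> K" by (simp add: fixed_part_def \<sigma>_br)
lemma br_K_P[simp]: "x \<in> K \<Longrightarrow> y \<in> P \<Longrightarrow> br x y \<in> P" by (simp add: fixed_part_def anti_part_def \<sigma>_br br_minus_right)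
lemma br_P_K[simp]: "x \<in> P \<Longrightarrow> y \<in> K \<Longrightarrow> br x y \<in> P" by (simp add: fixed_part_def anti_part_def \<sigma>_br br_minus_left)
lemma br_P_P[simp]: "x \<in> P \<Longrightarrow> y \<in> P \<Longrightarrow> br x y \<in> K"
  by (simp add: fixed_part_def anti_part_def \<sigma>_br br_minus_left br_minus_right)

lemma \<sigma>_K: "k \<in> K \<Longrightarrow> \<sigma> k = k" by (simp add: fixed_part_def)
lemma \<sigma>_P: "p \<in> P \<Longrightarrow> \<sigma> p = - p" by (simp add: anti_part_def)

text \<open>
  These become simplification rules only here: together with the definitions of \<open>K\<close> and \<open>P\<close>, which are
  unfolded above, they would loop.
\<close>
lemmas [simp] = K_V P_V

lemma K_induct:
  assumes "k \<in> K" "subspace S" "\<And>x y. x \<in> P \<Longrightarrow> y \<in> P \<Longrightarrow> br x y \<in> S"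
  shows "k \<in> S"
  using lie_bracket_span_subset[OF assms(2), of P P] assms(1,3) bracket_anti_part by blast

lemma \<sigma>_radical: "r \<in> R \<Longrightarrow> \<sigma> r \<in> R"
  by (rule involutive_automorphism_radical[OF automorphism involutive])

lemma radical_components:
  assumes "k \<in> K" "p \<in> P" "k + p \<in> R" shows "k \<in> R" "p \<in> R"
proof -
  have s: "\<sigma> (k + p) = k - p" using assms by (simp add: \<sigma>_add \<sigma>_K \<sigma>_P)
  have "(k + p) + (k - p) \<in> R" "(k + p) - (k - p) \<in> R"
    using \<sigma>_radical[OF assms(3)] s assms(3) subspace_add[OF subspace_radical] subspace_diff[OF subspace_radical] by metis+
  then have "2 *\<^sub>R k \<in> R" "2 *\<^sub>R p \<in> R" by (simp_all add: scaleR_2)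
  moreover have "x \<in> R" if "2 *\<^sub>R x \<in> R" for x
    using subspace_scale[OF subspace_radical that, of "1/2"] by simp
  ultimately show "k \<in> R" "p \<in> R" by blast+
qed

lemma \<Omega>_add_left: "x \<in> P \<Longrightarrow> y \<in> P \<Longrightarrow> z \<in> P \<Longrightarrow> \<Omega> (x + y) z = \<Omega> x z + \<Omega> y z"
  using symplectic by (simp add: symplectic_form_on_def bilinear_on_def linear_on_def)
lemma \<Omega>_add_right: "x \<in> P \<Longrightarrow> y \<in> P \<Longrightarrow> z \<in> P \<Longrightarrow> \<Omega> x (y + z) = \<Omega> x y + \<Omega> x z"
  using symplectic by (simp add: symplectic_form_on_def bilinear_on_def linear_on_def)
lemma \<Omega>_scale_left: "x \<in> P \<Longrightarrow> y \<in> P \<Longrightarrow> \<Omega> (c *\<^sub>R x) y = c * \<Omega> x y"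
  using symplectic by (simp add: symplectic_form_on_def bilinear_on_def linear_on_def)
lemma \<Omega>_scale_right: "x \<in> P \<Longrightarrow> y \<in> P \<Longrightarrow> \<Omega> x (c *\<^sub>R y) = c * \<Omega> x y"
  using symplectic by (simp add: symplectic_form_on_def bilinear_on_def linear_on_def)
lemma \<Omega>_self: "x \<in> P \<Longrightarrow> \<Omega> x x = 0"
  using symplectic by (simp add: symplectic_form_on_def)
lemma P_0[simp]: "0 \<in> P" by (rule subspace_0[OF subspace_P])
lemma K_0[simp]: "0 \<in> K" by (rule subspace_0[OF subspace_K])
lemma P_add[simp]: "x \<in> P \<Longrightarrow> y \<in> P \<Longrightarrow> x + y \<in> P" by (rule subspace_add[OF subspace_P])
lemma P_diff[simp]: "x \<in> P \<Longrightarrow> y \<in> P \<Longrightarrow> x - y \<in> P" by (rule subspace_diff[OF subspace_P])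
lemma P_scale[simp]: "x \<in> P \<Longrightarrow> c *\<^sub>R x \<in> P" by (rule subspace_scale[OF subspace_P])
lemma \<Omega>_0_left[simp]: "x \<in> P \<Longrightarrow> \<Omega> 0 x = 0" using \<Omega>_scale_left[of 0 x 0] by simp
lemma \<Omega>_0_right[simp]: "x \<in> P \<Longrightarrow> \<Omega> x 0 = 0" using \<Omega>_scale_right[of x 0 0] by simp
lemma \<Omega>_diff_left: "x \<in> P \<Longrightarrow> y \<in> P \<Longrightarrow> z \<in> P \<Longrightarrow> \<Omega> (x - y) z = \<Omega> x z - \<Omega> y z"
  using \<Omega>_add_left[of "x - y" y z] by simp
lemma \<Omega>_skew: assumes "x \<in> P" "y \<in> P" shows "\<Omega> x y = - \<Omega> y x"
proof -
  have "\<Omega> (x + y) (x + y) = (\<Omega> x x + \<Omega> y x) + (\<Omega> x y + \<Omega> y y)"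
    using assms by (simp only: \<Omega>_add_left \<Omega>_add_right P_add)
  then show ?thesis using \<Omega>_self[of "x + y"] \<Omega>_self[of x] \<Omega>_self[of y] assms by simp
qed
lemma \<Omega>_nondegenerate: "x \<in> P \<Longrightarrow> (\<And>y. y \<in> P \<Longrightarrow> \<Omega> x y = 0) \<Longrightarrow> x = 0"
  using symplectic by (auto simp: symplectic_form_on_def)
lemma \<Omega>_invariant: "k \<in> K \<Longrightarrow> x \<in> P \<Longrightarrow> y \<in> P \<Longrightarrow> \<Omega> (br k x) y = - \<Omega> x (br k y)"
  using invariant[of k x y] by simp
lemma linear_\<Omega>_left: "S \<subseteq> P \<Longrightarrow> y \<in> P \<Longrightarrow> linear_on S (\<lambda>x. \<Omega> x y)"
  by (auto simp: linear_on_def subset_iff \<Omega>_add_left \<Omega>_scale_left)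
lemma linear_\<Omega>_right: "S \<subseteq> P \<Longrightarrow> y \<in> P \<Longrightarrow> linear_on S (\<Omega> y)"
  by (auto simp: linear_on_def subset_iff \<Omega>_add_right \<Omega>_scale_right)

lemma fd_subspace_P: "subspace S \<Longrightarrow> S \<subseteq> P \<Longrightarrow> \<exists>B. finite B \<and> span B = S"
  by (rule fd_subspace_spanned[OF finite_dimensional]) auto

lemma \<Omega>_bilinear: "bilinear_on P \<Omega>"
  using symplectic by (simp add: symplectic_form_on_def)

lemma represent_functional:
  assumes \<gamma>: "bilinear_on P \<gamma>" and A: "subspace A" "A \<subseteq> P" and S: "subspace S" "S \<subseteq> P" and f: "linear_on S f"
    and ker: "\<And>s. s \<in> S \<Longrightarrow> (\<And>a. a \<in> A \<Longrightarrow> \<gamma> a s = 0) \<Longrightarrow> f s = (0::real)"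
  obtains a where "a \<in> A" "\<And>s. s \<in> S \<Longrightarrow> f s = \<gamma> a s"
proof (rule functional_represented_by_pairing[of A S \<gamma> f])
  show "\<exists>B. finite B \<and> span B = A" by (rule fd_subspace_P[OF A])
  show "linear_on A (\<lambda>p. \<gamma> p s)" if "s \<in> S" for s
    using \<gamma> A(2) S(2) that by (auto simp: bilinear_on_def linear_on_def subset_iff)
  show "linear_on S (\<gamma> p)" if "p \<in> A" for p
    using \<gamma> A(2) S(2) that by (auto simp: bilinear_on_def linear_on_def subset_iff)
qed (use S(1) f ker that in blast)+

section \<open>Splitting off a factor\<close>

text \<open>
  An \<open>\<Omega>\<close>-orthogonal decomposition of \<open>P\<close> into commuting subspaces already decomposes the triple.  The
  setting is symmetric in \<open>P1\<close> and \<open>P2\<close>; only the summand generated by \<open>P1\<close> is treated, and both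
  instances are combined in \<open>semisimple_factor_if_split\<close>.
\<close>

context
  fixes P1 P2
  assumes sub: "subspace P1" "subspace P2" "P1 \<subseteq> P" "P2 \<subseteq> P"
    and sum: "\<And>x. x \<in> P \<Longrightarrow> \<exists>a\<in>P1. \<exists>b\<in>P2. x = a + b"
    and orth: "\<And>x y. x \<in> P1 \<Longrightarrow> y \<in> P2 \<Longrightarrow> \<Omega> x y = 0"
    and comm: "\<And>x y. x \<in> P1 \<Longrightarrow> y \<in> P2 \<Longrightarrow> br x y = 0"
begin

lemma in_P: "x \<in> P1 \<Longrightarrow> x \<in> P" "x \<in> P2 \<Longrightarrow> x \<in> P" using sub by auto
lemma in_V: "x \<in> P1 \<Longrightarrow> x \<in> V" "x \<in> P2 \<Longrightarrow> x \<in> V" using in_P by auto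

definition "summand_K = lie_bracket_span br P1 P1"
definition "summand = {k + p |k p. k \<in> summand_K \<and> p \<in> P1}"

lemma subspace_summand_K: "subspace summand_K" by (simp add: summand_K_def subspace_lie_bracket_span)
lemma summand_K_K: "k \<in> summand_K \<Longrightarrow> k \<in> K"
  using lie_bracket_span_subset[OF subspace_K, of P1 P1] in_P by (auto simp: summand_K_def)
lemma subspace_summand: "subspace summand" unfolding summand_def by (rule subspace_sums[OF subspace_summand_K sub(1)])
lemma summand_V: "x \<in> summand \<Longrightarrow> x \<in> V" using summand_K_K in_V by (auto simp: summand_def)

lemma summand_K_P2: assumes "k \<in> summand_K" "y \<in> P2" shows "br k y = 0"
proof -
  let ?S = "{k \<in> V. \<forall>y\<in>P2. br k y = 0}"
  have "subspace ?S" using in_V by (auto simp: real_vector.subspace_def br_add_left br_scale_left)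
  moreover have "br a b \<in> ?S" if "a \<in> P1" "b \<in> P1" for a b
    using that in_V comm by (simp add: br_bracket_left)
  ultimately have "summand_K \<subseteq> ?S" unfolding summand_K_def by (rule lie_bracket_span_subset)
  then show ?thesis using assms by blast
qed

text \<open>
  For \<open>k \<in> [P1,P1]\<close> the vector \<open>[k,x]\<close> is orthogonal to \<open>P2\<close>, by invariance and since \<open>k\<close> kills \<open>P2\<close>.
\<close>
lemma summand_K_P1: assumes k: "k \<in> summand_K" and x: "x \<in> P1" shows "br k x \<in> P1"
proof -
  have kx: "br k x \<in> P" using summand_K_K[OF k] in_P(1)[OF x] by simp
  obtain a b where ab: "a \<in> P1" "b \<in> P2" "br k x = a + b" using sum[OF kx] by blast
  have "\<Omega> b y = 0" if yP: "y \<in> P" for y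
  proof -
    obtain c e where ce: "c \<in> P1" "e \<in> P2" "y = c + e" using sum[OF yP] by blast
    have "\<Omega> (br k x) e = 0" using \<Omega>_invariant[of k x e] summand_K_K[OF k] in_P x ce summand_K_P2[OF k ce(2)] by simp
    then have "\<Omega> b e = 0" using ab ce in_P orth by (simp add: \<Omega>_add_left)
    moreover have "\<Omega> b c = 0" using orth[OF ce(1) ab(2)] \<Omega>_skew[of b c] in_P ab ce by simp
    ultimately show ?thesis using ce ab in_P by (simp add: \<Omega>_add_right)
  qed
  then have "b = 0" using \<Omega>_nondegenerate in_P ab by blast
  then show ?thesis using ab by simp
qed

lemma summand_K_summand_K: assumes k: "k \<in> summand_K" and l: "l \<in> summand_K" shows "br k l \<in> summand_K"
proof -
  let ?S = "{l \<in> V. br k l \<in> summand_K}"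
  have kV: "k \<in> V" using summand_K_K[OF k] by simp
  have "subspace ?S"
    unfolding real_vector.subspace_def
    using kV subspace_0[OF subspace_summand_K] subspace_add[OF subspace_summand_K] subspace_scale[OF subspace_summand_K]
    by (auto simp: br_add_right br_scale_right)
  moreover have "br a b \<in> ?S" if ab: "a \<in> P1" "b \<in> P1" for a b
  proof -
    have "br k (br a b) = br (br k a) b + br a (br k b)" using ab kV in_V by (intro br_derivation) auto
    moreover have "br (br k a) b \<in> summand_K" "br a (br k b) \<in> summand_K"
      unfolding summand_K_def using ab summand_K_P1[OF k] by (auto intro!: lie_bracket_span_memI)
    ultimately show ?thesis using ab in_V subspace_add[OF subspace_summand_K] by simp
  qed
  ultimately have "summand_K \<subseteq> ?S" unfolding summand_K_def by (rule lie_bracket_span_subset)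
  then show ?thesis using l by blast
qed

lemma summand_K_summand: "k \<in> summand_K \<Longrightarrow> k \<in> summand"
proof -
  assume "k \<in> summand_K"
  then have "k = k + 0 \<and> k \<in> summand_K \<and> 0 \<in> P1" using subspace_0[OF sub(1)] by simp
  then show ?thesis unfolding summand_def by blast
qed

lemma P1_summand: "p \<in> P1 \<Longrightarrow> p \<in> summand"
proof -
  assume "p \<in> P1"
  then have "p = 0 + p \<and> 0 \<in> summand_K \<and> p \<in> P1" using subspace_0[OF subspace_summand_K] by simp
  then show ?thesis unfolding summand_def by blast
qed

lemma \<sigma>_summand: "k \<in> summand_K \<Longrightarrow> p \<in> P1 \<Longrightarrow> \<sigma> (k + p) = k - p"
  using summand_K_K[of k] in_P(1)[of p] by (simp add: \<sigma>_add \<sigma>_K \<sigma>_P)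

lemma fixed_part_summand: "fixed_part summand \<sigma> = summand_K"
proof
  show "summand_K \<subseteq> fixed_part summand \<sigma>" using summand_K_summand summand_K_K \<sigma>_K by (auto simp: fixed_part_def[of summand])
  show "fixed_part summand \<sigma> \<subseteq> summand_K"
  proof
    fix x assume x: "x \<in> fixed_part summand \<sigma>"
    then have "x \<in> summand" by (simp add: fixed_part_def[of summand])
    then obtain k p where kp: "x = k + p" "k \<in> summand_K" "p \<in> P1" unfolding summand_def by blast
    have "k - p = k + p" using x kp \<sigma>_summand[OF kp(2,3)] by (simp add: fixed_part_def[of summand])
    then have "p = - p" by simp
    then have "p = 0" by (rule eq_neg_zero)
    then show "x \<in> summand_K" using kp by simp
  qed
qed

lemma anti_part_summand: "anti_part summand \<sigma> = P1"
proof
  show "P1 \<subseteq> anti_part summand \<sigma>" using P1_summand in_P \<sigma>_P by (auto simp: anti_part_def[of summand])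
  show "anti_part summand \<sigma> \<subseteq> P1"
  proof
    fix x assume x: "x \<in> anti_part summand \<sigma>"
    then have "x \<in> summand" by (simp add: anti_part_def[of summand])
    then obtain k p where kp: "x = k + p" "k \<in> summand_K" "p \<in> P1" unfolding summand_def by blast
    have "k - p = - (k + p)" using x kp \<sigma>_summand[OF kp(2,3)] by (simp add: anti_part_def[of summand])
    then have "k = - k" by simp
    then have "k = 0" by (rule eq_neg_zero)
    then show "x \<in> P1" using kp by simp
  qed
qed

lemma summand_triple: "symplectic_symmetric_triple summand br \<sigma> \<Omega>"
proof
  show "subspace summand" by (rule subspace_summand)
  show "\<exists>B. finite B \<and> span B = summand"
    by (rule fd_subspace_spanned[OF finite_dimensional subspace_summand]) (use summand_V in auto)
  fix x y assume "x \<in> summand" "y \<in> summand"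
  then obtain k p l q where e: "x = k + p" "y = l + q" "k \<in> summand_K" "p \<in> P1" "l \<in> summand_K" "q \<in> P1"
    by (auto simp: summand_def)
  have inV: "k \<in> V" "p \<in> V" "l \<in> V" "q \<in> V" using e summand_K_K in_V by auto
  have "br x y = (br k l + br p q) + (br k q - br l p)"
    using inV e br_skew[of p l] by (simp add: br_add_left br_add_right)
  moreover have "br p q \<in> summand_K" unfolding summand_K_def using e by (intro lie_bracket_span_memI)
  then have "br k l + br p q \<in> summand_K" using e summand_K_summand_K by (intro subspace_add[OF subspace_summand_K])
  moreover have "br k q - br l p \<in> P1" using e summand_K_P1 by (auto intro!: subspace_diff[OF sub(1)])
  ultimately show "br x y \<in> summand" unfolding summand_def by blast
next
  show "bilinear_on summand br" using bracket_bilinear summand_V by (auto simp: bilinear_on_def linear_on_def)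
next
  fix x assume "x \<in> summand" then show "br x x = 0" using bracket_alternating summand_V by blast
next
  fix x y z assume "x \<in> summand" "y \<in> summand" "z \<in> summand"
  then show "br x (br y z) + br y (br z x) + br z (br x y) = 0" using jacobi summand_V by blast
next
  have s: "\<sigma> x \<in> summand" if xV1: "x \<in> summand" for x
  proof -
    obtain k p where e: "x = k + p" "k \<in> summand_K" "p \<in> P1" using xV1 by (auto simp: summand_def)
    then have "\<sigma> x = k + - p \<and> k \<in> summand_K \<and> - p \<in> P1" using \<sigma>_summand subspace_neg[OF sub(1)] by simp
    then show ?thesis unfolding summand_def by blast
  qed
  have "bij_betw \<sigma> summand summand"
    by (rule bij_betw_byWitness[of _ \<sigma>]) (use s involutive summand_V in auto)
  then show "lie_automorphism summand br \<sigma>"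
    using automorphism summand_V by (auto simp: lie_automorphism_def linear_on_def)
next
  fix x assume "x \<in> summand" then show "\<sigma> (\<sigma> x) = x" using involutive summand_V by blast
next
  show "lie_bracket_span br (anti_part summand \<sigma>) (anti_part summand \<sigma>) = fixed_part summand \<sigma>"
    unfolding anti_part_summand fixed_part_summand by (simp add: summand_K_def)
next
  fix k assume "k \<in> fixed_part summand \<sigma>" and kill: "\<And>p. p \<in> anti_part summand \<sigma> \<Longrightarrow> br k p = 0"
  then have k: "k \<in> summand_K" by (simp add: fixed_part_summand)
  have "br k x = 0" if "x \<in> P" for x
  proof -
    obtain a b where ab: "a \<in> P1" "b \<in> P2" "x = a + b" using sum[OF \<open>x \<in> P\<close>] by blast
    then show ?thesis using kill summand_K_P2[OF k] summand_K_K[OF k] in_V by (simp add: anti_part_summand br_add_right)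
  qed
  then show "k = 0" using faithful summand_K_K[OF k] by blast
next
  have "x = 0" if x: "x \<in> P1" and 0: "\<forall>y\<in>P1. \<Omega> x y = 0" for x
  proof (rule \<Omega>_nondegenerate[OF in_P(1)[OF x]])
    fix y assume "y \<in> P"
    then obtain a b where ab: "a \<in> P1" "b \<in> P2" "y = a + b" using sum by blast
    then show "\<Omega> x y = 0" using 0 orth x in_P by (simp add: \<Omega>_add_right)
  qed
  then show "symplectic_form_on (anti_part summand \<sigma>) \<Omega>"
    unfolding anti_part_summand symplectic_form_on_def bilinear_on_def
    using in_P \<Omega>_self linear_\<Omega>_left[OF sub(3)] linear_\<Omega>_right[OF sub(3)] by blast
next
  fix k x y assume "k \<in> fixed_part summand \<sigma>" "x \<in> anti_part summand \<sigma>" "y \<in> anti_part summand \<sigma>"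
  then show "\<Omega> (br k x) y + \<Omega> x (br k y) = 0"
    unfolding anti_part_summand fixed_part_summand using invariant summand_K_K in_P by blast
qed

end

text \<open>
  The summand generated by \<open>P1\<close> is semisimple: its solvable ideals are ideals of the whole algebra, hence
  contained in \<open>R\<close>, whose \<open>P\<close>-part meets \<open>P1\<close> trivially.
\<close>
lemma semisimple_factor_if_split:
  assumes sub: "subspace P1" "subspace P2" "P1 \<subseteq> P" "P2 \<subseteq> P"
    and sum: "\<And>x. x \<in> P \<Longrightarrow> \<exists>a\<in>P1. \<exists>b\<in>P2. x = a + b"
    and orth: "\<And>x y. x \<in> P1 \<Longrightarrow> y \<in> P2 \<Longrightarrow> \<Omega> x y = 0"
    and comm: "\<And>x y. x \<in> P1 \<Longrightarrow> y \<in> P2 \<Longrightarrow> br x y = 0"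
    and disj: "P1 \<inter> P2 \<subseteq> {0}" and rad: "P1 \<inter> R \<subseteq> {0}" and ne: "P1 \<noteq> {0}"
  shows "\<exists>L. semisimple_factor V br \<sigma> \<Omega> L"
proof -
  have in_P: "x \<in> P1 \<Longrightarrow> x \<in> P" "x \<in> P2 \<Longrightarrow> x \<in> P" for x using sub by auto
  have sum': "\<exists>a\<in>P2. \<exists>b\<in>P1. x = a + b" if "x \<in> P" for x using sum[OF that] by (metis add.commute)
  have orth': "\<Omega> x y = 0" if "x \<in> P2" "y \<in> P1" for x y using orth[OF that(2,1)] \<Omega>_skew[of x y] in_P that by simp
  have comm': "br x y = 0" if "x \<in> P2" "y \<in> P1" for x y using comm[OF that(2,1)] br_skew[of x y] in_P that by simp
  note c1 = sub sum orth comm and c2 = sub(2,1,4,3) sum' orth' comm'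
  define A1 where "A1 = summand_K P1"
  define A2 where "A2 = summand_K P2"
  have S1: "summand P1 = {k + p |k p. k \<in> A1 \<and> p \<in> P1}" and S2: "summand P2 = {k + p |k p. k \<in> A2 \<and> p \<in> P2}"
    by (simp_all add: summand_def[OF c1] summand_def[OF c2] A1_def A2_def)
  have A1: "A1 = lie_bracket_span br P1 P1" unfolding A1_def by (rule summand_K_def[OF c1])
  have A2: "A2 = lie_bracket_span br P2 P2" unfolding A2_def by (rule summand_K_def[OF c2])
  have A1K: "k \<in> A1 \<Longrightarrow> k \<in> K" and A2K: "k \<in> A2 \<Longrightarrow> k \<in> K" for k
    using summand_K_K[OF c1] summand_K_K[OF c2] by (auto simp: A1_def A2_def)
  have A1P2: "k \<in> A1 \<Longrightarrow> y \<in> P2 \<Longrightarrow> br k y = 0" and A2P1: "k \<in> A2 \<Longrightarrow> y \<in> P1 \<Longrightarrow> br k y = 0" for k y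
    using summand_K_P2[OF c1] summand_K_P2[OF c2] by (auto simp: A1_def A2_def)
  have inV: "x \<in> P1 \<Longrightarrow> x \<in> V" "x \<in> P2 \<Longrightarrow> x \<in> V" "x \<in> A1 \<Longrightarrow> x \<in> V" "x \<in> A2 \<Longrightarrow> x \<in> V" for x
    using in_P A1K A2K by auto
  have kill: "k = 0" if "k \<in> K" "\<And>x. x \<in> P1 \<Longrightarrow> br k x = 0" "\<And>x. x \<in> P2 \<Longrightarrow> br k x = 0" for k
  proof (rule faithful[OF that(1)])
    fix x assume "x \<in> P"
    then obtain a b where "a \<in> P1" "b \<in> P2" "x = a + b" using sum by blast
    then show "br k x = 0" using that inV by (simp add: br_add_right)
  qed
  have A12: "br k l = 0" if k: "k \<in> A1" and l: "l \<in> A2" for k l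
  proof -
    let ?S = "{l \<in> V. br k l = 0}"
    have kV: "k \<in> V" using inV k by blast
    have "subspace ?S" using kV by (auto simp: real_vector.subspace_def br_add_right br_scale_right)
    moreover have "br a b \<in> ?S" if ab: "a \<in> P2" "b \<in> P2" for a b
      using br_derivation[OF kV inV(2)[OF ab(1)] inV(2)[OF ab(2)]] A1P2[OF k] ab inV by simp
    ultimately have "A2 \<subseteq> ?S" unfolding A2 by (rule lie_bracket_span_subset)
    then show ?thesis using l by blast
  qed
  have s1: "subspace A1" "subspace A2" using subspace_summand_K[OF c1] subspace_summand_K[OF c2] by (simp_all add: A1_def A2_def)
  have comm12: "br x y = 0" if "x \<in> summand P1" "y \<in> summand P2" for x y
  proof -
    obtain k p where x: "x = k + p" "k \<in> A1" "p \<in> P1" using \<open>x \<in> summand P1\<close> unfolding S1 by blast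
    obtain l q where y: "y = l + q" "l \<in> A2" "q \<in> P2" using \<open>y \<in> summand P2\<close> unfolding S2 by blast
    have "br p l = 0" using br_skew[of p l] A2P1[OF y(2) x(3)] inV x y by simp
    then show ?thesis using x y inV A12 A1P2 comm by (simp add: br_add_left br_add_right)
  qed
  have V12: "V = {x + y |x y. x \<in> summand P1 \<and> y \<in> summand P2}"
  proof
    show "{x + y |x y. x \<in> summand P1 \<and> y \<in> summand P2} \<subseteq> V"
      using summand_V[OF c1] summand_V[OF c2] by auto
    show "V \<subseteq> {x + y |x y. x \<in> summand P1 \<and> y \<in> summand P2}"
    proof
      fix x assume "x \<in> V"
      then obtain k p where kp: "k \<in> K" "p \<in> P" "x = k + p" by (rule canonical_decomposition)
      have "k \<in> {x + y |x y. x \<in> A1 \<and> y \<in> A2}"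
      proof (rule K_induct[OF kp(1) subspace_sums[OF s1]])
        fix x y assume xy: "x \<in> P" "y \<in> P"
        obtain a b where ab: "a \<in> P1" "b \<in> P2" "x = a + b" using sum xy by blast
        obtain e f where ef: "e \<in> P1" "f \<in> P2" "y = e + f" using sum xy by blast
        have "br x y = br a e + br b f"
          using ab ef inV comm comm' by (simp add: br_add_left br_add_right)
        moreover have "br a e \<in> A1" "br b f \<in> A2"
          unfolding A1 A2 using ab ef by (auto intro!: lie_bracket_span_memI)
        ultimately show "br x y \<in> {x + y |x y. x \<in> A1 \<and> y \<in> A2}" by blast
      qed
      then obtain k1 k2 where k: "k = k1 + k2" "k1 \<in> A1" "k2 \<in> A2" by blast
      obtain a b where ab: "a \<in> P1" "b \<in> P2" "p = a + b" using sum kp by blast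
      have "x = (k1 + a) + (k2 + b)" using kp k ab by simp
      moreover have "k1 + a \<in> summand P1" "k2 + b \<in> summand P2" unfolding S1 S2 using k ab by blast+
      ultimately show "x \<in> {x + y |x y. x \<in> summand P1 \<and> y \<in> summand P2}" by blast
    qed
  qed
  have int: "summand P1 \<inter> summand P2 = {0}"
  proof -
    have "x = 0" if x1: "x \<in> summand P1" and x2: "x \<in> summand P2" for x
    proof -
      obtain k p where x: "x = k + p" "k \<in> A1" "p \<in> P1" using x1 unfolding S1 by blast
      obtain l q where y: "x = l + q" "l \<in> A2" "q \<in> P2" using x2 unfolding S2 by blast
      have "k - l = q - p" using x y by (simp add: algebra_simps)
      moreover have "k - l \<in> K" using x y A1K A2K subspace_diff[OF subspace_K] by simp
      moreover have "q - p \<in> P" using x y in_P by simp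
      ultimately have "k - l = 0" "q - p = 0" using K_P_zero by metis+
      then have kl: "k = l" "p = q" by simp_all
      then have "p = 0" using x y disj by blast
      moreover have "k = 0" by (rule kill) (use x y kl A1K A1P2 A2P1 in auto)
      ultimately show ?thesis using x by simp
    qed
    moreover have "0 \<in> summand P1" "0 \<in> summand P2"
      using subspace_0[OF subspace_summand[OF c1]] subspace_0[OF subspace_summand[OF c2]] by blast+
    ultimately show ?thesis by blast
  qed
  have t1: "symplectic_symmetric_triple (summand P1) br \<sigma> \<Omega>" by (rule summand_triple[OF c1])
  have t2: "symplectic_symmetric_triple (summand P2) br \<sigma> \<Omega>" by (rule summand_triple[OF c2])
  have a1: "anti_part (summand P1) \<sigma> = P1" by (rule anti_part_summand[OF c1])
  have a2: "anti_part (summand P2) \<sigma> = P2" by (rule anti_part_summand[OF c2])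
  have V1V: "x \<in> V" if "x \<in> summand P1" for x by (rule summand_V[OF c1 that])
  have V2V: "x \<in> V" if "x \<in> summand P2" for x by (rule summand_V[OF c2 that])
  have ds: "triple_direct_sum V br \<sigma> \<Omega> (summand P1) (summand P2)"
    unfolding triple_direct_sum_def a1 a2 by (intro conjI t1 t2 V12 int ballI comm12 orth)
  have "I \<subseteq> {0}" if I: "lie_ideal (summand P1) br I" "lie_solvable I br" for I
  proof -
    have sI: "subspace I" "I \<subseteq> summand P1" and cl: "\<And>x y. x \<in> summand P1 \<Longrightarrow> y \<in> I \<Longrightarrow> br x y \<in> I"
      using I(1) by (simp_all add: lie_ideal_def)
    have IV: "i \<in> I \<Longrightarrow> i \<in> V" for i using sI(2) V1V by blast
    have "lie_ideal V br I" unfolding lie_ideal_def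
    proof (intro conjI ballI sI(1))
      show "I \<subseteq> V" using IV by blast
      fix x i assume x: "x \<in> V" and i: "i \<in> I"
      obtain v w where vw: "x = v + w" "v \<in> summand P1" "w \<in> summand P2" using x V12 by blast
      have wV: "v \<in> V" "w \<in> V" using vw(2,3) by (auto intro: V1V V2V)
      have "br i w = 0" using comm12[OF subsetD[OF sI(2) i] vw(3)] .
      then have "br w i = 0" using br_skew[of w i] IV[OF i] wV by simp
      then have "br x i = br v i" using vw wV IV[OF i] by (simp add: br_add_left)
      then show "br x i \<in> I" using cl vw i by simp
    qed
    then have IR: "I \<subseteq> R" using radical_greatest(3) I(2) by blast
    show ?thesis
    proof
      fix i assume i: "i \<in> I"
      then obtain k p where kp: "i = k + p" "k \<in> A1" "p \<in> P1" using sI(2) unfolding S1 by blast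
      have "k \<in> R" "p \<in> R"
        using radical_components[of k p] kp A1K in_P IR i by auto
      then have p: "p = 0" using rad kp by blast
      have "br k x = 0" if "x \<in> P1" for x
      proof -
        have "br k x \<in> P1" using summand_K_P1[OF c1] kp(2) that by (simp add: A1_def)
        moreover have "br k x \<in> R" using br_radical_left[OF \<open>k \<in> R\<close>] inV that by blast
        ultimately show ?thesis using rad by blast
      qed
      then have "k = 0" using kill[of k] A1K A1P2 kp by blast
      then show "i \<in> {0}" using p kp by simp
    qed
  qed
  then have "\<Union>{I. lie_ideal (summand P1) br I \<and> lie_solvable I br} \<subseteq> {0}" by blast
  then have "lie_radical (summand P1) br \<subseteq> {0}"
    unfolding lie_radical_def by (rule span_minimal) (rule real_vector.subspace_single_0)
  moreover have "0 \<in> lie_radical (summand P1) br" unfolding lie_radical_def by (rule span_zero)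
  ultimately have "lie_semisimple (summand P1) br" unfolding lie_semisimple_def by (intro subset_antisym) simp_all
  moreover have "summand P1 \<noteq> {0}"
  proof -
    obtain p where p: "p \<in> P1" "p \<noteq> 0" using ne subspace_0[OF sub(1)] by blast
    have "p \<in> summand P1" by (rule P1_summand[OF c1 p(1)])
    then show ?thesis using p(2) by blast
  qed
  ultimately show ?thesis unfolding semisimple_factor_def using ds by blast
qed

end

section \<open>The radical part and its orthogonal\<close>

locale triple_with_form = symplectic_symmetric_triple V br \<sigma> \<Omega> + radical_form V br \<beta>
  for V :: "'a::real_vector set" and br \<sigma> \<Omega> \<beta>
begin

lemma \<beta>_\<sigma>: "x \<in> V \<Longrightarrow> y \<in> V \<Longrightarrow> \<beta> (\<sigma> x) (\<sigma> y) = \<beta> x y"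
  by (rule \<beta>_automorphism[OF automorphism involutive])

lemma \<beta>_bilinear_P: "bilinear_on P \<beta>"
  using \<beta>_bilinear by (auto simp: bilinear_on_def linear_on_def)

lemma \<beta>_add_left: "x \<in> V \<Longrightarrow> y \<in> V \<Longrightarrow> z \<in> V \<Longrightarrow> \<beta> (x + y) z = \<beta> x z + \<beta> y z"
  using \<beta>_bilinear by (simp add: bilinear_on_def linear_on_def)
lemma \<beta>_add_right: "x \<in> V \<Longrightarrow> y \<in> V \<Longrightarrow> z \<in> V \<Longrightarrow> \<beta> x (y + z) = \<beta> x y + \<beta> x z"
  using \<beta>_bilinear by (simp add: bilinear_on_def linear_on_def)
lemma \<beta>_scale_left: "x \<in> V \<Longrightarrow> y \<in> V \<Longrightarrow> \<beta> (c *\<^sub>R x) y = c * \<beta> x y"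
  using \<beta>_bilinear by (simp add: bilinear_on_def linear_on_def)
lemma \<beta>_scale_right: "x \<in> V \<Longrightarrow> y \<in> V \<Longrightarrow> \<beta> x (c *\<^sub>R y) = c * \<beta> x y"
  using \<beta>_bilinear by (simp add: bilinear_on_def linear_on_def)
lemma \<beta>_diff_left: "x \<in> V \<Longrightarrow> y \<in> V \<Longrightarrow> z \<in> V \<Longrightarrow> \<beta> (x - y) z = \<beta> x z - \<beta> y z"
  using \<beta>_add_left[of "x - y" y z] by simp
lemma linear_\<beta>_right: "S \<subseteq> V \<Longrightarrow> y \<in> V \<Longrightarrow> linear_on S (\<beta> y)"
  by (auto simp: linear_on_def subset_iff \<beta>_add_right \<beta>_scale_right)

lemma \<beta>_radical_left: "r \<in> R \<Longrightarrow> y \<in> V \<Longrightarrow> \<beta> r y = 0"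
  by (rule \<beta>_nilpotent[of _ _ 1]) (simp_all add: br_radical_left)

lemma \<beta>_radical_right: "r \<in> R \<Longrightarrow> y \<in> V \<Longrightarrow> \<beta> y r = 0"
  using \<beta>_radical_left \<beta>_sym by simp

lemma \<beta>_K_P: assumes "k \<in> K" "p \<in> P" shows "\<beta> k p = 0"
proof -
  have "\<beta> (\<sigma> k) (\<sigma> p) = \<beta> k p" using assms by (intro \<beta>_\<sigma>) auto
  moreover have "\<beta> (\<sigma> k) (\<sigma> p) = - \<beta> k p"
    using assms \<beta>_scale_right[of k p "-1"] by (simp add: \<sigma>_K \<sigma>_P)
  ultimately show ?thesis by simp
qed

lemma \<beta>_ad_skew:
  assumes "x \<in> V" "y \<in> V" "z \<in> V" shows "\<beta> (br x y) z = - \<beta> y (br x z)"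
proof -
  have "\<beta> (br x y) z = \<beta> (- br y x) z" using br_skew assms by metis
  also have "\<dots> = - \<beta> (br y x) z" using \<beta>_scale_left[of "br y x" z "-1"] assms by simp
  finally show ?thesis using \<beta>_invariant assms by simp
qed

lemma P_in_radical_if_\<beta>:
  assumes p: "p \<in> P" and 0: "\<And>q. q \<in> P \<Longrightarrow> \<beta> p q = 0" shows "p \<in> R"
proof (rule \<beta>_nondegenerate)
  fix y assume "y \<in> V"
  then obtain k q where kq: "k \<in> K" "q \<in> P" "y = k + q" by (rule canonical_decomposition)
  then show "\<beta> p y = 0" using 0 \<beta>_K_P[of k p] \<beta>_sym[of p k] p by (simp add: \<beta>_add_right)
qed (use p in simp)

lemma K_in_radical_if_\<beta>:
  assumes k: "k \<in> K" and 0: "\<And>l. l \<in> K \<Longrightarrow> \<beta> k l = 0" shows "k \<in> R"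
proof (rule \<beta>_nondegenerate)
  fix y assume "y \<in> V"
  then obtain l q where lq: "l \<in> K" "q \<in> P" "y = l + q" by (rule canonical_decomposition)
  then show "\<beta> k y = 0" using 0 \<beta>_K_P[of k q] k by (simp add: \<beta>_add_right)
qed (use k in simp)

lemma K_in_radical:
  assumes k: "k \<in> K" and 0: "\<And>x. x \<in> P \<Longrightarrow> br k x \<in> R" shows "k \<in> R"
proof (rule K_in_radical_if_\<beta>[OF k])
  fix l assume l: "l \<in> K"
  have "l \<in> {l \<in> V. \<beta> k l = 0}"
  proof (rule K_induct[OF l])
    show "subspace {l \<in> V. \<beta> k l = 0}"
      using k \<beta>_scale_right[of k 0 0] by (auto simp: real_vector.subspace_def \<beta>_add_right \<beta>_scale_right)
    fix x y assume "x \<in> P" "y \<in> P"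
    then show "br x y \<in> {l \<in> V. \<beta> k l = 0}"
      using \<beta>_invariant[of k x y] \<beta>_radical_left[OF 0, of x y] k by simp
  qed
  then show "\<beta> k l = 0" by simp
qed

text \<open>
  Then \<open>ad p\<close> maps all of \<open>V\<close> into \<open>R\<close>, so \<open>\<beta> p\<close> vanishes.
\<close>
lemma P_in_radical_if_brackets:
  assumes p: "p \<in> P" and 0: "\<And>q. q \<in> P \<Longrightarrow> br p q \<in> R" shows "p \<in> R"
proof (rule P_in_radical_if_\<beta>[OF p])
  fix q assume q: "q \<in> P"
  have pK: "br p k \<in> R" if k: "k \<in> K" for k
  proof -
    have "k \<in> {k \<in> V. br p k \<in> R}"
    proof (rule K_induct[OF k])
      show "subspace {k \<in> V. br p k \<in> R}"
        unfolding real_vector.subspace_def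
        using p subspace_0[OF subspace_radical] subspace_add[OF subspace_radical] subspace_scale[OF subspace_radical]
        by (auto simp: br_add_right br_scale_right)
      fix a b assume ab: "a \<in> P" "b \<in> P"
      have "br p (br a b) = br (br p a) b + br a (br p b)" using ab p by (intro br_derivation) auto
      also have "\<dots> \<in> R"
        using ab br_radical_left[OF 0[OF ab(1)], of b] br_radical_right[OF _ 0[OF ab(2)], of a]
          subspace_add[OF subspace_radical] by simp
      finally show "br a b \<in> {k \<in> V. br p k \<in> R}" using ab by simp
    qed
    then show ?thesis by simp
  qed
  have "br p (br q z) \<in> R" if "z \<in> V" for z
  proof -
    obtain k x where z: "k \<in> K" "x \<in> P" "z = k + x" using canonical_decomposition[OF \<open>z \<in> V\<close>] by blast
    then show ?thesis
      using p q 0[of "br q k"] pK[of "br q x"] subspace_add[OF subspace_radical] by (simp add: br_add_right)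
  qed
  then show "\<beta> p q = 0" using p q by (intro \<beta>_nilpotent[of _ _ 1]) auto
qed

text \<open>
  Typically applied to an \<open>x\<close> that is \<open>\<beta>\<close>-orthogonal to a \<open>K\<close>-stable subspace containing \<open>y\<close>.
\<close>
lemma orth_bracket_in_radical:
  assumes x: "x \<in> P" "y \<in> P" and 0: "\<And>k. k \<in> K \<Longrightarrow> \<beta> x (br k y) = 0" shows "br x y \<in> R"
proof (rule K_in_radical_if_\<beta>)
  fix l assume l: "l \<in> K"
  have "\<beta> (br x y) l = \<beta> x (- br l y)" using \<beta>_invariant[of x y l] br_skew[of y l] x l by simp
  also have "\<dots> = 0" using 0[OF l] \<beta>_scale_right[of x "br l y" "-1"] x l by simp
  finally show "\<beta> (br x y) l = 0" .
qed (use x in simp)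

text \<open>
  Modulo \<open>R\<close> the isotropy algebra \<open>K\<close> has no invariant vectors in \<open>P\<close>; this substitutes for the
  fact that semisimple algebras are perfect.
\<close>
lemma K_invariant_in_radical:
  assumes p: "p \<in> P" and 0: "\<And>k. k \<in> K \<Longrightarrow> br k p \<in> R" shows "p \<in> R"
proof (rule P_in_radical_if_brackets[OF p])
  fix q assume q: "q \<in> P"
  have "br q p \<in> R"
    by (rule orth_bracket_in_radical[OF q p]) (rule \<beta>_radical_right[OF 0 P_V[OF q]])
  then show "br p q \<in> R" using br_skew[of p q] p q subspace_neg[OF subspace_radical, of "br q p"] by simp
qed

text \<open>
  \<open>PR\<close> is the radical part of \<open>P\<close>, and \<open>U\<close> its \<open>\<Omega>\<close>-orthogonal.
\<close>
definition "PR = P \<inter> R"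
definition "U = {x \<in> P. \<forall>r\<in>PR. \<Omega> x r = 0}"

lemma subspace_PR: "subspace PR" unfolding PR_def by (rule subspace_inter[OF subspace_P subspace_radical])
lemma PR_P: "r \<in> PR \<Longrightarrow> r \<in> P" and PR_R: "r \<in> PR \<Longrightarrow> r \<in> R" by (simp_all add: PR_def)
lemma PR_sub: "PR \<subseteq> P" by (simp add: PR_def)
lemma PRI: "r \<in> P \<Longrightarrow> r \<in> R \<Longrightarrow> r \<in> PR" by (simp add: PR_def)
lemma br_K_PR: "k \<in> K \<Longrightarrow> r \<in> PR \<Longrightarrow> br k r \<in> PR" by (simp add: PR_def br_radical_right)
lemma br_KR_P: "k \<in> K \<Longrightarrow> k \<in> R \<Longrightarrow> p \<in> P \<Longrightarrow> br k p \<in> PR" by (simp add: PR_def br_radical_left)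
lemma U_P: "u \<in> U \<Longrightarrow> u \<in> P" by (simp add: U_def)
lemma \<Omega>_U_PR: "u \<in> U \<Longrightarrow> r \<in> PR \<Longrightarrow> \<Omega> u r = 0" by (simp add: U_def)
lemma \<Omega>_PR_U: "u \<in> U \<Longrightarrow> r \<in> PR \<Longrightarrow> \<Omega> r u = 0"
  using \<Omega>_skew[of r u] \<Omega>_U_PR PR_P U_P by simp

lemma subspace_U: "subspace U"
  unfolding real_vector.subspace_def by (auto simp: U_def \<Omega>_add_left \<Omega>_scale_left PR_P)

lemma br_K_U: "k \<in> K \<Longrightarrow> u \<in> U \<Longrightarrow> br k u \<in> U"
  unfolding U_def by (auto simp: \<Omega>_invariant PR_P br_K_PR)

text \<open>
  Dual, with respect to \<open>\<Omega>\<close>, to the fact that \<open>K \<inter> R\<close> maps \<open>P\<close> into \<open>PR\<close>.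
\<close>
lemma KR_kills_U: assumes k: "k \<in> K" "k \<in> R" and u: "u \<in> U" shows "br k u = 0"
proof (rule \<Omega>_nondegenerate)
  fix x assume x: "x \<in> P"
  have "\<Omega> (br k u) x = - \<Omega> u (br k x)" using k u x U_P by (intro \<Omega>_invariant) auto
  then show "\<Omega> (br k u) x = 0" using \<Omega>_U_PR[OF u br_KR_P[OF k x]] by simp
qed (use k u U_P in simp)

text \<open>
  The double orthogonal of \<open>PR\<close> is \<open>PR\<close>.
\<close>
lemma U_perp: assumes x: "x \<in> P" and 0: "\<And>u. u \<in> U \<Longrightarrow> \<Omega> x u = 0" shows "x \<in> PR"
proof -
  obtain r where r: "r \<in> PR" "\<And>s. s \<in> P \<Longrightarrow> \<Omega> x s = \<Omega> r s"
  proof (rule represent_functional[OF \<Omega>_bilinear subspace_PR PR_sub subspace_P order_refl])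
    show "linear_on P (\<Omega> x)" by (rule linear_\<Omega>_right[OF order_refl x])
    show "\<Omega> x s = 0" if "s \<in> P" "\<And>p. p \<in> PR \<Longrightarrow> \<Omega> p s = 0" for s
    proof (rule 0)
      have "\<Omega> s r = 0" if "r \<in> PR" for r using \<open>\<And>p. p \<in> PR \<Longrightarrow> \<Omega> p s = 0\<close>[OF that] \<Omega>_skew[of s r] \<open>s \<in> P\<close> PR_P[OF that] by simp
      then show "s \<in> U" using \<open>s \<in> P\<close> by (simp add: U_def)
    qed
  qed blast
  have "x - r = 0" using r x PR_P by (intro \<Omega>_nondegenerate) (auto simp: \<Omega>_diff_left)
  then show ?thesis using r by simp
qed

text \<open>
  Brackets of \<open>W\<close> and \<open>U\<close> lie in \<open>K \<inter> R\<close> and hence kill \<open>U\<close>.  By the Jacobi identity \<open>KA = [U,U]\<close>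
  kills \<open>W\<close>, and \<open>U1 = [KA,U]\<close> commutes with \<open>W\<close> and is \<open>\<Omega>\<close>-orthogonal to it.  Passing from \<open>U\<close> to
  \<open>U1\<close> removes the part of \<open>U\<close> in the radical: \<open>P\<close> is the direct sum of \<open>U1\<close> and \<open>W\<close>, and \<open>U1\<close>
  generates a semisimple factor.
\<close>
lemma no_semisimple_factor_complement:
  assumes W: "subspace W" "W \<subseteq> P" "PR \<subseteq> W" and sum: "\<And>x. x \<in> P \<Longrightarrow> \<exists>w\<in>W. \<exists>u\<in>U. x = w + u"
    and int: "W \<inter> U \<subseteq> PR" and WU: "\<And>w u. w \<in> W \<Longrightarrow> u \<in> U \<Longrightarrow> br w u \<in> R"
    and nofactor: "\<not> (\<exists>L. semisimple_factor V br \<sigma> \<Omega> L)"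
  shows "P \<subseteq> W"
proof -
  have WP: "w \<in> W \<Longrightarrow> w \<in> P" for w using W(2) by blast
  define KA where "KA = lie_bracket_span br U U"
  define U1 where "U1 = lie_bracket_span br KA U"
  have sKA: "subspace KA" and sU1: "subspace U1" by (simp_all add: KA_def U1_def subspace_lie_bracket_span)
  have KA_K: "k \<in> K" if "k \<in> KA" for k
    using lie_bracket_span_subset[OF subspace_K, of U U] U_P that unfolding KA_def by auto
  have U1_U: "u \<in> U" if "u \<in> U1" for u
    using lie_bracket_span_subset[OF subspace_U, of KA U] br_K_U KA_K that unfolding U1_def by auto
  have WU0: "br (br w u) v = 0" if "w \<in> W" "u \<in> U" "v \<in> U" for w u v
    using KR_kills_U[of "br w u" v] WU[of w u] that WP U_P by simp
  have KA_W: "br k w = 0" if k: "k \<in> KA" and w: "w \<in> W" for k w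
  proof -
    let ?S = "{k \<in> V. br k w = 0}"
    have wV: "w \<in> V" using w WP by simp
    have "subspace ?S" using wV by (auto simp: real_vector.subspace_def br_add_left br_scale_left)
    moreover have "br u v \<in> ?S" if uv: "u \<in> U" "v \<in> U" for u v
    proof -
      have V: "u \<in> V" "v \<in> V" using uv U_P by auto
      have "br w (br u v) = br (br w u) v + br u (br w v)" by (rule br_derivation[OF wV V])
      also have "\<dots> = 0" using WU0[OF w uv] WU0[OF w uv(2,1)] br_skew[of u "br w v"] V wV by simp
      finally have "br (br u v) w = 0" using br_skew[of "br u v" w] V wV by simp
      then show ?thesis using V by simp
    qed
    ultimately have "KA \<subseteq> ?S" unfolding KA_def by (rule lie_bracket_span_subset)
    then show ?thesis using k by blast
  qed
  have KA_KR: "br k l = 0" if k: "k \<in> KA" and l: "l \<in> K" "l \<in> R" for k l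
  proof -
    let ?S = "{k \<in> V. br l k = 0}"
    have lV: "l \<in> V" using l by simp
    have "subspace ?S" using lV by (auto simp: real_vector.subspace_def br_add_right br_scale_right)
    moreover have "br u v \<in> ?S" if uv: "u \<in> U" "v \<in> U" for u v
      using br_derivation[of l u v] KR_kills_U[OF l] uv U_P lV by simp
    ultimately have "KA \<subseteq> ?S" unfolding KA_def by (rule lie_bracket_span_subset)
    then show ?thesis using k br_skew[of k l] KA_K[OF k] lV by auto
  qed
  have U1_W: "\<Omega> u w = 0 \<and> br u w = 0" if u: "u \<in> U1" and w: "w \<in> W" for u w
  proof -
    let ?S = "{u \<in> P. \<Omega> u w = 0 \<and> br u w = 0}"
    have wP: "w \<in> P" using w WP by simp
    have "subspace ?S" using wP
      by (auto simp: real_vector.subspace_def br_add_left br_scale_left \<Omega>_add_left \<Omega>_scale_left)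
    moreover have "br k v \<in> ?S" if kv: "k \<in> KA" "v \<in> U" for k v
    proof -
      have V: "k \<in> K" "v \<in> P" using kv U_P KA_K by auto
      have "\<Omega> (br k v) w = 0" using \<Omega>_invariant[OF V wP] KA_W[OF kv(1) w] V by simp
      moreover have "br (br k v) w = br k (br v w)"
        using br_bracket_left[of k v w] KA_W[OF kv(1) w] V wP by simp
      moreover have "br v w \<in> R" using WU[OF w kv(2)] br_skew[of v w] V wP subspace_neg[OF subspace_radical] by simp
      then have "br k (br v w) = 0" using KA_KR[OF kv(1)] V wP by simp
      ultimately show ?thesis using V by simp
    qed
    ultimately have "U1 \<subseteq> ?S" unfolding U1_def by (rule lie_bracket_span_subset)
    then show ?thesis using u by blast
  qed
  have U1_P: "u \<in> P" if "u \<in> U1" for u using U1_U[OF that] U_P by blast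
  have U1_int_W: "x = 0" if x: "x \<in> U1" "x \<in> W" for x
  proof (rule \<Omega>_nondegenerate[OF U1_P[OF x(1)]])
    fix y assume "y \<in> P"
    then obtain w u where wu: "w \<in> W" "u \<in> U" "y = w + u" using sum by blast
    have "x \<in> PR" using U1_U x int by blast
    then show "\<Omega> x y = 0" using wu U1_W[OF x(1) wu(1)] \<Omega>_PR_U[OF wu(2)] WP U_P PR_P by (simp add: \<Omega>_add_right)
  qed
  (* An x orthogonal to U1 is moved by KA into the orthogonal of U, that is into PR.  Then its
     U-component u is K-invariant modulo R, hence lies in PR. *)
  have U1_perp: "x \<in> W" if x: "x \<in> P" and 0: "\<And>u. u \<in> U1 \<Longrightarrow> \<Omega> x u = 0" for x
  proof -
    obtain w u where wu: "w \<in> W" "u \<in> U" "x = w + u" using sum[OF x] by blast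
    have P: "w \<in> P" "u \<in> P" using wu WP U_P by auto
    have KAu: "br k u \<in> R" if k: "k \<in> KA" for k
    proof -
      have kx: "br k x = br k u" using wu P KA_K[OF k] KA_W[OF k] by (simp add: br_add_right)
      have "br k x \<in> PR"
      proof (rule U_perp)
        show "br k x \<in> P" using KA_K[OF k] x by simp
        fix v assume v: "v \<in> U"
        have "br k v \<in> U1" unfolding U1_def using k v by (rule lie_bracket_span_memI)
        then have "\<Omega> x (br k v) = 0" by (rule 0)
        then show "\<Omega> (br k x) v = 0" using \<Omega>_invariant[OF KA_K[OF k] x U_P[OF v]] by simp
      qed
      then show ?thesis using kx PR_R by simp
    qed
    have "u \<in> R"
    proof (rule K_invariant_in_radical[OF P(2)])
      fix k assume k: "k \<in> K"
      have "k \<in> {k \<in> V. br k u \<in> R}"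
      proof (rule K_induct[OF k])
        show "subspace {k \<in> V. br k u \<in> R}"
          unfolding real_vector.subspace_def
          using P subspace_0[OF subspace_radical] subspace_add[OF subspace_radical] subspace_scale[OF subspace_radical]
          by (auto simp: br_add_left br_scale_left)
        fix a b assume ab: "a \<in> P" "b \<in> P"
        obtain w1 u1 where 1: "w1 \<in> W" "u1 \<in> U" "a = w1 + u1" using sum[OF ab(1)] by blast
        obtain w2 u2 where 2: "w2 \<in> W" "u2 \<in> U" "b = w2 + u2" using sum[OF ab(2)] by blast
        have Ps: "w1 \<in> P" "u1 \<in> P" "w2 \<in> P" "u2 \<in> P" using 1 2 WP U_P by auto
        have "br a b = br w1 w2 + br w1 u2 + br u1 w2 + br u1 u2"
          using 1 2 Ps by (simp add: br_add_left br_add_right)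
        then have "br (br a b) u = br (br w1 w2) u + br (br w1 u2) u + br (br u1 w2) u + br (br u1 u2) u"
          using Ps P by (simp add: br_add_left)
        moreover have "br (br w1 w2) u \<in> R"
        proof -
          have "br (br w1 w2) u = br w1 (br w2 u) - br w2 (br w1 u)" using Ps P by (intro br_bracket_left) auto
          also have "\<dots> \<in> R" 
            using br_radical_right[OF P_V[OF Ps(1)] WU[OF 2(1) wu(2)]] br_radical_right[OF P_V[OF Ps(3)] WU[OF 1(1) wu(2)]]
            by (rule subspace_diff[OF subspace_radical])
          finally show ?thesis .
        qed
        moreover have "br (br w1 u2) u \<in> R" by (rule br_radical_left[OF WU[OF 1(1) 2(2)] P_V[OF P(2)]])
        moreover have "br u1 w2 \<in> R" using WU[OF 2(1) 1(2)] br_skew[of u1 w2] Ps subspace_neg[OF subspace_radical] by simp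
        then have "br (br u1 w2) u \<in> R" by (rule br_radical_left[OF _ P_V[OF P(2)]])
        moreover have "br u1 u2 \<in> KA" unfolding KA_def using 1(2) 2(2) by (rule lie_bracket_span_memI)
        then have "br (br u1 u2) u \<in> R" by (rule KAu)
        ultimately show "br a b \<in> {k \<in> V. br k u \<in> R}"
          using subspace_add[OF subspace_radical] ab by simp
      qed
      then show "br k u \<in> R" by simp
    qed
    then have "u \<in> PR" using P by (intro PRI)
    then show ?thesis using wu W(3) subspace_add[OF W(1)] by blast
  qed
  have split: "\<exists>a\<in>U1. \<exists>b\<in>W. x = a + b" if x: "x \<in> P" for x
  proof -
    have sub: "U1 \<subseteq> P" using U1_P by blast
    obtain u where u: "u \<in> U1" "\<And>s. s \<in> U1 \<Longrightarrow> \<Omega> x s = \<Omega> u s"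
    proof (rule represent_functional[OF \<Omega>_bilinear sU1 sub sU1 sub])
      show "linear_on U1 (\<Omega> x)" by (rule linear_\<Omega>_right[OF sub x])
      show "\<Omega> x s = 0" if s: "s \<in> U1" and 0: "\<And>p. p \<in> U1 \<Longrightarrow> \<Omega> p s = 0" for s
      proof -
        have "\<Omega> s p = 0" if "p \<in> U1" for p using 0[OF that] \<Omega>_skew[OF U1_P[OF s] U1_P[OF that]] by simp
        then have "s \<in> W" using U1_perp[OF U1_P[OF s]] by blast
        then have "s = 0" using U1_int_W s by blast
        then show ?thesis using x by simp
      qed
    qed blast
    have "x - u \<in> W" by (rule U1_perp) (use u x U1_P in \<open>auto simp: \<Omega>_diff_left\<close>)
    moreover have "x = u + (x - u)" by simp
    ultimately show ?thesis using u(1) by blast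
  qed
  show ?thesis
  proof (cases "U1 = {0}")
    case True
    then show ?thesis using split by auto
  next
    case False
    have "\<exists>L. semisimple_factor V br \<sigma> \<Omega> L"
    proof (rule semisimple_factor_if_split[OF sU1 W(1) _ W(2) split _ _ _ _ False])
      show "U1 \<subseteq> P" using U1_P by blast
      show "U1 \<inter> W \<subseteq> {0}" using U1_int_W by blast
      show "U1 \<inter> R \<subseteq> {0}" using U1_int_W U1_P PRI W(3) by blast
    qed (use U1_W in auto)
    then show ?thesis using nofactor by blast
  qed
qed

lemma solvable_if_P_radical:
  assumes "P \<subseteq> R" shows "lie_solvable V br"
proof -
  have KR: "k \<in> R" if "k \<in> K" for k
    using K_in_radical[OF that] assms that br_K_P by blast
  have "V \<subseteq> R"
  proof
    fix x assume "x \<in> V"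
    then obtain k p where "k \<in> K" "p \<in> P" "x = k + p" by (rule canonical_decomposition)
    then show "x \<in> R" using KR assms subspace_add[OF subspace_radical] by blast
  qed
  then have "V = R" using radical_subset by blast
  then show ?thesis using radical_greatest(2) by simp
qed

lemma P_radical_if_PR_symplectic:
  assumes nondeg: "\<And>r. r \<in> PR \<Longrightarrow> (\<And>s. s \<in> PR \<Longrightarrow> \<Omega> s r = 0) \<Longrightarrow> r = 0"
    and nofactor: "\<not> (\<exists>L. semisimple_factor V br \<sigma> \<Omega> L)"
  shows "P \<subseteq> R"
proof -
  have "P \<subseteq> PR"
  proof (rule no_semisimple_factor_complement[OF subspace_PR PR_sub order_refl _ _ _ nofactor])
    fix x assume x: "x \<in> P"
    obtain r where r: "r \<in> PR" "\<And>s. s \<in> PR \<Longrightarrow> \<Omega> x s = \<Omega> r s"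
    proof (rule represent_functional[OF \<Omega>_bilinear subspace_PR PR_sub subspace_PR PR_sub])
      show "linear_on PR (\<Omega> x)" by (rule linear_\<Omega>_right[OF PR_sub x])
      show "\<Omega> x s = 0" if "s \<in> PR" "\<And>p. p \<in> PR \<Longrightarrow> \<Omega> p s = 0" for s
        using nondeg[OF that] x by simp
    qed blast
    have "x - r \<in> U" using r x PR_P by (auto simp: U_def \<Omega>_diff_left)
    moreover have "x = r + (x - r)" by simp
    ultimately show "\<exists>w\<in>PR. \<exists>u\<in>U. x = w + u" using r(1) by blast
  qed (use br_radical_left PR_R U_P P_V in blast)+
  then show ?thesis using PR_R by blast
qed

end

context triple_with_form
begin

section \<open>Isotropic K-stable subspaces\<close>

lemma \<beta>_0_left: "y \<in> V \<Longrightarrow> \<beta> 0 y = 0"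
  using \<beta>_scale_left[of 0 y 0] by simp

text \<open>
  Let \<open>Yp\<close> be the \<open>\<beta>\<close>-orthogonal of \<open>Y\<close>.  An element \<open>e = [y,x]\<close> maps each term of the \<open>K\<close>-stable flag
  \<open>P\<close>, \<open>Yp\<close>, \<open>Y\<close>, \<open>PR\<close> into the next one.  So for \<open>k \<in> K\<close> the operator \<open>ad e ad k\<close> is
  nilpotent modulo \<open>R\<close>, on \<open>P\<close> because of the flag and on \<open>K\<close> because an element of \<open>K\<close> mapping \<open>P\<close> into
  \<open>PR\<close> lies in \<open>R\<close>.  Therefore \<open>\<beta> e k = 0\<close> and \<open>e \<in> R\<close>.
\<close>
lemma \<beta>_isotropic_flag_in_radical:
  assumes Y: "subspace Y" "Y \<subseteq> P" "PR \<subseteq> Y" and KY: "\<And>k y. k \<in> K \<Longrightarrow> y \<in> Y \<Longrightarrow> br k y \<in> Y"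
    and iso: "\<And>y z. y \<in> Y \<Longrightarrow> z \<in> Y \<Longrightarrow> \<beta> y z = 0"
    and kill: "\<And>y x z. y \<in> Y \<Longrightarrow> x \<in> P \<Longrightarrow> z \<in> Y \<Longrightarrow> br (br y x) z \<in> R"
  shows "Y \<subseteq> R"
proof
  fix y assume y: "y \<in> Y"
  have YP: "y \<in> Y \<Longrightarrow> y \<in> P" for y using Y(2) by blast
  have "br y x \<in> R" if x: "x \<in> P" for x
  proof -
    define e where "e = br y x"
    have e: "e \<in> K" using YP[OF y] x by (simp add: e_def)
    define Yp where "Yp = {v \<in> P. \<forall>z\<in>Y. \<beta> v z = 0}"
    define F :: "nat \<Rightarrow> 'a set" where "F j = (if j = 0 then P else if j = 1 then Yp else if j = 2 then Y else PR)" for j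
    have FP: "f \<in> P" if "f \<in> F j" for f j
      using that YP PR_P by (auto simp: F_def Yp_def split: if_splits)
    have KF: "br k f \<in> F j" if k: "k \<in> K" and f: "f \<in> F j" for k f j
    proof -
      have "br k v \<in> Yp" if v: "v \<in> Yp" for v
      proof -
        have "\<beta> (br k v) z = 0" if z: "z \<in> Y" for z
          using \<beta>_ad_skew[of k v z] KY[OF k z] v k YP[OF z] by (simp add: Yp_def)
        then show ?thesis using v k by (simp add: Yp_def)
      qed
      then show ?thesis using k f KY br_K_PR by (auto simp: F_def split: if_splits)
    qed
    have eF: "br e f \<in> F (Suc j)" if f: "f \<in> F j" for f j
    proof -
      have fP: "f \<in> P" using FP f by blast
      have eY: "br e z \<in> PR" if z: "z \<in> Y" for z
        using kill[OF y x z] e YP[OF z] by (simp add: PR_def e_def)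
      consider "j = 0" | "j = 1" | "j = 2" | "j > 2" by linarith
      then show ?thesis
      proof cases
        case 1
        have "\<beta> (br e f) z = 0" if z: "z \<in> Y" for z
          using \<beta>_ad_skew[of e f z] \<beta>_radical_right[OF PR_R[OF eY[OF z]], of f] e fP YP[OF z] by simp
        then have "br e f \<in> Yp" using e fP by (simp add: Yp_def)
        then show ?thesis using 1 by (simp add: F_def)
      next
        case 2
        then have f0: "\<And>z. z \<in> Y \<Longrightarrow> \<beta> f z = 0" using f by (simp add: F_def Yp_def)
        have "br f y \<in> R"
          by (rule orth_bracket_in_radical[OF fP YP[OF y]]) (use f0 KY y in blast)
        then have "br y f \<in> R" using br_skew[of y f] YP[OF y] fP subspace_neg[OF subspace_radical, of "br f y"] by simp
        then have 1: "br x (br y f) \<in> Y" using x YP[OF y] fP Y(3) by (auto simp: PR_def br_radical_right)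
        have xf: "br x f \<in> K" using x fP by simp
        have "br y (br x f) = - br (br x f) y" using br_skew[of y "br x f"] YP[OF y] xf by simp
        then have 2: "br y (br x f) \<in> Y" using KY[OF xf y] subspace_neg[OF Y(1)] by simp
        have "br e f = br y (br x f) - br x (br y f)"
          unfolding e_def using YP[OF y] x fP by (intro br_bracket_left) auto
        then show ?thesis using subspace_diff[OF Y(1) 2 1] \<open>j = 1\<close> by (simp add: F_def)
      next
        case 3
        then show ?thesis using eY f by (simp add: F_def)
      next
        case 4
        then show ?thesis using br_K_PR[OF e] f by (simp add: F_def)
      qed
    qed
    (* C i: operators in K lowering the flag by i steps; G i: the induced filtration of V,
       with G 0 = V and G 3 contained in R *)
    define C where "C i = {h \<in> K. \<forall>j. \<forall>f\<in>F j. br h f \<in> F (i + j)}" for i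
    have sF: "subspace (F j)" for j
    proof -
      have "subspace Yp"
        unfolding real_vector.subspace_def Yp_def
        using YP by (auto simp: \<beta>_0_left \<beta>_add_left \<beta>_scale_left)
      then show ?thesis using subspace_P Y(1) subspace_PR by (simp add: F_def)
    qed
    define G where "G i = {h + p |h p. h \<in> C i \<and> p \<in> F i}" for i
    have step: "br e (br k z) \<in> G (Suc i)" if k: "k \<in> K" and z: "z \<in> G i" for k z i
    proof -
      obtain h p where hp: "z = h + p" "h \<in> C i" "p \<in> F i" using z by (auto simp: G_def)
      have hK: "h \<in> K" and hF: "\<And>j f. f \<in> F j \<Longrightarrow> br h f \<in> F (i + j)" using hp(2) by (auto simp: C_def)
      have pP: "p \<in> P" using FP hp(3) by blast
      have "br e (br k z) = br e (br k h) + br e (br k p)"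
        using e k hK pP hp(1) by (simp add: br_add_right)
      moreover have "br e (br k p) \<in> F (Suc i)" by (rule eF[OF KF[OF k hp(3)]])
      moreover have "br e (br k h) \<in> C (Suc i)"
      proof -
        have kh: "br k h \<in> K" using k hK by simp
        have khF: "br (br k h) f \<in> F (i + j)" if f: "f \<in> F j" for f j
        proof -
          have "br (br k h) f = br k (br h f) - br h (br k f)" using k hK FP[OF f] by (intro br_bracket_left) auto
          then show ?thesis using subspace_diff[OF sF KF[OF k hF[OF f]] hF[OF KF[OF k f]]] by simp
        qed
        have "br (br e (br k h)) f \<in> F (Suc i + j)" if f: "f \<in> F j" for f j
        proof -
          have "br (br e (br k h)) f = br e (br (br k h) f) - br (br k h) (br e f)"
            using e kh FP[OF f] by (intro br_bracket_left) auto
          moreover have "br e (br (br k h) f) \<in> F (Suc i + j)" using eF[OF khF[OF f]] by simp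
          moreover have "br (br k h) (br e f) \<in> F (Suc i + j)" using khF[OF eF[OF f]] by simp
          ultimately show ?thesis using subspace_diff[OF sF] by simp
        qed
        then show ?thesis using e kh by (simp add: C_def)
      qed
      ultimately show ?thesis unfolding G_def by blast
    qed
    have G0: "z \<in> G 0" if z: "z \<in> V" for z
    proof -
      obtain k p where kp: "k \<in> K" "p \<in> P" "z = k + p" using canonical_decomposition[OF z] by blast
      then have "k \<in> C 0" "p \<in> F 0" using KF by (simp_all add: C_def) (simp add: F_def)
      then show ?thesis unfolding G_def using kp(3) by blast
    qed
    have G3: "z \<in> R" if z: "z \<in> G 3" for z
    proof -
      obtain h p where hp: "z = h + p" "h \<in> C 3" "p \<in> F 3" using z by (auto simp: G_def)
      have hP: "br h q \<in> R" if q: "q \<in> P" for q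
      proof -
        have "q \<in> F 0" using q by (simp add: F_def)
        then have "br h q \<in> F (3 + 0)" using hp(2) unfolding C_def by blast
        then show ?thesis by (simp add: F_def PR_def)
      qed
      have "h \<in> K" using hp(2) by (simp add: C_def)
      then have "h \<in> R" by (rule K_in_radical[OF _ hP])
      moreover have "p \<in> R" using hp(3) by (simp add: F_def PR_def)
      ultimately show ?thesis using hp(1) subspace_add[OF subspace_radical] by simp
    qed
    have "e \<in> R"
    proof (rule K_in_radical_if_\<beta>[OF e])
      fix k assume k: "k \<in> K"
      show "\<beta> e k = 0"
      proof (rule \<beta>_nilpotent[of _ _ 3])
        fix z assume z: "z \<in> V"
        have "((\<lambda>z. br e (br k z)) ^^ i) z \<in> G i" for i
          by (induction i) (simp_all add: G0 z step k)
        then show "((\<lambda>z. br e (br k z)) ^^ 3) z \<in> R" by (rule G3)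
      qed (use e k in simp_all)
    qed
    then show ?thesis by (simp add: e_def)
  qed
  then show "y \<in> R" by (rule P_in_radical_if_brackets[OF YP[OF y]])
qed

section \<open>An isotropic radical part\<close>

context
  assumes PR_iso: "\<And>r s. r \<in> PR \<Longrightarrow> s \<in> PR \<Longrightarrow> \<Omega> r s = 0"
begin

text \<open>
  The vectors on which \<open>\<beta>\<close> represents the functionals \<open>\<Omega> r\<close> for \<open>r \<in> PR\<close>.  Such a functional kills
  \<open>PR\<close>, the kernel of \<open>\<beta>\<close> on \<open>P\<close>, because \<open>PR\<close> is isotropic; so each \<open>r\<close> occurs, and \<open>W / PR\<close> is
  isomorphic to \<open>PR\<close> as a \<open>K\<close>-module.
\<close>
definition "W = {w \<in> P. \<exists>r\<in>PR. \<forall>x\<in>P. \<beta> w x = \<Omega> r x}"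

lemma W_P: "w \<in> W \<Longrightarrow> w \<in> P" by (simp add: W_def)

lemma W_sub: "W \<subseteq> P" "W \<subseteq> V" using W_P by auto

lemma WD: assumes "w \<in> W" obtains r where "r \<in> PR" "\<And>x. x \<in> P \<Longrightarrow> \<beta> w x = \<Omega> r x"
  using assms by (auto simp: W_def)

lemma WI: "w \<in> P \<Longrightarrow> r \<in> PR \<Longrightarrow> (\<And>x. x \<in> P \<Longrightarrow> \<beta> w x = \<Omega> r x) \<Longrightarrow> w \<in> W"
  by (auto simp: W_def)

lemma PR_W: "r \<in> PR \<Longrightarrow> r \<in> W"
  by (rule WI[of _ 0]) (simp_all add: PR_P subspace_0[OF subspace_PR] \<beta>_radical_left PR_R)

lemma PR_U: "r \<in> PR \<Longrightarrow> r \<in> U" by (simp add: U_def PR_P PR_iso)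

lemma subspace_W: "subspace W"
  unfolding real_vector.subspace_def
proof (intro conjI ballI allI)
  show "0 \<in> W" by (rule PR_W[OF subspace_0[OF subspace_PR]])
  fix v w assume "v \<in> W" "w \<in> W"
  then obtain r s where rs: "r \<in> PR" "\<And>x. x \<in> P \<Longrightarrow> \<beta> v x = \<Omega> r x" "s \<in> PR" "\<And>x. x \<in> P \<Longrightarrow> \<beta> w x = \<Omega> s x"
    by (metis WD)
  show "v + w \<in> W"
    by (rule WI[of _ "r + s"])
      (use rs \<open>v \<in> W\<close> \<open>w \<in> W\<close> W_P PR_P subspace_add[OF subspace_PR] in \<open>simp_all add: \<beta>_add_left \<Omega>_add_left\<close>)
next
  fix c w assume w: "w \<in> W"
  then obtain r where r: "r \<in> PR" "\<And>x. x \<in> P \<Longrightarrow> \<beta> w x = \<Omega> r x" by (metis WD)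
  show "c *\<^sub>R w \<in> W"
    by (rule WI[of _ "c *\<^sub>R r"])
      (use r w W_P PR_P subspace_scale[OF subspace_PR] in \<open>simp_all add: \<beta>_scale_left \<Omega>_scale_left\<close>)
qed

lemma br_K_W: assumes k: "k \<in> K" and w: "w \<in> W" shows "br k w \<in> W"
proof -
  obtain r where r: "r \<in> PR" "\<And>x. x \<in> P \<Longrightarrow> \<beta> w x = \<Omega> r x" using WD[OF w] by blast
  show ?thesis
  proof (rule WI[of _ "br k r"])
    fix x assume x: "x \<in> P"
    have "\<beta> (br k w) x = - \<Omega> r (br k x)" using \<beta>_ad_skew[of k w x] r(2)[of "br k x"] k x W_P[OF w] by simp
    then show "\<beta> (br k w) x = \<Omega> (br k r) x" using \<Omega>_invariant[OF k PR_P[OF r(1)] x] by simp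
  qed (use k w W_P r br_K_PR in auto)
qed

lemma \<beta>_W_U: "w \<in> W \<Longrightarrow> u \<in> U \<Longrightarrow> \<beta> w u = 0"
  by (metis WD U_P \<Omega>_PR_U)

lemma br_W_U: assumes w: "w \<in> W" and u: "u \<in> U" shows "br w u \<in> R"
  by (rule orth_bracket_in_radical[OF W_P[OF w] U_P[OF u]]) (rule \<beta>_W_U[OF w br_K_U[OF _ u]])

lemma W_surj: assumes r: "r \<in> PR" obtains w where "w \<in> W" "\<And>x. x \<in> P \<Longrightarrow> \<beta> w x = \<Omega> r x"
proof -
  obtain w where w: "w \<in> P" "\<And>x. x \<in> P \<Longrightarrow> \<Omega> r x = \<beta> w x"
  proof (rule represent_functional[OF \<beta>_bilinear_P subspace_P order_refl subspace_P order_refl])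
    show "linear_on P (\<Omega> r)" by (rule linear_\<Omega>_right[OF order_refl PR_P[OF r]])
    show "\<Omega> r s = 0" if s: "s \<in> P" and 0: "\<And>p. p \<in> P \<Longrightarrow> \<beta> p s = 0" for s
    proof -
      have "s \<in> R" by (rule P_in_radical_if_\<beta>[OF s]) (use 0 \<beta>_sym in metis)
      then show ?thesis using PR_iso[OF r] PRI[OF s] by blast
    qed
  qed blast
  then show ?thesis by (intro that[OF WI[OF w(1) r w(2)[symmetric]] w(2)[symmetric]])
qed

lemma W_perp: assumes x: "x \<in> P" and 0: "\<And>w. w \<in> W \<Longrightarrow> \<beta> w x = 0" shows "x \<in> U"
proof -
  have "\<Omega> x r = 0" if r: "r \<in> PR" for r
  proof -
    obtain w where "w \<in> W" "\<And>x. x \<in> P \<Longrightarrow> \<beta> w x = \<Omega> r x" using W_surj[OF r] by blast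
    then have "\<Omega> r x = 0" using 0 x by metis
    then show ?thesis using \<Omega>_skew[OF x PR_P[OF r]] by simp
  qed
  then show ?thesis using x by (simp add: U_def)
qed

text \<open>
  \<open>W \<inter> U\<close> is the kernel of \<open>\<beta>\<close> on \<open>W\<close>, so \<open>\<beta>\<close> is nondegenerate on \<open>W / PR\<close> and \<open>P\<close> decomposes
  orthogonally.
\<close>
lemma P_W_U:
  assumes int: "W \<inter> U \<subseteq> PR" and x: "x \<in> P"
  shows "\<exists>w\<in>W. \<exists>u\<in>U. x = w + u"
proof -
  obtain w where w: "w \<in> W" "\<And>s. s \<in> W \<Longrightarrow> \<beta> x s = \<beta> w s"
  proof (rule represent_functional[OF \<beta>_bilinear_P subspace_W W_sub(1) subspace_W W_sub(1)])
    show "linear_on W (\<beta> x)" by (rule linear_\<beta>_right[OF W_sub(2) P_V[OF x]])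
    show "\<beta> x s = 0" if s: "s \<in> W" and 0: "\<And>p. p \<in> W \<Longrightarrow> \<beta> p s = 0" for s
    proof -
      have "s \<in> U" by (rule W_perp[OF W_P[OF s] 0])
      then have "s \<in> PR" using s int by blast
      then show ?thesis using \<beta>_radical_right[OF PR_R] x by simp
    qed
  qed blast
  have "x - w \<in> U"
  proof (rule W_perp)
    show "x - w \<in> P" using x w W_P by simp
    fix v assume v: "v \<in> W"
    then have "\<beta> (x - w) v = 0" using w x W_P by (simp add: \<beta>_diff_left)
    then show "\<beta> v (x - w) = 0" using \<beta>_sym by metis
  qed
  moreover have "x = w + (x - w)" by simp
  ultimately show ?thesis using w(1) by blast
qed

text \<open>
  For \<open>e = [y,x]\<close> with \<open>y \<in> W \<inter> U\<close>, the Jacobi identity gives \<open>e U \<subseteq> W \<inter> U\<close>.  As \<open>\<Omega>\<close>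
  vanishes on \<open>W \<inter> U\<close>, invariance turns this into \<open>e (W \<inter> U) \<subseteq> PR\<close>, and the flag lemma applies.
\<close>
lemma W_int_U_radical_if_\<Omega>_isotropic:
  assumes iso: "\<And>y z. y \<in> W \<inter> U \<Longrightarrow> z \<in> W \<inter> U \<Longrightarrow> \<Omega> y z = 0"
  shows "W \<inter> U \<subseteq> PR"
proof -
  let ?Y = "W \<inter> U"
  have sY: "subspace ?Y" by (rule subspace_inter[OF subspace_W subspace_U])
  have KY: "br k y \<in> ?Y" if "k \<in> K" "y \<in> ?Y" for k y using that br_K_W br_K_U by blast
  have PRY: "r \<in> ?Y" if "r \<in> PR" for r using that PR_W PR_U by blast
  have "?Y \<subseteq> R"
  proof (rule \<beta>_isotropic_flag_in_radical[OF sY _ _ KY])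
    show "?Y \<subseteq> P" "PR \<subseteq> ?Y" using W_P PRY by blast+
    show "\<beta> y z = 0" if "y \<in> ?Y" "z \<in> ?Y" for y z using that \<beta>_W_U by blast
    fix y x z assume y: "y \<in> ?Y" and x: "x \<in> P" and z: "z \<in> ?Y"
    have yP: "y \<in> P" and zP: "z \<in> P" using y z W_P by blast+
    define e where "e = br y x"
    have e: "e \<in> K" using yP x by (simp add: e_def)
    have "br e z \<in> PR"
    proof (rule U_perp)
      show "br e z \<in> P" using e zP by simp
      fix u assume u: "u \<in> U"
      have uP: "u \<in> P" using u U_P by blast
      have "br y u \<in> R" using br_W_U y u by blast
      then have 1: "br x (br y u) \<in> ?Y" using br_radical_right[OF P_V[OF x] \<open>br y u \<in> R\<close>] x yP uP by (intro PRY PRI) auto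
      have xu: "br x u \<in> K" using x uP by simp
      have "br y (br x u) = - br (br x u) y" using br_skew[of y "br x u"] yP xu by simp
      then have 2: "br y (br x u) \<in> ?Y" using KY[OF xu y] subspace_neg[OF sY] by simp
      have "br e u = br y (br x u) - br x (br y u)"
        unfolding e_def using yP x uP by (intro br_bracket_left) auto
      then have "br e u \<in> ?Y" using subspace_diff[OF sY 2 1] by simp
      then show "\<Omega> (br e z) u = 0" using iso[OF z] \<Omega>_invariant[OF e zP uP] by simp
    qed
    then show "br (br y x) z \<in> R" using PR_R by (simp add: e_def)
  qed
  then show ?thesis using W_P PRI by blast
qed

text \<open>
  If \<open>PR\<close> is a line, so is \<open>W / PR\<close>.  Then \<open>W \<inter> U\<close> is isotropic, hence \<open>P = W + U\<close>, and a generator of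
  \<open>W\<close> modulo \<open>PR\<close> is central modulo \<open>R\<close>.
\<close>
lemma PR_not_line:
  assumes r0: "r0 \<in> PR" "r0 \<noteq> 0" and line: "\<And>r. r \<in> PR \<Longrightarrow> \<exists>a. r = a *\<^sub>R r0"
  shows False
proof -
  have J: "\<exists>a. \<forall>x\<in>P. \<beta> w x = a * \<Omega> r0 x" if w: "w \<in> W" for w
  proof -
    obtain r where r: "r \<in> PR" "\<And>x. x \<in> P \<Longrightarrow> \<beta> w x = \<Omega> r x" using WD[OF w] by blast
    obtain a where "r = a *\<^sub>R r0" using line[OF r(1)] by blast
    then show ?thesis using r(2) r0(1) PR_P by (auto simp: \<Omega>_scale_left)
  qed
  have comb: "a *\<^sub>R w - b *\<^sub>R v \<in> PR"
    if "w \<in> W" "v \<in> W" "\<forall>x\<in>P. \<beta> w x = b * \<Omega> r0 x" "\<forall>x\<in>P. \<beta> v x = a * \<Omega> r0 x" for a b v w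
    using that W_P by (intro PRI P_in_radical_if_\<beta>) (auto simp: \<beta>_diff_left \<beta>_scale_left)
  have int: "W \<inter> U \<subseteq> PR"
  proof (rule W_int_U_radical_if_\<Omega>_isotropic)
    fix y z assume y: "y \<in> W \<inter> U" and z: "z \<in> W \<inter> U"
    have P: "y \<in> P" "z \<in> P" using y z W_P by blast+
    obtain a where a: "\<forall>x\<in>P. \<beta> z x = a * \<Omega> r0 x" using J z by blast
    obtain b where b: "\<forall>x\<in>P. \<beta> y x = b * \<Omega> r0 x" using J y by blast
    show "\<Omega> y z = 0"
    proof (cases "a = 0")
      case True
      then have "z \<in> PR" using P(2) a by (intro PRI P_in_radical_if_\<beta>) auto
      then show ?thesis using \<Omega>_U_PR y by blast
    next
      case False
      have "a *\<^sub>R y - b *\<^sub>R z \<in> PR" using comb[of y z b a] y z a b by blast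
      then have "\<Omega> (a *\<^sub>R y - b *\<^sub>R z) z = 0" using \<Omega>_PR_U z by blast
      then have "a * \<Omega> y z = 0" using P by (simp add: \<Omega>_diff_left \<Omega>_scale_left \<Omega>_self)
      then show ?thesis using False by simp
    qed
  qed
  obtain w0 where w0: "w0 \<in> W" "\<And>x. x \<in> P \<Longrightarrow> \<beta> w0 x = \<Omega> r0 x" using W_surj[OF r0(1)] by blast
  have w0P: "w0 \<in> P" using w0 W_P by blast
  have "w0 \<in> R"
  proof (rule P_in_radical_if_brackets[OF w0P])
    fix x assume "x \<in> P"
    then obtain w u where wu: "w \<in> W" "u \<in> U" "x = w + u" using P_W_U[OF int] by blast
    have P: "w \<in> P" "u \<in> P" using wu W_P U_P by auto
    obtain a where a: "\<forall>x\<in>P. \<beta> w x = a * \<Omega> r0 x" using J wu by blast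
    have "1 *\<^sub>R w - a *\<^sub>R w0 \<in> PR" using comb[of w w0 a 1] wu w0 a by simp
    then have "br w0 (w - a *\<^sub>R w0) \<in> R" using w0P PR_R by (intro br_radical_right) auto
    then have "br w0 w \<in> R" using w0P P by (simp add: br_diff_right br_scale_right bracket_alternating)
    then show "br w0 x \<in> R"
      using br_W_U[OF w0(1) wu(2)] wu(3) w0P P subspace_add[OF subspace_radical] by (simp add: br_add_right)
  qed
  then have "\<Omega> r0 x = 0" if "x \<in> P" for x using w0(2)[OF that] \<beta>_radical_left that by simp
  then have "r0 = 0" using \<Omega>_nondegenerate PR_P r0(1) by blast
  then show False using r0(2) by simp
qed

section \<open>The quartic form on a symplectic plane\<close>

context
  assumes PR_dim: "dim PR = 2"
begin

text \<open>
  Since \<open>W / PR\<close> is a plane, any two vectors on which \<open>\<Omega>\<close> does not vanish span it.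
\<close>
lemma W_span:
  assumes uv: "u \<in> W \<inter> U" "v \<in> W \<inter> U" "\<Omega> u v \<noteq> 0" and w: "w \<in> W"
  shows "\<exists>a b. w - a *\<^sub>R u - b *\<^sub>R v \<in> PR"
proof -
  have P: "u \<in> P" "v \<in> P" "w \<in> P" using uv w W_P by blast+
  obtain s where s: "s \<in> PR" "\<And>x. x \<in> P \<Longrightarrow> \<beta> u x = \<Omega> s x" using WD uv by blast
  obtain t where t: "t \<in> PR" "\<And>x. x \<in> P \<Longrightarrow> \<beta> v x = \<Omega> t x" using WD uv by blast
  obtain r where r: "r \<in> PR" "\<And>x. x \<in> P \<Longrightarrow> \<beta> w x = \<Omega> r x" using WD w by blast
  have sP: "s \<in> P" "t \<in> P" "r \<in> P" using s t r PR_P by auto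
  have comb: "a *\<^sub>R u + b *\<^sub>R v \<in> PR" if "a *\<^sub>R s + b *\<^sub>R t = 0" for a b
  proof (intro PRI P_in_radical_if_\<beta>)
    fix x assume x: "x \<in> P"
    have "\<beta> (a *\<^sub>R u + b *\<^sub>R v) x = \<Omega> (a *\<^sub>R s + b *\<^sub>R t) x"
      using P x sP s t by (simp add: \<beta>_add_left \<beta>_scale_left \<Omega>_add_left \<Omega>_scale_left)
    then show "\<beta> (a *\<^sub>R u + b *\<^sub>R v) x = 0" using that x by simp
  qed (use P in auto)
  have indep: "a = 0 \<and> b = 0" if "a *\<^sub>R s + b *\<^sub>R t = 0" for a b
  proof -
    have "\<Omega> (a *\<^sub>R u + b *\<^sub>R v) v = 0" "\<Omega> (a *\<^sub>R u + b *\<^sub>R v) u = 0"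
      using \<Omega>_PR_U[OF _ comb[OF that]] uv by auto
    then show ?thesis using P uv(3) \<Omega>_skew[of v u]
      by (simp add: \<Omega>_add_left \<Omega>_scale_left \<Omega>_self)
  qed
  have "s \<noteq> t" using indep[of 1 "-1"] by auto
  moreover have "t \<noteq> 0" using indep[of 0 1] by auto
  moreover have "s \<notin> span {t}"
  proof
    assume "s \<in> span {t}"
    then obtain k where "s = k *\<^sub>R t" by (auto simp: span_singleton)
    then show False using indep[of 1 "-k"] by simp
  qed
  ultimately have "independent {s, t}" by (simp add: independent_insert)
  then have "dim (span {s, t}) = 2" using \<open>s \<noteq> t\<close> real_vector.dim_span_eq_card_independent by fastforce
  moreover have sub: "span {s, t} \<subseteq> PR" using s t by (intro span_minimal subspace_PR) auto
  ultimately have "span {s, t} = PR"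
    using PR_dim PR_P by (intro fd_subspace_dim_equal[OF finite_dimensional subspace_span sub]) auto
  then have "r \<in> span {s, t}" using r by simp
  then obtain a b where ab: "r = a *\<^sub>R s + b *\<^sub>R t"
    by (auto simp: span_insert span_singleton algebra_simps)
  have "w - a *\<^sub>R u - b *\<^sub>R v \<in> PR"
  proof (intro PRI P_in_radical_if_\<beta>)
    fix x assume x: "x \<in> P"
    have "\<beta> (w - a *\<^sub>R u - b *\<^sub>R v) x = \<Omega> r x - a * \<Omega> s x - b * \<Omega> t x"
      using P x s t r by (simp add: \<beta>_diff_left \<beta>_scale_left)
    also have "\<dots> = 0" using ab x sP by (simp add: \<Omega>_add_left \<Omega>_scale_left)
    finally show "\<beta> (w - a *\<^sub>R u - b *\<^sub>R v) x = 0" .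
  qed (use P in auto)
  then show ?thesis by blast
qed

lemma W_induct:
  assumes "u \<in> W \<inter> U" "v \<in> W \<inter> U" "\<Omega> u v \<noteq> 0" and w: "w \<in> W"
    and T: "subspace T" "PR \<subseteq> T" "u \<in> T" "v \<in> T"
  shows "w \<in> T"
proof -
  obtain a b where "w - a *\<^sub>R u - b *\<^sub>R v \<in> PR" using W_span[OF assms(1-4)] by blast
  then have "(w - a *\<^sub>R u - b *\<^sub>R v) + (a *\<^sub>R u + b *\<^sub>R v) \<in> T"
    using T by (intro subspace_add[OF T(1)] subspace_scale[OF T(1)]) auto
  then show ?thesis by (simp add: algebra_simps)
qed

text \<open>
  Now suppose that \<open>\<Omega>\<close> does not vanish on \<open>W \<inter> U\<close>.  Then \<open>W \<subseteq> U\<close>, and \<open>\<Omega>\<close> is nondegenerate on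
  \<open>W / PR\<close>.  The map \<open>X\<close> translates functionals on \<open>W\<close> between the two forms.
\<close>

context
  fixes y1 y2 X
  assumes y12: "y1 \<in> W \<inter> U" "y2 \<in> W \<inter> U" "\<Omega> y1 y2 \<noteq> 0"
    and X: "\<And>b. b \<in> W \<Longrightarrow> X b \<in> P" "\<And>w b. w \<in> W \<Longrightarrow> b \<in> W \<Longrightarrow> \<beta> w (X b) = \<Omega> w b"
begin

lemma W_U: "w \<in> W \<Longrightarrow> w \<in> U"
  using W_induct[OF y12 _ subspace_U] PR_U y12 by blast

lemma \<Omega>_W_nondegenerate:
  assumes s: "s \<in> W" and 0: "\<And>w. w \<in> W \<Longrightarrow> \<Omega> s w = 0" shows "s \<in> PR"
proof -
  have P: "y1 \<in> P" "y2 \<in> P" "s \<in> P" using y12 s W_P by blast+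
  obtain a b where ab: "s - a *\<^sub>R y1 - b *\<^sub>R y2 \<in> PR" using W_span[OF y12 s] by blast
  have "\<Omega> (s - a *\<^sub>R y1 - b *\<^sub>R y2) y1 = 0" "\<Omega> (s - a *\<^sub>R y1 - b *\<^sub>R y2) y2 = 0"
    using \<Omega>_PR_U[OF _ ab] y12 by auto
  then have "a = 0" "b = 0"
    using P 0[of y1] 0[of y2] y12 \<Omega>_skew[of y2 y1] by (simp_all add: \<Omega>_diff_left \<Omega>_scale_left \<Omega>_self)
  then show ?thesis using ab by simp
qed

text \<open>
  The quartic form \<open>\<Omega> [[a, X b], c] d\<close> (see \<open>Q_eq\<close>), written so that its symmetry under exchanging the
  pairs \<open>(a,b)\<close> and \<open>(c,d)\<close> is evident.
\<close>
definition "q a b c d = \<beta> (br a (X b)) (br c (X d))"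

lemma W_V: "w \<in> W \<Longrightarrow> w \<in> V" using W_P P_V by blast

text \<open>
  The value on the right needs \<open>x\<close> only through the operator \<open>[a,x]\<close>; so the identity holds for every
  \<open>x \<in> P\<close>, not just for those of the form \<open>X b\<close>.
\<close>
lemma Q_eq:
  assumes "a \<in> W" "x \<in> P" "c \<in> W" "d \<in> W"
  shows "\<beta> (br a x) (br c (X d)) = \<Omega> (br (br a x) c) d"
proof -
  have e: "br a x \<in> K" using assms W_P by simp
  have "\<beta> (br a x) (br c (X d)) = \<beta> (br (br a x) c) (X d)"
    using \<beta>_invariant[of "br a x" c "X d"] e W_V X(1) assms by simp
  then show ?thesis using X(2)[OF br_K_W[OF e assms(3)] assms(4)] by simp
qed

lemma Q_cong:
  assumes W: "a \<in> W" "c \<in> W" "d \<in> W" and x: "x \<in> P" "x' \<in> P" "\<And>w. w \<in> W \<Longrightarrow> \<beta> w x = \<beta> w x'"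
  shows "\<beta> (br a x) (br c (X d)) = \<beta> (br a x') (br c (X d))"
proof -
  let ?e = "br c (X d)"
  have e: "?e \<in> K" using W X W_P by simp
  have "\<beta> (br a z) ?e = \<beta> (br ?e a) z" if z: "z \<in> P" for z
    using \<beta>_invariant[of ?e a z] \<beta>_sym[of "br a z" ?e] e W_V[OF W(1)] z by simp
  then show ?thesis using x br_K_W[OF e W(1)] by simp
qed

text \<open>
  Total symmetry of \<open>q\<close> comes from three sources: \<open>[a, X b]\<close> is \<open>\<Omega>\<close>-skew, \<open>W\<close> is abelian modulo \<open>R\<close>, and
  \<open>\<beta>\<close> is symmetric.
\<close>
lemma q_34: assumes "a \<in> W" "b \<in> W" "c \<in> W" "d \<in> W" shows "q a b c d = q a b d c"
proof -
  have e: "br a (X b) \<in> K" using assms W_P X by simp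
  have P: "c \<in> P" "d \<in> P" using assms W_P by auto
  have "\<Omega> (br (br a (X b)) c) d = \<Omega> (br (br a (X b)) d) c"
    using \<Omega>_invariant[OF e P] \<Omega>_skew[of c "br (br a (X b)) d"] e P by simp
  then show ?thesis using assms X by (simp add: q_def Q_eq)
qed

lemma q_pair: "q a b c d = q c d a b" by (simp add: q_def \<beta>_sym)

lemma q_13: assumes "a \<in> W" "b \<in> W" "c \<in> W" "d \<in> W" shows "q a b c d = q c b a d"
proof -
  have P: "a \<in> P" "c \<in> P" "d \<in> P" "X b \<in> P" using assms W_P X by auto
  let ?x = "X b"
  have "br a c \<in> R" by (rule br_W_U[OF assms(1) W_U[OF assms(3)]])
  then have r: "br ?x (br a c) \<in> PR" using br_radical_right[OF _ \<open>br a c \<in> R\<close>, of ?x] P by (intro PRI) auto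
  have "br (br a ?x) c = br a (br ?x c) - br ?x (br a c)" using P by (intro br_bracket_left) auto
  also have "br a (br ?x c) = br (br c ?x) a"
  proof -
    have "br ?x c = - br c ?x" by (rule br_skew) (use P in auto)
    moreover have "br (br c ?x) a = - br a (br c ?x)" by (rule br_skew) (use P in auto)
    ultimately show ?thesis using P by (simp add: br_minus_right)
  qed
  finally have "\<Omega> (br (br a ?x) c) d = \<Omega> (br (br c ?x) a) d - \<Omega> (br ?x (br a c)) d"
    using P by (simp add: \<Omega>_diff_left)
  also have "\<Omega> (br ?x (br a c)) d = 0" by (rule \<Omega>_PR_U[OF W_U[OF assms(4)] r])
  finally show ?thesis using assms X by (simp add: q_def Q_eq)
qed

lemma q_12: assumes "a \<in> W" "b \<in> W" "c \<in> W" "d \<in> W" shows "q a b c d = q b a c d"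
proof -
  have "q a b c d = q d b c a" using q_34[OF assms] q_13[of a b d c] q_34[of d b a c] assms by simp
  also have "\<dots> = q c a d b" by (rule q_pair)
  also have "\<dots> = q c a b d" using assms by (intro q_34)
  also have "\<dots> = q b a c d" using assms by (intro q_13)
  finally show ?thesis .
qed

lemma q_add: assumes "a \<in> W" "a' \<in> W" "b \<in> W" "c \<in> W" "d \<in> W" shows "q (a + a') b c d = q a b c d + q a' b c d"
  using assms W_V X by (simp add: q_def br_add_left \<beta>_add_left)

lemma q_scale: assumes "a \<in> W" "b \<in> W" "c \<in> W" "d \<in> W" shows "q (k *\<^sub>R a) b c d = k * q a b c d"
  using assms W_V X by (simp add: q_def br_scale_left \<beta>_scale_left)

lemma q_radical: assumes "r \<in> PR" "b \<in> W" "c \<in> W" "d \<in> W" shows "q r b c d = 0"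
  unfolding q_def using assms X W_V PR_R by (intro \<beta>_radical_left br_radical_left) auto

lemma q_invariant:
  assumes e: "e \<in> K" and W: "a \<in> W" "b \<in> W" "c \<in> W" "d \<in> W"
  shows "q (br e a) b c d + q a (br e b) c d + q a b (br e c) d + q a b c (br e d) = 0"
proof -
  have P: "a \<in> P" "b \<in> P" "c \<in> P" "d \<in> P" "X b \<in> P" using W W_P X by auto
  have eW: "br e a \<in> W" "br e b \<in> W" "br e c \<in> W" "br e d \<in> W" using e W br_K_W by auto
  let ?f = "br a (X b)"
  have f: "?f \<in> K" using P by simp
  have "br e ?f = br (br e a) (X b) + br a (br e (X b))" using e P by (intro br_derivation) auto
  then have "\<beta> (br e ?f) (br c (X d)) = q (br e a) b c d + \<beta> (br a (br e (X b))) (br c (X d))"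
    using e P X W by (simp add: q_def \<beta>_add_left)
  also have "\<beta> (br a (br e (X b))) (br c (X d)) = q a (br e b) c d"
    unfolding q_def
  proof (rule Q_cong[OF W(1,3,4)])
    show "br e (X b) \<in> P" "X (br e b) \<in> P" using e P X eW by auto
    fix w assume w: "w \<in> W"
    have "\<beta> w (br e (X b)) = - \<beta> (br e w) (X b)" using \<beta>_ad_skew[of e w "X b"] e P W_V[OF w] by simp
    also have "\<dots> = - \<Omega> (br e w) b" using X(2)[OF br_K_W[OF e w] W(2)] by simp
    also have "\<dots> = \<Omega> w (br e b)" using \<Omega>_invariant[OF e W_P[OF w] P(2)] by simp
    also have "\<dots> = \<beta> w (X (br e b))" using X(2)[OF w eW(2)] by simp
    finally show "\<beta> w (br e (X b)) = \<beta> w (X (br e b))" .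
  qed
  finally have 1: "\<beta> (br e ?f) (br c (X d)) = q (br e a) b c d + q a (br e b) c d" .
  have "\<beta> (br e ?f) (br c (X d)) = \<beta> (br (br e ?f) c) (X d)"
    using \<beta>_invariant[of "br e ?f" c "X d"] e f P X W by simp
  also have "\<dots> = \<Omega> (br (br e ?f) c) d"
    using X(2)[OF br_K_W[OF br_K_K[OF e f] W(3)] W(4)] .
  also have "br (br e ?f) c = br e (br ?f c) - br ?f (br e c)" using e f P by (intro br_bracket_left) auto
  also have "\<Omega> (br e (br ?f c) - br ?f (br e c)) d = \<Omega> (br e (br ?f c)) d - \<Omega> (br ?f (br e c)) d"
    using e f P by (simp add: \<Omega>_diff_left)
  also have "\<Omega> (br e (br ?f c)) d = - \<Omega> (br ?f c) (br e d)" using e f P by (intro \<Omega>_invariant) auto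
  also have "\<Omega> (br ?f c) (br e d) = q a b c (br e d)" using Q_eq[OF W(1) P(5) W(3) eW(4)] by (simp add: q_def)
  also have "\<Omega> (br ?f (br e c)) d = q a b (br e c) d" using Q_eq[OF W(1) P(5) eW(3) W(4)] by (simp add: q_def)
  finally show ?thesis using 1 by simp
qed

lemma subspace_q_kernel: "subspace {w \<in> W. \<forall>b\<in>B. \<forall>c\<in>C. \<forall>d\<in>D. q w b c d = 0}"
  if "B \<subseteq> W" "C \<subseteq> W" "D \<subseteq> W"
  unfolding real_vector.subspace_def
  using that subspace_0[OF subspace_W] subspace_add[OF subspace_W] subspace_scale[OF subspace_W]
    subspace_0[OF subspace_PR]
  by (auto simp: q_add q_scale q_radical subset_iff)

lemma q_zero_extend:
  assumes uv: "u \<in> W" "v \<in> W" "\<Omega> u v \<noteq> 0" and BCD: "B \<subseteq> W" "C \<subseteq> W" "D \<subseteq> W"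
    and 0: "\<And>b c d. b \<in> B \<Longrightarrow> c \<in> C \<Longrightarrow> d \<in> D \<Longrightarrow> q u b c d = 0 \<and> q v b c d = 0"
    and w: "w \<in> W" "b \<in> B" "c \<in> C" "d \<in> D"
  shows "q w b c d = 0"
proof -
  have "w \<in> {w \<in> W. \<forall>b\<in>B. \<forall>c\<in>C. \<forall>d\<in>D. q w b c d = 0}"
  proof (rule W_induct[OF _ _ uv(3) w(1) subspace_q_kernel[OF BCD]])
    show "PR \<subseteq> {w \<in> W. \<forall>b\<in>B. \<forall>c\<in>C. \<forall>d\<in>D. q w b c d = 0}"
      using PR_W BCD q_radical by blast
  qed (use uv W_U 0 in auto)
  then show ?thesis using w by blast
qed

text \<open>
  The kernel of \<open>q\<close> is a \<open>K\<close>-stable \<open>\<beta>\<close>-isotropic subspace whose brackets with \<open>P\<close> map \<open>W\<close> into \<open>PR\<close>.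
\<close>
lemma q_kernel_radical:
  assumes y: "y \<in> W" and 0: "\<And>b c d. b \<in> W \<Longrightarrow> c \<in> W \<Longrightarrow> d \<in> W \<Longrightarrow> q y b c d = 0"
  shows "y \<in> R"
proof -
  let ?Y = "{w \<in> W. \<forall>b\<in>W. \<forall>c\<in>W. \<forall>d\<in>W. q w b c d = 0}"
  have "?Y \<subseteq> R"
  proof (rule \<beta>_isotropic_flag_in_radical)
    show "subspace ?Y" by (rule subspace_q_kernel) auto
    show "?Y \<subseteq> P" using W_P by blast
    show "PR \<subseteq> ?Y" using PR_W q_radical by blast
    fix k z assume k: "k \<in> K" and z: "z \<in> ?Y"
    then have zW: "z \<in> W" and zq: "\<And>b c d. b \<in> W \<Longrightarrow> c \<in> W \<Longrightarrow> d \<in> W \<Longrightarrow> q z b c d = 0" by auto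
    have "q (br k z) b c d = 0" if "b \<in> W" "c \<in> W" "d \<in> W" for b c d
      using q_invariant[OF k zW that] zq that br_K_W[OF k] by simp
    then show "br k z \<in> ?Y" using br_K_W[OF k zW] by simp
  next
    fix z z' assume "z \<in> ?Y" "z' \<in> ?Y"
    then show "\<beta> z z' = 0" using \<beta>_W_U W_U by blast
  next
    fix z x z' assume z: "z \<in> ?Y" and x: "x \<in> P" and z': "z' \<in> ?Y"
    have W: "z \<in> W" "z' \<in> W" using z z' by auto
    obtain b where b: "b \<in> W" "\<And>w. w \<in> W \<Longrightarrow> \<beta> x w = \<Omega> b w"
    proof (rule represent_functional[OF \<Omega>_bilinear subspace_W W_sub(1) subspace_W W_sub(1)])
      show "linear_on W (\<beta> x)" by (rule linear_\<beta>_right[OF W_sub(2) P_V[OF x]])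
      show "\<beta> x s = 0" if s: "s \<in> W" and s0: "\<And>p. p \<in> W \<Longrightarrow> \<Omega> p s = 0" for s
      proof -
        have "\<Omega> s w = 0" if "w \<in> W" for w
          using \<Omega>_skew[OF W_P[OF s] W_P[OF that]] s0[OF that] by simp
        then have "s \<in> PR" by (rule \<Omega>_W_nondegenerate[OF s])
        then show ?thesis using \<beta>_radical_right[OF PR_R] x by simp
      qed
    qed blast
    (* On W the functional of x is that of X (- b), so x may be replaced by X (- b). *)
    have b': "- b \<in> W" using subspace_neg[OF subspace_W b(1)] .
    have bx: "\<beta> w x = \<beta> w (X (- b))" if w: "w \<in> W" for w
      using b(2)[OF w] X(2)[OF w b'] \<beta>_sym[of w x] \<Omega>_skew[of b w] \<Omega>_scale_right[of w b "-1"] W_P[OF w] W_P[OF b(1)] by simp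
    let ?e = "br z x"
    have e: "?e \<in> K" using x W W_P by simp
    have "br ?e z' \<in> PR"
    proof (rule \<Omega>_W_nondegenerate[OF br_K_W[OF e W(2)]])
      fix d assume d: "d \<in> W"
      have "\<Omega> (br ?e z') d = \<beta> ?e (br z' (X d))" using Q_eq[OF W(1) x W(2) d] by simp
      also have "\<dots> = q z (- b) z' d" unfolding q_def
        using Q_cong[OF W d x X(1)[OF b'] bx] by simp
      also have "\<dots> = 0" using z b' W d by simp
      finally show "\<Omega> (br ?e z') d = 0" .
    qed
    then show "br (br z x) z' \<in> R" by (rule PR_R)
  qed
  then show ?thesis using assms by blast
qed

lemma q_perm:
  assumes "a \<in> W" "b \<in> W" "c \<in> W" "d \<in> W"
  shows "q a b c d = q b a c d" "q a b c d = q c b a d" "q a b c d = q a b d c" "q a b c d = q a c b d"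
proof -
  show "q a b c d = q b a c d" "q a b c d = q c b a d" "q a b c d = q a b d c"
    using assms q_12 q_13 q_34 by auto
  have "q a b c d = q b a c d" using assms by (intro q_12)
  also have "\<dots> = q c a b d" using assms by (intro q_13)
  also have "\<dots> = q a c b d" using assms by (intro q_12)
  finally show "q a b c d = q a c b d" .
qed

text \<open>
  Let \<open>q a a a a \<noteq> 0\<close>, and set \<open>e = [a, X a]\<close> and \<open>b = [e,a]\<close>; then \<open>a\<close> and \<open>b\<close> span \<open>W\<close> modulo \<open>PR\<close>.
  From \<open>[e,e] = 0\<close> follows \<open>q a b = 0\<close>, and invariance of \<open>q\<close> under \<open>e\<close> then gives \<open>q b b b b = 0\<close>.  So
  \<open>b\<close> is in the kernel of \<open>q\<close>, which is impossible outside \<open>R\<close>.  If \<open>q\<close> vanishes on the diagonal, it is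
  zero by polarization, and the same contradiction arises for \<open>y1\<close>.
\<close>
lemma quartic_contradiction: False
proof -
  have y: "y1 \<in> W" "y2 \<in> W" "y1 \<in> P" "y2 \<in> P" using y12 W_P by blast+
  have notR: "w \<notin> R" if w: "w \<in> W" "v \<in> W" "\<Omega> w v \<noteq> 0" for w v
    using \<Omega>_PR_U[OF W_U[OF w(2)], of w] w PRI[of w] W_P by blast
  show False
  proof (cases "\<exists>a\<in>W. q a a a a \<noteq> 0")
    case True
    then obtain a where a: "a \<in> W" "q a a a a \<noteq> 0" by blast
    have aP: "a \<in> P" using a W_P by blast
    define e where "e = br a (X a)"
    have e: "e \<in> K" using aP X a by (simp add: e_def)
    define b where "b = br e a"
    have b: "b \<in> W" using br_K_W[OF e a(1)] by (simp add: b_def)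
    have bP: "b \<in> P" using b W_P by blast
    have ba: "\<Omega> b a \<noteq> 0" using a(2) Q_eq[OF a(1) X(1)[OF a(1)] a(1) a(1)] by (simp add: q_def b_def e_def)
    then have ab: "\<Omega> a b \<noteq> 0" using \<Omega>_skew[OF aP bP] by simp
    have qab: "q a b c d = 0" if cd: "c \<in> W" "d \<in> W" for c d
    proof -
      have Xa: "X a \<in> P" using X a by blast
      have "0 = br e e" using bracket_alternating e by simp
      also have "br e e = br e (br a (X a))" by (simp add: e_def)
      also have "\<dots> = br (br e a) (X a) + br a (br e (X a))"
        using e aP Xa by (intro br_derivation) auto
      finally have sum0: "0 = br b (X a) + br a (br e (X a))" by (simp add: b_def)
      have "\<beta> (br b (X a) + br a (br e (X a))) (br c (X d)) = \<beta> (br b (X a)) (br c (X d)) + \<beta> (br a (br e (X a))) (br c (X d))"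
        using bP aP Xa e cd W_P X by (intro \<beta>_add_left) simp_all
      then have "\<beta> 0 (br c (X d)) = \<beta> (br b (X a)) (br c (X d)) + \<beta> (br a (br e (X a))) (br c (X d))"
        unfolding sum0[symmetric] .
      moreover have "\<beta> 0 (br c (X d)) = 0" using \<beta>_scale_left[of 0 "br c (X d)" 0] cd W_P X by simp
      moreover have "\<beta> (br a (br e (X a))) (br c (X d)) = \<beta> (br a (X b)) (br c (X d))"
      proof (rule Q_cong[OF a(1) cd])
        show "br e (X a) \<in> P" "X b \<in> P" using e Xa X b by auto
        fix w assume w: "w \<in> W"
        have "\<beta> w (br e (X a)) = - \<beta> (br e w) (X a)" using \<beta>_ad_skew[of e w "X a"] e Xa W_V[OF w] by simp
        also have "\<dots> = - \<Omega> (br e w) a" using X(2)[OF br_K_W[OF e w] a(1)] by simp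
        also have "\<dots> = \<Omega> w b" using \<Omega>_invariant[OF e W_P[OF w] aP] by (simp add: b_def)
        also have "\<dots> = \<beta> w (X b)" using X(2)[OF w b] by simp
        finally show "\<beta> w (br e (X a)) = \<beta> w (X b)" .
      qed
      ultimately have "q b a c d + q a b c d = 0" by (simp add: q_def)
      then show ?thesis using q_perm(1)[OF a(1) b cd] by simp
    qed
    have eb: "br e b \<in> W" using br_K_W[OF e b] .
    have "q (br e a) b b b + q a (br e b) b b + q a b (br e b) b + q a b b (br e b) = 0"
      by (rule q_invariant[OF e a(1) b b b])
    moreover have "q a (br e b) b b = 0" using q_perm(4)[OF a(1) eb b b] qab[OF eb b] by simp
    ultimately have bbbb: "q b b b b = 0" using qab[OF eb b] qab[OF b eb] by (simp add: b_def)
    have qba: "q b a c d = 0" if "c \<in> W" "d \<in> W" for c d using qab[OF that] q_perm(1)[OF a(1) b that] by simp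
    have bbb: "q b b b d = 0" if d: "d \<in> W" for d
    proof -
      have "q d b b b = 0"
        by (rule q_zero_extend[OF a(1) b ab, of "{b}" "{b}" "{b}"]) (use a b d qab bbbb in auto)
      then show ?thesis using q_pair[of d b b b] q_perm(3)[OF b b d b] by simp
    qed
    have bb: "q b b c d = 0" if cd: "c \<in> W" "d \<in> W" for c d
    proof -
      have "q c b b d = 0"
      proof (rule q_zero_extend[OF a(1) b ab, of "{b}" "{b}" W])
        fix b' c' d' assume "b' \<in> {b}" "c' \<in> {b}" "d' \<in> W"
        then show "q a b' c' d' = 0 \<and> q b b' c' d' = 0" using qab[OF b] bbb by simp
      qed (use b cd in auto)
      then show ?thesis using q_perm(2)[OF cd(1) b b cd(2)] by simp
    qed
    have "b \<in> R"
    proof (rule q_kernel_radical[OF b])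
      fix b' c d assume W: "b' \<in> W" "c \<in> W" "d \<in> W"
      have "q b' b c d = 0"
      proof (rule q_zero_extend[OF a(1) b ab, of "{b}" W W])
        fix b' c' d' assume "b' \<in> {b}" "c' \<in> W" "d' \<in> W"
        then show "q a b' c' d' = 0 \<and> q b b' c' d' = 0" using qab bb by simp
      qed (use b W in auto)
      then show "q b b' c d = 0" using q_perm(1)[OF b W] by simp
    qed
    then show False using notR[OF b a(1) ba] by blast
  next
    case False
    have diag: "q a a a a = 0" if "a \<in> W" for a using False that by blast
    have exp: "q (u + t *\<^sub>R v) b c d = q u b c d + t * q v b c d"
      if "u \<in> W" "v \<in> W" "b \<in> W" "c \<in> W" "d \<in> W" for u v b c d t
      using that subspace_scale[OF subspace_W] by (simp add: q_add q_scale)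
    have p: "q y2 y1 y1 y1 = q y1 y1 y1 y2" "q y1 y2 y1 y1 = q y1 y1 y1 y2" "q y1 y1 y2 y1 = q y1 y1 y1 y2"
      "q y2 y2 y1 y1 = q y1 y1 y2 y2" "q y2 y1 y2 y1 = q y1 y1 y2 y2" "q y2 y1 y1 y2 = q y1 y1 y2 y2"
      "q y1 y2 y2 y1 = q y1 y1 y2 y2" "q y1 y2 y1 y2 = q y1 y1 y2 y2"
      "q y2 y1 y2 y2 = q y1 y2 y2 y2" "q y2 y2 y1 y2 = q y1 y2 y2 y2" "q y2 y2 y2 y1 = q y1 y2 y2 y2"
      using y q_perm by metis+
    have poly: "4 * t * q y1 y1 y1 y2 + 6 * t^2 * q y1 y1 y2 y2 + 4 * t^3 * q y1 y2 y2 y2 = 0" for t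
    proof -
      define z where "z = y1 + t *\<^sub>R y2"
      have z: "z \<in> W" using y by (simp add: z_def subspace_add[OF subspace_W] subspace_scale[OF subspace_W])
      have ex: "q z b c d = q y1 b c d + t * q y2 b c d" if "b \<in> W" "c \<in> W" "d \<in> W" for b c d
        unfolding z_def by (rule exp[OF y(1,2) that])
      have n4: "q z z z z = q y1 z z z + t * q y2 z z z" by (rule ex[OF z z z])
      have n3: "q a z z z = q y1 a z z + t * q y2 a z z" if "a \<in> W" for a
        using q_perm(1)[OF that z z z] ex[OF that z z] by simp
      have n2: "q a b z z = q y1 a b z + t * q y2 a b z" if "a \<in> W" "b \<in> W" for a b
        using q_perm(2)[OF that z z] q_perm(4)[OF z that(2) that(1) z] ex[OF that z] by simp
      have n1: "q a b c z = q y1 a b c + t * q y2 a b c" if "a \<in> W" "b \<in> W" "c \<in> W" for a b c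
      proof -
        have "q a b c z = q c z a b" by (rule q_pair)
        also have "\<dots> = q z c a b" using that z by (intro q_perm(1))
        also have "\<dots> = q z a c b" using that z by (intro q_perm(4))
        also have "\<dots> = q z a b c" using that z by (intro q_perm(3))
        finally show ?thesis using ex[OF that] by simp
      qed
      have "0 = q z z z z" using diag[OF z] by simp
      also have "\<dots> = q y1 y1 y1 y1 + 4 * t * q y1 y1 y1 y2 + 6 * t^2 * q y1 y1 y2 y2 + 4 * t^3 * q y1 y2 y2 y2 + t^4 * q y2 y2 y2 y2"
        using y by (simp add: n4 n3 n2 n1 p algebra_simps power2_eq_square power3_eq_cube power4_eq_xxxx)
      finally show ?thesis using diag y by simp
    qed
    (* three values of t suffice, as the extreme coefficients vanish already *)
    have z: "q y1 y1 y1 y2 = 0" "q y1 y1 y2 y2 = 0" "q y1 y2 y2 y2 = 0"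
      using poly[of 1] poly[of "-1"] poly[of 2] by simp_all
    have basis: "q a b c d = 0" if "a \<in> {y1, y2}" "b \<in> {y1, y2}" "c \<in> {y1, y2}" "d \<in> {y1, y2}" for a b c d
    proof -
      show ?thesis using that z p diag y by auto
    qed
    let ?B = "{y1, y2}"
    have BW: "?B \<subseteq> W" using y by blast
    have 1: "q a b c d = 0" if "a \<in> W" "b \<in> ?B" "c \<in> ?B" "d \<in> ?B" for a b c d
      by (rule q_zero_extend[OF y(1,2) y12(3) BW BW BW _ that]) (use basis in auto)
    have 2: "q a b c d = 0" if "a \<in> W" "b \<in> W" "c \<in> ?B" "d \<in> ?B" for a b c d
    proof (rule q_zero_extend[OF y(1,2) y12(3) order_refl BW BW _ that])
      fix b c d assume W: "b \<in> W" "c \<in> ?B" "d \<in> ?B"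
      then have cd: "c \<in> W" "d \<in> W" using y by auto
      show "q y1 b c d = 0 \<and> q y2 b c d = 0"
        using q_perm(1)[OF y(1) W(1) cd] q_perm(1)[OF y(2) W(1) cd] 1[OF W(1) _ W(2,3)] by simp
    qed
    have 3: "q a b c d = 0" if "a \<in> W" "b \<in> W" "c \<in> W" "d \<in> ?B" for a b c d
    proof (rule q_zero_extend[OF y(1,2) y12(3) order_refl order_refl BW _ that])
      fix b c d assume W: "b \<in> W" "c \<in> W" "d \<in> ?B"
      then have d: "d \<in> W" using y by auto
      show "q y1 b c d = 0 \<and> q y2 b c d = 0"
        using q_perm(2)[OF y(1) W(1,2) d] q_perm(2)[OF y(2) W(1,2) d] 2[OF W(2,1) _ W(3)] by simp
    qed
    have "y1 \<in> R"
    proof (rule q_kernel_radical[OF y(1)])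
      fix b c d assume W: "b \<in> W" "c \<in> W" "d \<in> W"
      have "q y1 b c d = q y1 b d c" using W y by (intro q_perm(3))
      also have "\<dots> = q d b y1 c" using W y by (intro q_perm(2))
      also have "\<dots> = q d b c y1" using W y by (intro q_perm(3))
      finally show "q y1 b c d = 0" using 3[OF W(3,1,2), of y1] by simp
    qed
    then show False using notR[OF y(1,2) y12(3)] by blast
  qed
qed

end

lemma W_int_U_radical: "W \<inter> U \<subseteq> PR"
proof (rule W_int_U_radical_if_\<Omega>_isotropic, rule ccontr)
  fix y z assume yz: "y \<in> W \<inter> U" "z \<in> W \<inter> U" "\<Omega> y z \<noteq> 0"
  have WU: "w \<in> U" if "w \<in> W" for w
    using W_induct[OF yz that subspace_U] PR_U yz by blast
  have "\<exists>x\<in>P. \<forall>w\<in>W. \<beta> w x = \<Omega> w b" if b: "b \<in> W" for b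
  proof -
    obtain x where x: "x \<in> P" "\<And>w. w \<in> W \<Longrightarrow> \<Omega> w b = \<beta> x w"
    proof (rule represent_functional[OF \<beta>_bilinear_P subspace_P order_refl subspace_W W_sub(1)])
      show "linear_on W (\<lambda>w. \<Omega> w b)" by (rule linear_\<Omega>_left[OF W_sub(1) W_P[OF b]])
      show "\<Omega> s b = 0" if s: "s \<in> W" and 0: "\<And>p. p \<in> P \<Longrightarrow> \<beta> p s = 0" for s
      proof -
        have "s \<in> PR" by (intro PRI W_P s P_in_radical_if_\<beta>) (use 0 \<beta>_sym in metis)
        then show ?thesis using \<Omega>_PR_U[OF WU[OF b]] by blast
      qed
    qed blast
    then show ?thesis using \<beta>_sym by metis
  qed
  then obtain X where "\<And>b. b \<in> W \<Longrightarrow> X b \<in> P \<and> (\<forall>w\<in>W. \<beta> w (X b) = \<Omega> w b)" by metis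
  then show False using quartic_contradiction[OF yz, of X] by blast
qed

text \<open>
  Now \<open>P = W\<close>, and preimages in \<open>W\<close> of a basis of \<open>PR\<close> extend this basis to one of \<open>P\<close>.
\<close>
lemma dim_P_if_isotropic:
  assumes nofactor: "\<not> (\<exists>L. semisimple_factor V br \<sigma> \<Omega> L)"
  shows "dim P = 4"
proof -
  have sub: "W \<subseteq> P" "PR \<subseteq> W" using W_P PR_W by auto
  have PW: "P \<subseteq> W"
    by (rule no_semisimple_factor_complement[OF subspace_W sub P_W_U[OF W_int_U_radical] W_int_U_radical br_W_U nofactor])
  obtain B where B: "B \<subseteq> PR" "independent B" "PR \<subseteq> span B" "card B = dim PR"
    using real_vector.basis_exists by blast
  then obtain r1 r2 where r12: "B = {r1, r2}" "r1 \<noteq> r2" using PR_dim card_2_iff[of B] by auto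
  have r: "r1 \<in> PR" "r2 \<in> PR" "r1 \<in> P" "r2 \<in> P" using B r12 PR_P by auto
  have PRspan: "\<exists>a b. s = a *\<^sub>R r1 + b *\<^sub>R r2" if "s \<in> PR" for s
  proof -
    have "s \<in> span {r1, r2}" using B(3) r12 that by blast
    then show ?thesis by (auto simp: span_insert span_singleton algebra_simps)
  qed
  have rindep: "a = 0 \<and> b = 0" if ab: "a *\<^sub>R r1 + b *\<^sub>R r2 = 0" for a b
  proof -
    have i: "r2 \<noteq> 0" "r1 \<notin> span {r2}" using B(2) r12 by (auto simp: independent_insert dependent_zero)
    have "a = 0"
    proof (rule ccontr)
      assume "a \<noteq> 0"
      have "a *\<^sub>R r1 = (- b) *\<^sub>R r2" using ab by (simp add: eq_neg_iff_add_eq_0)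
      then have "(inverse a) *\<^sub>R (a *\<^sub>R r1) = (inverse a) *\<^sub>R ((- b) *\<^sub>R r2)" by simp
      then have "r1 = (inverse a * (- b)) *\<^sub>R r2" using \<open>a \<noteq> 0\<close> by simp
      then have "r1 \<in> span {r2}" unfolding span_singleton by (rule range_eqI)
      then show False using i(2) by blast
    qed
    then show ?thesis using ab i(1) by simp
  qed
  obtain w1 where w1: "w1 \<in> W" "\<And>x. x \<in> P \<Longrightarrow> \<beta> w1 x = \<Omega> r1 x" using W_surj[OF r(1)] by blast
  obtain w2 where w2: "w2 \<in> W" "\<And>x. x \<in> P \<Longrightarrow> \<beta> w2 x = \<Omega> r2 x" using W_surj[OF r(2)] by blast
  have wP: "w1 \<in> P" "w2 \<in> P" using w1 w2 W_P by auto
  have wzero: "a = 0 \<and> b = 0" if ab: "a *\<^sub>R w1 + b *\<^sub>R w2 \<in> PR" for a b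
  proof (rule rindep)
    show "a *\<^sub>R r1 + b *\<^sub>R r2 = 0"
    proof (rule \<Omega>_nondegenerate)
      fix x assume x: "x \<in> P"
      have "\<beta> (a *\<^sub>R w1 + b *\<^sub>R w2) x = 0" using \<beta>_radical_left PR_R ab x by simp
      then show "\<Omega> (a *\<^sub>R r1 + b *\<^sub>R r2) x = 0"
        using w1(2)[OF x] w2(2)[OF x] wP r x by (simp add: \<beta>_add_left \<beta>_scale_left \<Omega>_add_left \<Omega>_scale_left)
    qed (use r in simp)
  qed
  have lin: "span {r1, r2} \<subseteq> PR" using r by (intro span_minimal subspace_PR) auto
  have n2: "w2 \<notin> span {r1, r2}" using lin wzero[of 0 1] by auto
  have n1: "w1 \<notin> span {w2, r1, r2}"
  proof
    assume "w1 \<in> span {w2, r1, r2}"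
    then obtain k where "w1 - k *\<^sub>R w2 \<in> span {r1, r2}" by (auto simp: span_insert[of w2])
    then show False using lin wzero[of 1 "-k"] by auto
  qed
  have ind: "independent {w1, w2, r1, r2}"
    using n1 n2 B(2) r12(1) by (simp add: independent_insert span_base del: insert_iff) 
  have dist: "card {w1, w2, r1, r2} = 4"
  proof -
    have "w2 \<noteq> r1" "w2 \<noteq> r2" using n2 span_base[of _ "{r1, r2}"] by auto
    moreover have "w1 \<noteq> w2" "w1 \<noteq> r1" "w1 \<noteq> r2" using n1 span_base[of _ "{w2, r1, r2}"] by auto
    ultimately show ?thesis using r12(2) by simp
  qed
  have "P \<subseteq> span {w1, w2, r1, r2}"
  proof
    fix x assume x: "x \<in> P"
    then have xW: "x \<in> W" using PW by blast
    obtain s where s: "s \<in> PR" "\<And>z. z \<in> P \<Longrightarrow> \<beta> x z = \<Omega> s z" using WD[OF xW] by blast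
    obtain a b where ab: "s = a *\<^sub>R r1 + b *\<^sub>R r2" using PRspan[OF s(1)] by blast
    have "x - a *\<^sub>R w1 - b *\<^sub>R w2 \<in> PR"
    proof (intro PRI P_in_radical_if_\<beta>)
      fix z assume z: "z \<in> P"
      have "\<beta> (x - a *\<^sub>R w1 - b *\<^sub>R w2) z = \<Omega> s z - a * \<Omega> r1 z - b * \<Omega> r2 z"
        using wP x z s w1 w2 by (simp add: \<beta>_diff_left \<beta>_scale_left)
      then show "\<beta> (x - a *\<^sub>R w1 - b *\<^sub>R w2) z = 0" using ab r z by (simp add: \<Omega>_add_left \<Omega>_scale_left)
    qed (use x wP in simp_all)
    then obtain c d where "x - a *\<^sub>R w1 - b *\<^sub>R w2 = c *\<^sub>R r1 + d *\<^sub>R r2" using PRspan by blast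
    then have "x = a *\<^sub>R w1 + b *\<^sub>R w2 + (c *\<^sub>R r1 + d *\<^sub>R r2)" by (simp add: algebra_simps)
    moreover have "a *\<^sub>R w1 + b *\<^sub>R w2 + (c *\<^sub>R r1 + d *\<^sub>R r2) \<in> span {w1, w2, r1, r2}"
      by (intro span_add span_scale span_base) auto
    ultimately show "x \<in> span {w1, w2, r1, r2}" by simp
  qed
  moreover have "{w1, w2, r1, r2} \<subseteq> P" using wP r by auto
  ultimately show ?thesis using real_vector.dim_unique[of "{w1, w2, r1, r2}" P 4] ind dist by blast
qed

end

end

end

section \<open>Dimensions of the radical part\<close>

context triple_with_form
begin

lemma semisimple_if_PR_zero: assumes "PR \<subseteq> {0}" shows "lie_semisimple V br"
proof -
  have "r = 0" if r: "r \<in> R" for r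
  proof -
    obtain k p where kp: "k \<in> K" "p \<in> P" "r = k + p" using canonical_decomposition[OF radical_in_carrier[OF r]] by blast
    have R: "k \<in> R" "p \<in> R" using radical_components[of k p] kp r by auto
    have "br k x = 0" if "x \<in> P" for x using br_KR_P[OF kp(1) R(1) that] assms by blast
    then have "k = 0" by (rule faithful[OF kp(1)])
    moreover have "p = 0" using PRI[OF kp(2) R(2)] assms by blast
    ultimately show ?thesis using kp(3) by simp
  qed
  then have "R = {0}" using subspace_0[OF subspace_radical] by blast
  then show ?thesis by (simp add: lie_semisimple_def)
qed

text \<open>
  If \<open>P\<close> is spanned by \<open>PR\<close> and one vector \<open>x\<close>, then \<open>[x,P] \<subseteq> R\<close>.
\<close>
lemma solvable_if_PR_codim_le_1: assumes "dim P \<le> dim PR + 1" shows "lie_solvable V br"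
proof (rule solvable_if_P_radical, rule ccontr)
  assume notR: "\<not> P \<subseteq> R"
  then obtain x where x: "x \<in> P" "x \<notin> R" by blast
  let ?S = "{r + y |r y. r \<in> PR \<and> y \<in> span {x}}"
  have sS: "subspace ?S" by (rule subspace_sums[OF subspace_PR subspace_span])
  have S_P: "?S \<subseteq> P" using PR_P x(1) by (auto simp: span_singleton)
  have PR_S: "PR \<subseteq> ?S"
  proof
    fix r assume "r \<in> PR"
    then have "r = r + 0 \<and> r \<in> PR \<and> 0 \<in> span {x}" by (simp add: span_zero)
    then show "r \<in> ?S" by blast
  qed
  have "x = 0 + x \<and> 0 \<in> PR \<and> x \<in> span {x}" using subspace_0[OF subspace_PR] by (simp add: span_base)
  then have "x \<in> ?S" by blast
  then have "PR \<noteq> ?S" using x(2) PR_R by blast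
  have PV: "P \<subseteq> V" using P_V by blast
  have SV: "?S \<subseteq> V" by (rule subset_trans[OF S_P PV])
  have "\<not> dim ?S \<le> dim PR"
    using fd_subspace_dim_equal[OF finite_dimensional subspace_PR PR_S SV] \<open>PR \<noteq> ?S\<close> by blast
  then have "dim P \<le> dim ?S" using assms by simp
  then have SP: "?S = P" by (rule fd_subspace_dim_equal[OF finite_dimensional sS S_P PV])
  have "x \<in> R"
  proof (rule P_in_radical_if_brackets[OF x(1)])
    fix q assume "q \<in> P"
    then have "q \<in> ?S" using SP by simp
    then obtain r a where q: "q = r + a *\<^sub>R x" "r \<in> PR" by (auto simp: span_singleton)
    then have "br x q = br x r" using x(1) PR_P by (simp add: br_add_right br_scale_right bracket_alternating)
    then show "br x q \<in> R" using br_radical_right PR_R q(2) x(1) by simp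
  qed
  then show False using x(2) by blast
qed

lemma dim_PR_neq_1: "dim PR \<noteq> 1"
proof
  assume d: "dim PR = 1"
  obtain B where B: "B \<subseteq> PR" "independent B" "PR \<subseteq> span B" "card B = dim PR"
    using real_vector.basis_exists by blast
  obtain r0 where r0: "B = {r0}" using B(4) d card_1_singletonE by metis
  have r0PR: "r0 \<in> PR" "r0 \<noteq> 0" using B r0 by (auto simp: dependent_zero)
  have line: "\<exists>a. r = a *\<^sub>R r0" if "r \<in> PR" for r
    using B(3) that by (auto simp: r0 span_singleton)
  have "\<Omega> r s = 0" if "r \<in> PR" "s \<in> PR" for r s
    using line[OF that(1)] line[OF that(2)] PR_P[OF r0PR(1)] by (auto simp: \<Omega>_scale_left \<Omega>_scale_right \<Omega>_self)
  then show False using PR_not_line[OF _ r0PR line] by blast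
qed

text \<open>
  An alternating form on a plane is zero or nondegenerate.
\<close>
lemma PR_isotropic_if_degenerate:
  assumes d: "dim PR = 2" and r: "r \<in> PR" "r \<noteq> 0" "\<And>s. s \<in> PR \<Longrightarrow> \<Omega> s r = 0"
    and st: "s \<in> PR" "t \<in> PR"
  shows "\<Omega> s t = 0"
proof -
  have "independent {r}" using r(2) by (simp add: independent_insert)
  then obtain C where C: "{r} \<subseteq> C" "C \<subseteq> PR" "independent C" "PR \<subseteq> span C"
    using real_vector.maximal_independent_subset_extend[of "{r}" PR] r(1) by blast
  have "card C = 2" using real_vector.basis_card_eq_dim[OF C(2,4,3)] d by simp
  then obtain u where u: "C = {r, u}" using C(1) by (auto simp: card_2_iff)
  have P: "r \<in> P" "u \<in> P" "u \<in> PR" using C(2) u PR_P by auto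
  have form: "\<exists>a b. s = a *\<^sub>R r + b *\<^sub>R u" if "s \<in> PR" for s
  proof -
    have "s \<in> span {r, u}" using C(4) u that by blast
    then show ?thesis by (auto simp: span_insert span_singleton algebra_simps)
  qed
  obtain a b where s: "s = a *\<^sub>R r + b *\<^sub>R u" using form[OF st(1)] by blast
  obtain a' b' where t: "t = a' *\<^sub>R r + b' *\<^sub>R u" using form[OF st(2)] by blast
  have "\<Omega> u r = 0" "\<Omega> r u = 0" using r(3)[OF P(3)] \<Omega>_skew[OF P(1,2)] by auto
  then show ?thesis using P by (simp add: s t \<Omega>_add_left \<Omega>_add_right \<Omega>_scale_left \<Omega>_scale_right \<Omega>_self)
qed

lemma dim_P_4_iff_dim_PR_2:
  assumes not_solvable: "\<not> lie_solvable V br" and not_semisimple: "\<not> lie_semisimple V br"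
    and nofactor: "\<not> (\<exists>L. semisimple_factor V br \<sigma> \<Omega> L)"
  shows "dim P = 4 \<longleftrightarrow> dim PR = 2"
proof
  assume P4: "dim P = 4"
  have "dim PR \<noteq> 0"
  proof
    assume 0: "dim PR = 0"
    have "dim PR \<le> dim {0::'a}" using 0 by simp
    then have "{0} = PR"
      using subspace_0[OF subspace_PR] PR_P P_V
      by (intro fd_subspace_dim_equal[OF finite_dimensional]) auto
    then show False using semisimple_if_PR_zero not_semisimple by blast
  qed
  moreover have "dim PR \<noteq> 1" by (rule dim_PR_neq_1)
  moreover have "\<not> dim P \<le> dim PR + 1" using solvable_if_PR_codim_le_1 not_solvable by blast
  ultimately show "dim PR = 2" using P4 by linarith
next
  assume d: "dim PR = 2"
  show "dim P = 4"
  proof (cases "\<exists>r\<in>PR. r \<noteq> 0 \<and> (\<forall>s\<in>PR. \<Omega> s r = 0)")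
    case True
    then obtain r where r: "r \<in> PR" "r \<noteq> 0" "\<And>s. s \<in> PR \<Longrightarrow> \<Omega> s r = 0" by blast
    show ?thesis by (rule dim_P_if_isotropic[OF PR_isotropic_if_degenerate[OF d r] d nofactor])
  next
    case False
    then have "P \<subseteq> R" by (intro P_radical_if_PR_symplectic nofactor) blast
    then show ?thesis using solvable_if_P_radical not_solvable by blast
  qed
qed

end

theorem theorem4p2p13:
  fixes G :: "'a::real_vector set"
    and br :: "'a \<Rightarrow> 'a \<Rightarrow> 'a"
    and \<sigma> :: "'a \<Rightarrow> 'a"
    and \<Omega> :: "'a \<Rightarrow> 'a \<Rightarrow> real"
  assumes triple: "symplectic_symmetric_triple G br \<sigma> \<Omega>"
    and not_solvable: "\<not> lie_solvable G br"
    and not_semisimple: "\<not> lie_semisimple G br"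
    and no_semisimple_factor: "\<not> (\<exists>L. semisimple_factor G br \<sigma> \<Omega> L)"
  shows "triple_dim G \<sigma> = 4 \<longleftrightarrow> dim (anti_part G \<sigma> \<inter> lie_radical G br) = 2"
proof -
  interpret t: symplectic_symmetric_triple G br \<sigma> \<Omega> by (rule triple)
  obtain \<beta> where "radical_form G br \<beta>" using t.exists_radical_form by blast
  then interpret f: triple_with_form G br \<sigma> \<Omega> \<beta> by (rule triple_with_form.intro[OF triple])
  show ?thesis
    using f.dim_P_4_iff_dim_PR_2[OF not_solvable not_semisimple no_semisimple_factor]
    by (simp add: triple_dim_def f.PR_def)
qed

end
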